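(* Let $\Sigma\subset\mathbb{Z}^N$ be simply connected and let $f:\Sigma\to\mathcal{Z}$ be an $\Omega$-net. Then $f$ lifts a Guichard net (with respect to some choice of point sphere complex) if and only if it is special $\Omega$ with linear conserved quantity $p(t)$ satisfying $(p(t),p(t))=-1-2ct$, for $c$ a non-zero constant.
   Context: Domain: an edge $ij$ of $\Sigma\subset\mathbb{Z}^N$ is a pair of points of $\Sigma$ differing by a standard unit vector; a quadrilateral is an elementary square with all four vertices $i,j,k,\ell$ (in cyclic order) in $\Sigma$. $\Sigma$ is simply connected if any two points are joined by an edge-path in $\Sigma$ and any two edge-paths in $\Sigma$ with the same end-points are related by finitely many moves: (a) replace $i$ by $(iji)$ or conversely, $ij$ an edge; (b) replace $(k\ell i)$ by $(kji)$ on a quadrilateral. A vector-valued $1$-form $\alpha$ assigns $\alpha_{ji}=-\alpha_{ij}$ to each oriented edge from $i$ to $j$; it is closed if $\alpha_{i\ell}+\alpha_{\ell k}+\alpha_{kj}+\alpha_{ji}=0$ on every quadrilateral. $\mathrm{d}x_{ji}=x_j-x_i$. For vector-valued $1$-forms, $(\alpha\curlywedge\beta)_{\ell kji}=\tfrac14\bigl((\alpha_{ji}+\alpha_{k\ell})\wedge(\beta_{\ell i}+\beta_{kj})-(\alpha_{\ell i}+\alpha_{kj})\wedge(\beta_{ji}+\beta_{k\ell})\bigr)$. $\mathbb{R}^{4,2}$ has a form $(\cdot,\cdot)$ of signature $(4,2)$, $\mathcal{Q}$ is the projectivised light cone, $\mathcal{Z}$ the set of totally null $2$-planes; $\mathfrak{o}(4,2)\cong\Lambda^2\mathbb{R}^{4,2}$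 via $(a\wedge b)(z)=(a,z)b-(b,z)a$. $\Omega$-nets: $f:\Sigma\to\mathcal{Z}$ with $f_i\cap f_j\ne\{0\}$ on each edge, regular: (i) $f_{ij}:=f_i+f_j$ is $3$-dimensional, so $s_{ij}:=f_i\cap f_j$ is $1$-dimensional; (ii) on each quadrilateral $s_{ij}\wedge s_{jk}\wedge s_{k\ell}\wedge s_{\ell i}\ne\{0\}$; and applicable (equivalently, spanned by Koenigs dual sections): there is a closed $\Lambda^2\mathbb{R}^{4,2}$-valued $1$-form $\eta$ with $\eta_{ij}\in\Lambda^2f_{ij}$, $\eta_{ij}\wedge s_{ij}\neq\{0\}$ on each edge. Isothermic nets: a map $s$ to $\mathcal{Q}$ (null line subbundle), regular: on each quadrilateral $s_i,s_j,s_k,s_\ell$ are pairwise distinct, $\dim(s_i+s_j+s_k+s_\ell)\ge3$, $s_i\not\perp s_k$, $s_j\not\perp s_\ell$; with a closed, never-zero $\Lambda^2\mathbb{R}^{4,2}$-valued $1$-form $\eta$ with $\eta_{ji}\in s_j\wedge s_i$ on each edge. Writing $\eta_{ji}=\mu_j\wedge\mu_i$ ($\mu_i\in s_i$, $\mu_j\in s_j$), put $m_{ij}=1/(\mu_i,\mu_j)\in\mathbb{R}^\times\cup\{\infty\}$. For $t\ne m_{ij}$, $\Gamma^s(t)_{ji}\in\mathrm{O}(4,2)$ is, if $m_{ij}\ne\infty$, the map acting as $1-t/m_{ij}$ on $s_j$, as $1$ on $(s_i\oplus s_j)^\perp$ and as $(1-t/m_{ij})^{-1}$ on $s_i$; if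 $m_{ij}=\infty$ it is $\exp(t\eta_{ji})$. All this applies to nets on $\{0,1\}\times\Sigma\subset\mathbb{Z}^{N+1}$. A polynomial conserved quantity of degree $d$ of an isothermic net $s$ is $p(t)=\sum_{n=0}^dp^{(n)}t^n$, with $p^{(n)}$ $\mathbb{R}^{4,2}$-valued functions on the domain of $s$, $p^{(d)}$ not identically zero, such that $\Gamma^s(t)_{ji}p(t)_i=p(t)_j$ on all edges (for all $t$ for which $\Gamma^s(t)$ is defined). Linear means $d=1$. An $\Omega$-net $f$ is special $\Omega$ of type $d$ if $f=s^+\oplus s^-$ with isothermic nets $s^\pm$ such that $s=s^+\sqcup s^-:\{0,1\}\times\Sigma\to\mathcal{Q}$ (equal to $s^+$ on $\{0\}\times\Sigma$ and $s^-$ on $\{1\}\times\Sigma$) is isothermic with a polynomial conserved quantity of degree $d$; that conserved quantity $p(t)$ of $s$ is meant in the claim. Lifting: for a choice of $\mathfrak{p}$ with $(\mathfrak{p},\mathfrak{p})=-1$ (point sphere complex) and null $\mathfrak{o},\mathfrak{q}\perp\mathfrak{p}$, $(\mathfrak{o},\mathfrak{q})=-1$, so $\langle\mathfrak{o},\mathfrak{q}\rangle^\perp=\mathbb{R}^3\oplus\langle\mathfrak{p}\rangle$, a map $(x,n):\Sigma\to\mathbb{R}^3\times S^2$ is a principal net if on each edge $\kappa_{ij}x_i+n_i=\kappa_{ij}x_j+n_j$ for some $\kappa_{ij}\in\mathbb{R}^\times$, and $f$ lifts $(x,n)$ if $f=\langle\mathfrak{o}+x+\tfrac12(x,x)\mathfrak{q},\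 n+\mathfrak{p}+(x,n)\mathfrak{q}\rangle$. $(x,n)$ is Guichard if there is $\check x:\Sigma\to\mathbb{R}^3$ with $\mathrm{d}\check x_{ij}\parallel\mathrm{d}x_{ij}$ on each edge and $\mathrm{d}\check x\curlywedge\mathrm{d}x+\mathrm{d}n\curlywedge\mathrm{d}n=0$; non-degeneracy $\mathrm{d}\check x_{ji}\neq\kappa_{ij}\mathrm{d}n_{ji}$ of the associated $\Omega$-structure is assumed. Standing genericity assumption on the point sphere complexes and $\mathfrak{q}$ used (in the converse the point sphere complex is the constant vector $p^{(0)}$): $f_i^\perp\cap\langle\mathfrak{p},\mathfrak{q}\rangle=\{0\}$ for all $i$ and no $s_{ij}$ lies in $\mathfrak{p}^\perp$ or $\mathfrak{q}^\perp$.
   Formalization: The Guichard net is also required, on every quadrilateral, to have the four points of x not all on a line and (dx̌,dx)+(dn,dn) different on adjacent edges; without such a condition a Guichard net need not lift to a special Ω-net. *)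

theory Defs
  imports "HOL-Analysis.Analysis"
begin

section \<open>Domains in the integer lattice\<close>

definition edge :: "(int ^ 'n) set \<Rightarrow> int ^ 'n \<Rightarrow> int ^ 'n \<Rightarrow> bool" where
  "edge S i j \<longleftrightarrow> i \<in> S \<and> j \<in> S \<and> (\<exists>a. j = i + axis a 1 \<or> i = j + axis a 1)"

text \<open>Elementary squares, vertices in cyclic order, with any starting vertex and either orientation.\<close>

definition quad :: "(int ^ 'n) set \<Rightarrow> int ^ 'n \<Rightarrow> int ^ 'n \<Rightarrow> int ^ 'n \<Rightarrow> int ^ 'n \<Rightarrow> bool" where
  "quad S i j k l \<longleftrightarrow> {i, j, k, l} \<subseteq> S \<and>
     (\<exists>a b. a \<noteq> b \<and> (\<exists>u\<in>{axis a 1, - axis a 1}. \<exists>v\<in>{axis b 1, - axis b 1}.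
        j = i + u \<and> k = i + u + v \<and> l = i + v))"

definition edge_path :: "(int ^ 'n) set \<Rightarrow> (int ^ 'n) list \<Rightarrow> bool" where
  "edge_path S xs \<longleftrightarrow> xs \<noteq> [] \<and> set xs \<subseteq> S \<and> successively (edge S) xs"

inductive path_move :: "(int ^ 'n) set \<Rightarrow> (int ^ 'n) list \<Rightarrow> (int ^ 'n) list \<Rightarrow> bool"
  for S :: "(int ^ 'n) set" where
  spur: "edge S i j \<Longrightarrow> path_move S (xs @ [i] @ ys) (xs @ [i, j, i] @ ys)"
| flip: "quad S i j k l \<Longrightarrow> path_move S (xs @ [k, l, i] @ ys) (xs @ [k, j, i] @ ys)"

definition simply_connected_domain :: "(int ^ 'n) set \<Rightarrow> bool" where
  "simply_connected_domain S \<longleftrightarrow> S \<noteq> {} \<and>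
     (\<forall>i\<in>S. \<forall>j\<in>S. \<exists>xs. edge_path S xs \<and> hd xs = i \<and> last xs = j) \<and>
     (\<forall>xs ys. edge_path S xs \<and> edge_path S ys \<and> hd xs = hd ys \<and> last xs = last ys
        \<longrightarrow> equivclp (path_move S) xs ys)"

text \<open>The domain \<open>{0,1} \<times> S\<close>; the additional coordinate is the one indexed by \<open>None\<close>.\<close>

definition base_pt :: "int ^ ('n option) \<Rightarrow> int ^ 'n" where
  "base_pt z = (\<chi> a. z $ Some a)"

definition doubled :: "(int ^ 'n) set \<Rightarrow> (int ^ ('n option)) set" where
  "doubled S = {z. z $ None \<in> {0, 1} \<and> base_pt z \<in> S}"

definition join :: "(int ^ 'n \<Rightarrow> 'v) \<Rightarrow> (int ^ 'n \<Rightarrow> 'v) \<Rightarrow> int ^ ('n option) \<Rightarrow> 'v" where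
  "join sp sm z = (if z $ None = 0 then sp (base_pt z) else sm (base_pt z))"

section \<open>The space of signature (4,2) and its exterior algebra\<close>

type_synonym r42 = "(real ^ 4) \<times> (real ^ 2)"

definition form42 :: "r42 \<Rightarrow> r42 \<Rightarrow> real" where
  "form42 u v = fst u \<bullet> fst v - snd u \<bullet> snd v"

definition perp :: "r42 set \<Rightarrow> r42 set" where
  "perp U = {v. \<forall>u\<in>U. form42 u v = 0}"

definition null_lines :: "r42 set set" where
  "null_lines = {L. subspace L \<and> dim L = 1 \<and> (\<forall>u\<in>L. form42 u u = 0)}"

definition null_planes :: "r42 set set" where
  "null_planes = {L. subspace L \<and> dim L = 2 \<and> (\<forall>u\<in>L. \<forall>v\<in>L. form42 u v = 0)}"

text \<open>Bivectors are skew endomorphisms, as in the identification of the second exterior power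
  with the orthogonal Lie algebra.\<close>

type_synonym bivector = "r42 \<Rightarrow>\<^sub>L r42"

definition wedge :: "r42 \<Rightarrow> r42 \<Rightarrow> bivector" where
  "wedge a b = Blinfun (\<lambda>z. form42 a z *\<^sub>R b - form42 b z *\<^sub>R a)"

lemma bounded_linear_form42: "bounded_linear (form42 a)"
  unfolding form42_def
  by (intro bounded_linear_sub bounded_linear_compose[OF bounded_linear_inner_right]
        bounded_linear_fst bounded_linear_snd)

lemma wedge_apply: "blinfun_apply (wedge a b) z = form42 a z *\<^sub>R b - form42 b z *\<^sub>R a"
  unfolding wedge_def
  by (subst bounded_linear_Blinfun_apply)
     (intro bounded_linear_sub bounded_linear_compose[OF bounded_linear_scaleR_left]
        bounded_linear_form42, simp)

definition ext2 :: "r42 set \<Rightarrow> bivector set" where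
  "ext2 U = span {wedge a b | a b. a \<in> U \<and> b \<in> U}"

text \<open>Trivectors and quadrivectors are represented, through the metric, by alternating
  multilinear forms, with \<open>a\<^sub>1 \<and> \<dots> \<and> a\<^sub>k\<close> corresponding to
  \<open>(z\<^sub>1, \<dots>, z\<^sub>k) \<mapsto> det (a\<^sub>p, z\<^sub>q)\<close>. A bivector \<open>\<beta>\<close> is then the 2-form
  \<open>(x, y) \<mapsto> (\<beta> x, y)\<close>.\<close>

definition wedge_vec :: "bivector \<Rightarrow> r42 \<Rightarrow> (r42 \<Rightarrow> r42 \<Rightarrow> r42 \<Rightarrow> real)" where
  "wedge_vec \<beta> v = (\<lambda>x y z. form42 (blinfun_apply \<beta> x) y * form42 v z
                        + form42 (blinfun_apply \<beta> y) z * form42 v x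
                        + form42 (blinfun_apply \<beta> z) x * form42 v y)"

definition wedge4 :: "r42 \<Rightarrow> r42 \<Rightarrow> r42 \<Rightarrow> r42 \<Rightarrow> (r42 ^ 4 \<Rightarrow> real)" where
  "wedge4 a b c d =
     (\<lambda>z. det ((\<chi> p q. form42 ((vector [a, b, c, d] :: r42 ^ 4) $ p) (z $ q)) :: real ^ 4 ^ 4))"

section \<open>Discrete 1-forms\<close>

text \<open>A 1-form \<open>\<alpha>\<close> is used in the notation \<open>\<alpha> j i\<close> for the value on the
  oriented edge from \<open>i\<close> to \<open>j\<close>; values off the edges of the domain are irrelevant.\<close>

definition closed_form :: "(int ^ 'n) set \<Rightarrow> (int ^ 'n \<Rightarrow> int ^ 'n \<Rightarrow> 'v::real_vector) \<Rightarrow> bool" where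
  "closed_form S \<alpha> \<longleftrightarrow> (\<forall>i j. edge S i j \<longrightarrow> \<alpha> j i = - \<alpha> i j) \<and>
     (\<forall>i j k l. quad S i j k l \<longrightarrow> \<alpha> i l + \<alpha> l k + \<alpha> k j + \<alpha> j i = 0)"

definition df :: "(int ^ 'n \<Rightarrow> 'v::real_vector) \<Rightarrow> int ^ 'n \<Rightarrow> int ^ 'n \<Rightarrow> 'v" where
  "df x j i = x j - x i"

definition form_wedge :: "(int ^ 'n \<Rightarrow> int ^ 'n \<Rightarrow> r42) \<Rightarrow> (int ^ 'n \<Rightarrow> int ^ 'n \<Rightarrow> r42)
    \<Rightarrow> int ^ 'n \<Rightarrow> int ^ 'n \<Rightarrow> int ^ 'n \<Rightarrow> int ^ 'n \<Rightarrow> bivector" where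
  "form_wedge \<alpha> \<beta> l k j i = (1/4) *\<^sub>R
     (wedge (\<alpha> j i + \<alpha> k l) (\<beta> l i + \<beta> k j) - wedge (\<alpha> l i + \<alpha> k j) (\<beta> j i + \<beta> k l))"

section \<open>Omega-nets\<close>

definition omega_regular :: "(int ^ 'n) set \<Rightarrow> (int ^ 'n \<Rightarrow> r42 set) \<Rightarrow> bool" where
  "omega_regular S f \<longleftrightarrow>
     (\<forall>i j. edge S i j \<longrightarrow> dim (span (f i \<union> f j)) = 3) \<and>
     (\<forall>i j k l. quad S i j k l \<longrightarrow>
        (\<exists>a\<in>f i \<inter> f j. \<exists>b\<in>f j \<inter> f k. \<exists>c\<in>f k \<inter> f l. \<exists>d\<in>f l \<inter> f i.
           wedge4 a b c d \<noteq> (\<lambda>_. 0)))"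

definition applicable :: "(int ^ 'n) set \<Rightarrow> (int ^ 'n \<Rightarrow> r42 set) \<Rightarrow> bool" where
  "applicable S f \<longleftrightarrow> (\<exists>\<eta>. closed_form S \<eta> \<and>
     (\<forall>i j. edge S i j \<longrightarrow> \<eta> i j \<in> ext2 (span (f i \<union> f j)) \<and>
        (\<exists>v\<in>f i \<inter> f j. wedge_vec (\<eta> i j) v \<noteq> (\<lambda>_ _ _. 0))))"

definition omega_net :: "(int ^ 'n) set \<Rightarrow> (int ^ 'n \<Rightarrow> r42 set) \<Rightarrow> bool" where
  "omega_net S f \<longleftrightarrow> (\<forall>i\<in>S. f i \<in> null_planes) \<and>
     (\<forall>i j. edge S i j \<longrightarrow> f i \<inter> f j \<noteq> {0}) \<and>
     omega_regular S f \<and> applicable S f"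

section \<open>Isothermic nets and polynomial conserved quantities\<close>

definition isothermic_regular :: "(int ^ 'n) set \<Rightarrow> (int ^ 'n \<Rightarrow> r42 set) \<Rightarrow> bool" where
  "isothermic_regular S s \<longleftrightarrow> (\<forall>i j k l. quad S i j k l \<longrightarrow>
     distinct [s i, s j, s k, s l] \<and> dim (span (s i \<union> s j \<union> s k \<union> s l)) \<ge> 3 \<and>
     \<not> s i \<subseteq> perp (s k) \<and> \<not> s j \<subseteq> perp (s l))"

definition isothermic_with ::
  "(int ^ 'n) set \<Rightarrow> (int ^ 'n \<Rightarrow> r42 set) \<Rightarrow> (int ^ 'n \<Rightarrow> int ^ 'n \<Rightarrow> bivector) \<Rightarrow> bool" where
  "isothermic_with S s \<eta> \<longleftrightarrow> (\<forall>i\<in>S. s i \<in> null_lines) \<and> isothermic_regular S s \<and>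
     closed_form S \<eta> \<and>
     (\<forall>i j. edge S i j \<longrightarrow> \<eta> j i \<noteq> 0 \<and> (\<exists>v\<in>s j. \<exists>u\<in>s i. \<eta> j i = wedge v u))"

definition isothermic :: "(int ^ 'n) set \<Rightarrow> (int ^ 'n \<Rightarrow> r42 set) \<Rightarrow> bool" where
  "isothermic S s \<longleftrightarrow> (\<exists>\<eta>. isothermic_with S s \<eta>)"

text \<open>The inverse \<open>1/m\<^sub>i\<^sub>j = (\<mu>\<^sub>i, \<mu>\<^sub>j)\<close> of the edge label; it vanishes
  exactly for the label \<open>\<infinity>\<close>.\<close>

definition inv_label ::
  "(int ^ 'n \<Rightarrow> r42 set) \<Rightarrow> (int ^ 'n \<Rightarrow> int ^ 'n \<Rightarrow> bivector) \<Rightarrow> int ^ 'n \<Rightarrow> int ^ 'n \<Rightarrow> real" where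
  "inv_label s \<eta> i j = (THE r. \<exists>u\<in>s i. \<exists>v\<in>s j. \<eta> j i = wedge v u \<and> r = form42 u v)"

definition op_exp :: "bivector \<Rightarrow> r42 \<Rightarrow> r42" where
  "op_exp A v = (\<Sum>n. (1 / fact n) *\<^sub>R (blinfun_apply A ^^ n) v)"

text \<open>Only meaningful for \<open>t \<noteq> m\<^sub>i\<^sub>j\<close>, that is \<open>t * inv_label s \<eta> i j \<noteq> 1\<close>.\<close>

definition gamma_map :: "(int ^ 'n \<Rightarrow> r42 set) \<Rightarrow> (int ^ 'n \<Rightarrow> int ^ 'n \<Rightarrow> bivector)
    \<Rightarrow> real \<Rightarrow> int ^ 'n \<Rightarrow> int ^ 'n \<Rightarrow> r42 \<Rightarrow> r42" where
  "gamma_map s \<eta> t j i = (let r = inv_label s \<eta> i j in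
     if r = 0 then op_exp (t *\<^sub>R \<eta> j i)
     else (THE G. linear G \<and>
        (\<forall>v\<in>s j. G v = (1 - t * r) *\<^sub>R v) \<and>
        (\<forall>v\<in>perp (s i \<union> s j). G v = v) \<and>
        (\<forall>v\<in>s i. G v = inverse (1 - t * r) *\<^sub>R v)))"

definition poly_section :: "nat \<Rightarrow> (nat \<Rightarrow> int ^ 'n \<Rightarrow> r42) \<Rightarrow> real \<Rightarrow> int ^ 'n \<Rightarrow> r42" where
  "poly_section d p t i = (\<Sum>n\<le>d. t ^ n *\<^sub>R p n i)"

definition conserved_quantity :: "(int ^ 'n) set \<Rightarrow> (int ^ 'n \<Rightarrow> r42 set)
    \<Rightarrow> (int ^ 'n \<Rightarrow> int ^ 'n \<Rightarrow> bivector) \<Rightarrow> nat \<Rightarrow> (nat \<Rightarrow> int ^ 'n \<Rightarrow> r42) \<Rightarrow> bool" where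
  "conserved_quantity S s \<eta> d p \<longleftrightarrow> (\<exists>i\<in>S. p d i \<noteq> 0) \<and>
     (\<forall>i j t. edge S i j \<and> t * inv_label s \<eta> i j \<noteq> 1 \<longrightarrow>
        gamma_map s \<eta> t j i (poly_section d p t i) = poly_section d p t j)"

text \<open>\<open>f\<close> is special of type \<open>d\<close>, as witnessed by the conserved quantity \<open>p\<close>.\<close>

definition special_omega_with :: "(int ^ 'n) set \<Rightarrow> (int ^ 'n \<Rightarrow> r42 set) \<Rightarrow> nat
    \<Rightarrow> (nat \<Rightarrow> int ^ ('n option) \<Rightarrow> r42) \<Rightarrow> bool" where
  "special_omega_with S f d p \<longleftrightarrow> (\<exists>sp sm \<eta>.
     isothermic S sp \<and> isothermic S sm \<and>
     (\<forall>i\<in>S. f i = span (sp i \<union> sm i) \<and> sp i \<inter> sm i = {0}) \<and>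
     isothermic_with (doubled S) (join sp sm) \<eta> \<and>
     conserved_quantity (doubled S) (join sp sm) \<eta> d p)"

section \<open>Guichard nets and their lifts\<close>

definition lie_frame :: "r42 \<Rightarrow> r42 \<Rightarrow> r42 \<Rightarrow> bool" where
  "lie_frame \<pp> \<oo> \<qq> \<longleftrightarrow> form42 \<pp> \<pp> = -1 \<and> form42 \<oo> \<oo> = 0 \<and> form42 \<qq> \<qq> = 0 \<and>
     form42 \<oo> \<pp> = 0 \<and> form42 \<qq> \<pp> = 0 \<and> form42 \<oo> \<qq> = -1"

text \<open>Euclidean 3-space is the positive definite subspace \<open>perp {\<pp>, \<oo>, \<qq>}\<close>.\<close>

definition principal_net :: "(int ^ 'n) set \<Rightarrow> r42 \<Rightarrow> r42 \<Rightarrow> r42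
    \<Rightarrow> (int ^ 'n \<Rightarrow> r42) \<Rightarrow> (int ^ 'n \<Rightarrow> r42) \<Rightarrow> bool" where
  "principal_net S \<pp> \<oo> \<qq> x n \<longleftrightarrow>
     (\<forall>i\<in>S. x i \<in> perp {\<pp>, \<oo>, \<qq>} \<and> n i \<in> perp {\<pp>, \<oo>, \<qq>} \<and> form42 (n i) (n i) = 1) \<and>
     (\<forall>i j. edge S i j \<longrightarrow> (\<exists>\<kappa>. \<kappa> \<noteq> 0 \<and> \<kappa> *\<^sub>R x i + n i = \<kappa> *\<^sub>R x j + n j))"

definition lifts :: "(int ^ 'n) set \<Rightarrow> r42 \<Rightarrow> r42 \<Rightarrow> r42
    \<Rightarrow> (int ^ 'n \<Rightarrow> r42 set) \<Rightarrow> (int ^ 'n \<Rightarrow> r42) \<Rightarrow> (int ^ 'n \<Rightarrow> r42) \<Rightarrow> bool" where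
  "lifts S \<pp> \<oo> \<qq> f x n \<longleftrightarrow> (\<forall>i\<in>S.
     f i = span {\<oo> + x i + (form42 (x i) (x i) / 2) *\<^sub>R \<qq>, n i + \<pp> + form42 (x i) (n i) *\<^sub>R \<qq>})"

text \<open>\<open>y\<close> is an associate net of the principal net \<open>(x, n)\<close>, which is Guichard if there is one.\<close>

definition guichard_associate :: "(int ^ 'n) set \<Rightarrow> r42 \<Rightarrow> r42 \<Rightarrow> r42
    \<Rightarrow> (int ^ 'n \<Rightarrow> r42) \<Rightarrow> (int ^ 'n \<Rightarrow> r42) \<Rightarrow> (int ^ 'n \<Rightarrow> r42) \<Rightarrow> bool" where
  "guichard_associate S \<pp> \<oo> \<qq> x n y \<longleftrightarrow> (\<forall>i\<in>S. y i \<in> perp {\<pp>, \<oo>, \<qq>}) \<and>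
     (\<forall>i j. edge S i j \<longrightarrow> (\<exists>r. df y i j = r *\<^sub>R df x i j)) \<and>
     (\<forall>i j k l. quad S i j k l \<longrightarrow>
        form_wedge (df y) (df x) l k j i + form_wedge (df n) (df n) l k j i = 0)"

definition edge_nondegenerate :: "(int ^ 'n) set
    \<Rightarrow> (int ^ 'n \<Rightarrow> r42) \<Rightarrow> (int ^ 'n \<Rightarrow> r42) \<Rightarrow> (int ^ 'n \<Rightarrow> r42) \<Rightarrow> bool" where
  "edge_nondegenerate S x n y \<longleftrightarrow> (\<forall>i j \<kappa>. edge S i j \<and> \<kappa> \<noteq> 0 \<and>
     \<kappa> *\<^sub>R x i + n i = \<kappa> *\<^sub>R x j + n j \<longrightarrow> df y j i \<noteq> \<kappa> *\<^sub>R df n j i)"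

text \<open>Non-degeneracy on quadrilaterals. The number \<open>(dy, dx) + (dn, dn)\<close> on an edge is a constant
  multiple of the inverse edge label \<open>1/m\<close> of the associated Omega-structure (so
  \<open>edge_nondegenerate\<close> says that it does not vanish); where the labels of two adjacent edges of a
  quadrilateral agree, opposite points of any isothermic net spanning that structure are
  orthogonal. On a quadrilateral of \<open>x\<close> contained in a line, that is, one for which \<open>\<qq>\<close> lies in the
  span of the four null planes, the Guichard condition holds trivially and does not imply that
  the associated 1-form is closed.\<close>

definition quad_nondegenerate :: "(int ^ 'n) set
    \<Rightarrow> (int ^ 'n \<Rightarrow> r42) \<Rightarrow> (int ^ 'n \<Rightarrow> r42) \<Rightarrow> (int ^ 'n \<Rightarrow> r42) \<Rightarrow> bool" where
  "quad_nondegenerate S x n y \<longleftrightarrow> (\<forall>i j k l. quad S i j k l \<longrightarrow>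
     \<not> collinear {x i, x j, x k, x l} \<and>
     form42 (df y j i) (df x j i) + form42 (df n j i) (df n j i) \<noteq>
     form42 (df y k j) (df x k j) + form42 (df n k j) (df n k j))"

definition edges_generic :: "(int ^ 'n) set \<Rightarrow> (int ^ 'n \<Rightarrow> r42 set) \<Rightarrow> r42 \<Rightarrow> bool" where
  "edges_generic S f v \<longleftrightarrow> (\<forall>i j. edge S i j \<longrightarrow> \<not> f i \<inter> f j \<subseteq> perp {v})"

definition generic :: "(int ^ 'n) set \<Rightarrow> (int ^ 'n \<Rightarrow> r42 set) \<Rightarrow> r42 \<Rightarrow> r42 \<Rightarrow> bool" where
  "generic S f \<pp> \<qq> \<longleftrightarrow> (\<forall>i\<in>S. perp (f i) \<inter> span {\<pp>, \<qq>} = {0}) \<and>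
     edges_generic S f \<pp> \<and> edges_generic S f \<qq>"

definition lifts_guichard :: "(int ^ 'n) set \<Rightarrow> (int ^ 'n \<Rightarrow> r42 set) \<Rightarrow> bool" where
  "lifts_guichard S f \<longleftrightarrow> (\<exists>\<pp> \<oo> \<qq> x n y. lie_frame \<pp> \<oo> \<qq> \<and> generic S f \<pp> \<qq> \<and>
     principal_net S \<pp> \<oo> \<qq> x n \<and> lifts S \<pp> \<oo> \<qq> f x n \<and>
     guichard_associate S \<pp> \<oo> \<qq> x n y \<and>
     edge_nondegenerate S x n y \<and> quad_nondegenerate S x n y)"

end

theory Submission
  imports Defs
begin

text \<open>
  Both sides of the equivalence are read off from one closed 1-form. If \<open>f\<close> lifts \<open>(x, n)\<close>, write
  \<open>X\<close> and \<open>N\<close> for the point spheres and the tangent planes, which span the null planes \<open>f\<close>.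
  On each edge the curvature sphere is \<open>\<kappa> X i + N i = \<kappa> X j + N j\<close>. An edge-parallel net
  \<open>dy = \<rho> dx\<close> gives the bivector-valued 1-form \<open>\<rho> X j \<and> X i + N j \<and> N i\<close>. The Euclidean part of its
  closing condition is the Guichard condition, and on quadrilaterals that are not collinear the
  Euclidean part implies the rest (\<open>omega_form_closes\<close>).

  From a Guichard net to a conserved quantity: for \<open>g = N + a X\<close> the product \<open>g j \<and> g i\<close> differs from
  this 1-form by an exact term exactly if \<open>(a i - \<kappa>) (a j - \<kappa>) = \<rho> + \<kappa>\<^sup>2\<close> (\<open>edge_wedge\<close>). This is a Moebius
  involution along each edge, and closedness makes it flat on quadrilaterals (\<open>moebius_flat\<close>). On a
  simply connected domain it therefore has solutions, finite for all but countably many initial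
  values (\<open>moebius_transport\<close>). Two solutions that differ everywhere give isothermic nets spanning
  \<open>f\<close>; on the doubled domain the 1-form is again \<open>g j \<and> g i\<close>, since the Moebius relation also
  closes it on the vertical quadrilaterals, and \<open>\<pp> + t g\<close> is a conserved quantity with norm
  \<open>-1 - 2 t\<close> (\<open>null_koenigs_conserved\<close>).

  From a conserved quantity to a Guichard net: expanding in \<open>t\<close> shows that \<open>p 0\<close> is a constant \<open>\<pp>\<close>, that
  \<open>p 1\<close> has the difference \<open>\<eta> \<pp>\<close>, and that \<open>p 1\<close> is orthogonal to \<open>f\<close> (\<open>linear_conserved_quantityD\<close>).
  Being null, it lies in \<open>f\<close>, because null planes are maximal. After a choice of \<open>\<qq>\<close> off countably
  many hyperplanes (\<open>null_vector_in_general_position\<close>) one can write \<open>p 1 = c (N + a X)\<close>, and the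
  equation for \<open>p 1\<close> forces \<open>\<eta> / c\<close> to be \<open>\<rho> X j \<and> X i + N j \<and> N i\<close> plus an exact term
  (\<open>isothermic_edge_form\<close>). Contracting the closed form with \<open>\<qq>\<close> and integrating yields the associate
  net. Regularity of the isothermic nets translates into the non-degeneracy conditions; in
  particular, labels of adjacent edges differ (\<open>isothermic_adjacent_labels\<close>).
\<close>

section \<open>Linear algebra in signature (4,2)\<close>

lemma form42_commute: "form42 u v = form42 v u"
  by (simp add: form42_def inner_commute)

lemma form42_add_left: "form42 (u + v) w = form42 u w + form42 v w"
  and form42_add_right: "form42 w (u + v) = form42 w u + form42 w v"
  and form42_diff_left: "form42 (u - v) w = form42 u w - form42 v w"
  and form42_diff_right: "form42 w (u - v) = form42 w u - form42 w v"
  and form42_minus_left: "form42 (- u) w = - form42 u w"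
  and form42_minus_right: "form42 w (- u) = - form42 w u"
  and form42_scale_left: "form42 (r *\<^sub>R u) w = r * form42 u w"
  and form42_scale_right: "form42 w (r *\<^sub>R u) = r * form42 w u"
  and form42_zero_left: "form42 0 w = 0"
  and form42_zero_right: "form42 w 0 = 0"
  by (simp_all add: form42_def inner_add_left inner_add_right inner_diff_left inner_diff_right
      algebra_simps)

lemmas form42_simps = form42_add_left form42_add_right form42_diff_left form42_diff_right
  form42_minus_left form42_minus_right form42_scale_left form42_scale_right
  form42_zero_left form42_zero_right

text \<open>Changing the sign of the second component turns the form into the Euclidean inner product;
  orthogonal projection then yields linear functionals that separate a vector from a subspace.\<close>

lemma form42_separates:
  assumes "v \<notin> span W"
  shows "\<exists>z. (\<forall>w\<in>span W. form42 z w = 0) \<and> form42 z v \<noteq> 0"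
proof -
  obtain y z where yz: "y \<in> span W" "\<And>w. w \<in> span W \<Longrightarrow> orthogonal z w" "v = y + z"
    using orthogonal_subspace_decomp_exists[of W v] by blast
  have z0: "z \<noteq> 0" using yz assms by auto
  let ?z = "(fst z, - snd z)"
  have f: "form42 ?z w = z \<bullet> w" for w
    by (simp add: form42_def inner_prod_def)
  have "z \<bullet> v = z \<bullet> z" using yz by (simp add: orthogonal_def inner_add_right)
  then show ?thesis using yz z0 f by (intro exI[of _ ?z]) (auto simp: orthogonal_def)
qed

lemma form42_nondegenerate:
  assumes "\<And>w. form42 w u = 0"
  shows "u = 0"
  using form42_separates[of u "{}"] assms by auto

lemma form42_eqI:
  assumes "\<And>w. form42 w u = form42 w v"
  shows "u = v"
  using form42_nondegenerate[of "u - v"] assms by (simp add: form42_simps)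

text \<open>Three vectors always have a nontrivial combination without negative part. All bounds on the
  dimension of isotropic subspaces below come from this.\<close>

lemma snd_dependent:
  fixes a b c :: r42
  shows "\<exists>\<alpha> \<beta> \<gamma>. (\<alpha>, \<beta>, \<gamma>) \<noteq> (0, 0, 0) \<and> snd (\<alpha> *\<^sub>R a + \<beta> *\<^sub>R b + \<gamma> *\<^sub>R c) = 0"
proof -
  define cr where "cr u v = u $ 1 * v $ 2 - u $ 2 * v $ 1" for u v :: "real ^ 2"
  let ?a = "snd a" and ?b = "snd b" and ?c = "snd c"
  consider "?a = 0" | "?a \<noteq> 0" "cr ?a ?b = 0" | "cr ?a ?b \<noteq> 0" by blast
  then show ?thesis
  proof cases
    case 1
    then show ?thesis by (intro exI[of _ 1] exI[of _ 0]) auto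
  next
    case 2
    have "(?a \<bullet> ?b) *\<^sub>R ?a - (?a \<bullet> ?a) *\<^sub>R ?b = 0"
    proof -
      have e: "?a $ 1 * ?b $ 2 = ?a $ 2 * ?b $ 1" using 2 by (simp add: cr_def)
      have "?a $ 2 * (?b $ 2 * ?a $ 1) = ?a $ 2 * (?a $ 2 * ?b $ 1)"
        "?a $ 1 * (?b $ 1 * ?a $ 2) = ?a $ 1 * (?a $ 1 * ?b $ 2)"
        using e by (simp_all add: mult_ac)
      then show ?thesis
        by (simp add: vec_eq_iff forall_2 inner_vec_def sum_2 algebra_simps)
    qed
    then show ?thesis using 2
      by (intro exI[of _ "?a \<bullet> ?b"] exI[of _ "- (?a \<bullet> ?a)"] exI[of _ 0]) auto
  next
    case 3
    have "cr ?b ?c *\<^sub>R ?a + cr ?c ?a *\<^sub>R ?b + cr ?a ?b *\<^sub>R ?c = 0"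
      by (simp add: vec_eq_iff forall_2 cr_def algebra_simps)
    then show ?thesis using 3
      by (intro exI[of _ "cr ?b ?c"] exI[of _ "cr ?c ?a"] exI[of _ "cr ?a ?b"]) auto
  qed
qed

lemma nonpositive_no_negative_part:
  assumes "snd w = 0" and "form42 w w \<le> 0"
  shows "w = 0"
proof -
  have "fst w \<bullet> fst w \<le> 0" using assms by (simp add: form42_def)
  then have "fst w = 0" by (metis inner_ge_zero inner_eq_zero_iff order_antisym)
  then show ?thesis using assms by (simp add: prod_eq_iff)
qed

lemma null_dependent_3:
  assumes "form42 a a = 0" "form42 b b = 0" "form42 c c = 0"
    and "form42 a b = 0" "form42 b c = 0" "form42 a c = 0"
  shows "\<exists>\<alpha> \<beta> \<gamma>. (\<alpha>, \<beta>, \<gamma>) \<noteq> (0, 0, 0) \<and> \<alpha> *\<^sub>R a + \<beta> *\<^sub>R b + \<gamma> *\<^sub>R c = 0"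
proof -
  obtain \<alpha> \<beta> \<gamma> where *: "(\<alpha>, \<beta>, \<gamma>) \<noteq> (0, 0, 0)" "snd (\<alpha> *\<^sub>R a + \<beta> *\<^sub>R b + \<gamma> *\<^sub>R c) = 0"
    using snd_dependent by blast
  have "form42 (\<alpha> *\<^sub>R a + \<beta> *\<^sub>R b + \<gamma> *\<^sub>R c) (\<alpha> *\<^sub>R a + \<beta> *\<^sub>R b + \<gamma> *\<^sub>R c) = 0"
    using assms form42_commute[of b a] form42_commute[of c b] form42_commute[of c a]
    by (simp add: form42_simps)
  then show ?thesis using * nonpositive_no_negative_part by (metis order_refl)
qed

text \<open>In the orthogonal complement of a timelike vector the signature is (4,1), so that null
  vectors which are orthogonal are proportional.\<close>

lemma null_dependent_2:
  assumes "form42 a a = 0" "form42 b b = 0" "form42 a b = 0"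
    and "form42 p a = 0" "form42 p b = 0" "form42 p p = -1"
  shows "\<exists>\<alpha> \<beta>. (\<alpha>, \<beta>) \<noteq> (0, 0) \<and> \<alpha> *\<^sub>R a + \<beta> *\<^sub>R b = 0"
proof -
  obtain \<alpha> \<beta> \<gamma> where *: "(\<alpha>, \<beta>, \<gamma>) \<noteq> (0, 0, 0)" "snd (\<alpha> *\<^sub>R a + \<beta> *\<^sub>R b + \<gamma> *\<^sub>R p) = 0"
    using snd_dependent by blast
  have e: "form42 (\<alpha> *\<^sub>R a + \<beta> *\<^sub>R b + \<gamma> *\<^sub>R p) (\<alpha> *\<^sub>R a + \<beta> *\<^sub>R b + \<gamma> *\<^sub>R p) = - (\<gamma> * \<gamma>)"
    using assms form42_commute[of b a] form42_commute[of a p] form42_commute[of b p]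
    by (simp add: form42_simps)
  then have z: "\<alpha> *\<^sub>R a + \<beta> *\<^sub>R b + \<gamma> *\<^sub>R p = 0"
    using * nonpositive_no_negative_part by (metis neg_le_0_iff_le zero_le_square)
  then have "\<gamma> = 0" using e by (simp add: form42_simps)
  then show ?thesis using * z by auto
qed

lemma vector_4:
  "(vector [w, x, y, z] :: ('a::zero) ^ 4) $ 1 = w"
  "(vector [w, x, y, z] :: ('a::zero) ^ 4) $ 2 = x"
  "(vector [w, x, y, z] :: ('a::zero) ^ 4) $ 3 = y"
  "(vector [w, x, y, z] :: ('a::zero) ^ 4) $ 4 = z"
  unfolding vector_def by simp_all

text \<open>The Gram matrix that defines \<open>wedge4\<close> has the given combination of \<open>a\<close>, \<open>b\<close>, \<open>c\<close>, \<open>d\<close> as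
  the combination of its rows, so a nonzero determinant excludes linear relations.\<close>

lemma wedge4_independent:
  assumes "wedge4 a b c d \<noteq> (\<lambda>_. 0)"
    and "\<alpha> *\<^sub>R a + \<beta> *\<^sub>R b + \<gamma> *\<^sub>R c + \<delta> *\<^sub>R d = 0"
  shows "\<alpha> = 0 \<and> \<beta> = 0 \<and> \<gamma> = 0 \<and> \<delta> = 0"
proof -
  obtain z where z: "wedge4 a b c d z \<noteq> 0" using assms(1) by auto
  define M :: "real ^ 4 ^ 4" where
    "M = (\<chi> p q. form42 ((vector [a, b, c, d] :: r42 ^ 4) $ p) (z $ q))"
  have "det (transpose M) \<noteq> 0" using z by (simp add: wedge4_def M_def)
  then have inj: "\<forall>x. transpose M *v x = 0 \<longrightarrow> x = 0"
    using invertible_det_nz matrix_left_invertible_ker invertible_left_inverse by metis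
  let ?x = "vector [\<alpha>, \<beta>, \<gamma>, \<delta>] :: real ^ 4"
  have "transpose M *v ?x = 0"
  proof -
    have "(transpose M *v ?x) $ q = form42 (\<alpha> *\<^sub>R a + \<beta> *\<^sub>R b + \<gamma> *\<^sub>R c + \<delta> *\<^sub>R d) (z $ q)" for q
      by (simp add: matrix_vector_mult_def transpose_def M_def sum_4 vector_4 form42_simps)
    then show ?thesis using assms(2) by (simp add: vec_eq_iff form42_simps)
  qed
  then have "?x = 0" using inj by blast
  then show ?thesis by (simp add: vec_eq_iff forall_4 vector_4)
qed

section \<open>Decomposable bivectors\<close>

lemma form42_wedge:
  "form42 (blinfun_apply (wedge a b) z) w = form42 a z * form42 b w - form42 b z * form42 a w"
  by (simp add: wedge_apply form42_simps)

lemma bivector_eqI: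
  fixes A B :: bivector
  assumes "\<And>z w. form42 (blinfun_apply A z) w = form42 (blinfun_apply B z) w"
  shows "A = B"
  by (rule blinfun_eqI, rule form42_eqI) (metis assms form42_commute)

lemma wedge_add_left: "wedge (a + b) c = wedge a c + wedge b c"
  and wedge_add_right: "wedge c (a + b) = wedge c a + wedge c b"
  and wedge_diff_left: "wedge (a - b) c = wedge a c - wedge b c"
  and wedge_diff_right: "wedge c (a - b) = wedge c a - wedge c b"
  and wedge_minus_left: "wedge (- a) c = - wedge a c"
  and wedge_minus_right: "wedge c (- a) = - wedge c a"
  and wedge_scale_left: "wedge (r *\<^sub>R a) c = r *\<^sub>R wedge a c"
  and wedge_scale_right: "wedge c (r *\<^sub>R a) = r *\<^sub>R wedge c a"
  and wedge_self: "wedge a a = 0"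
  and wedge_zero_left: "wedge 0 a = 0"
  and wedge_zero_right: "wedge a 0 = 0"
  by (rule bivector_eqI, simp add: form42_simps form42_wedge blinfun.add_left blinfun.diff_left
        blinfun.minus_left blinfun.scaleR_left blinfun.zero_left algebra_simps)+

lemma wedge_anticommute: "wedge a b = - wedge b a"
  by (rule bivector_eqI) (simp add: form42_simps form42_wedge blinfun.minus_left)

lemmas wedge_simps = wedge_add_left wedge_add_right wedge_diff_left wedge_diff_right
  wedge_minus_left wedge_minus_right wedge_scale_left wedge_scale_right wedge_self
  wedge_zero_left wedge_zero_right

lemmas blinfun_left_simps = blinfun.add_left blinfun.diff_left blinfun.minus_left
  blinfun.scaleR_left blinfun.zero_left

lemma wedge_eq_0:
  assumes "wedge a b = 0" and "b \<noteq> 0"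
  shows "\<exists>m. a = m *\<^sub>R b"
proof -
  obtain z where z: "form42 z b \<noteq> 0" using assms(2) form42_nondegenerate by blast
  have "form42 a z *\<^sub>R b = form42 b z *\<^sub>R a"
    using assms(1) wedge_apply[of a b z] by simp
  then have "a = (form42 a z / form42 b z) *\<^sub>R b"
    using z form42_commute[of z b]
    by (metis (no_types, lifting) divideR_right real_vector.scale_scale divide_inverse mult.commute
        scaleR_scaleR)
  then show ?thesis by blast
qed

section \<open>Null planes\<close>

lemma exists_orthogonal:
  fixes A :: "r42 set"
  assumes "finite A" "card A < 6"
  shows "\<exists>w. w \<noteq> 0 \<and> (\<forall>a\<in>A. form42 a w = 0)"
proof -
  have "dim (span A) \<le> card A" using assms(1) by (intro dim_le_card) auto
  then have "dim (span A) \<noteq> dim (UNIV :: r42 set)" using assms(2) by (simp add: dim_UNIV)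
  then have "span A \<noteq> UNIV" by metis
  then obtain v where "v \<notin> span A" by blast
  then obtain z where z: "\<forall>w\<in>span A. form42 z w = 0" "form42 z v \<noteq> 0" using form42_separates by blast
  then have "z \<noteq> 0" by (auto simp: form42_simps)
  moreover have "form42 a z = 0" if "a \<in> A" for a
    using z(1) that form42_commute[of a z] by (simp add: span_base)
  ultimately show ?thesis by blast
qed

text \<open>A suitable multiple of \<open>g\<close> moves any vector of the plane into the complement of \<open>p\<close>; applied to a
  vector that is independent of \<open>g\<close>, this gives \<open>x\<close>.\<close>

lemma null_plane_basis:
  assumes F: "F \<in> null_planes" and g: "g \<in> F" "form42 g p = -1" and p: "form42 p p = -1"
  shows "\<exists>x. x \<noteq> 0 \<and> form42 x p = 0 \<and> F = span {x, g}"
proof -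
  have sub: "subspace F" "dim F = 2" using F by (auto simp: null_planes_def)
  have "\<not> F \<subseteq> span {g}"
  proof
    assume "F \<subseteq> span {g}"
    then have "dim F \<le> card {g}" by (rule dim_le_card) simp
    then show False using sub by simp
  qed
  then obtain w where w: "w \<in> F" "w \<notin> span {g}" by blast
  define x where "x = w + form42 w p *\<^sub>R g"
  have x: "x \<in> F" "form42 x p = 0"
    using w g sub by (simp_all add: x_def subspace_add subspace_scale form42_simps)
  have x0: "x \<noteq> 0"
  proof
    assume "x = 0"
    then have "w = (- form42 w p) *\<^sub>R g" by (simp add: x_def add_eq_0_iff2)
    moreover have "(- form42 w p) *\<^sub>R g \<in> span {g}" by (intro span_scale span_base) simp
    ultimately show False using w(2) by metis
  qed
  have "x \<notin> span {g}"
  proof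
    assume "x \<in> span {g}"
    then obtain r where "x = r *\<^sub>R g" by (auto simp: span_singleton)
    then show False using x(2) g(2) x0 by (simp add: form42_simps)
  qed
  moreover have "g \<noteq> 0" using g(2) by (auto simp: form42_simps)
  moreover have "x \<noteq> g" using x(2) g(2) by auto
  ultimately have "independent {x, g}" "card {x, g} = 2"
    by (simp_all add: independent_insert)
  then have "F \<subseteq> span {x, g}" using x g sub by (intro card_ge_dim_independent) auto
  moreover have "span {x, g} \<subseteq> F" using x g sub by (simp add: span_minimal)
  ultimately show ?thesis using x x0 by blast
qed

text \<open>In signature (4,2) there is no totally null subspace of dimension three.\<close>

lemma null_plane_maximal:
  assumes F: "F \<in> null_planes" and uv: "u \<in> F" "v \<in> F" "wedge v u \<noteq> 0"
    and w: "form42 w w = 0" "form42 u w = 0" "form42 v w = 0"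
  shows "w \<in> F"
proof -
  have sub: "subspace F" and null: "form42 u u = 0" "form42 v v = 0" "form42 u v = 0"
    using F uv by (auto simp: null_planes_def)
  obtain a b c where abc: "(a, b, c) \<noteq> (0, 0, 0)" "a *\<^sub>R u + b *\<^sub>R v + c *\<^sub>R w = 0"
    using null_dependent_3[of u v w] null w by blast
  have "c \<noteq> 0"
  proof
    assume c: "c = 0"
    then have z: "a *\<^sub>R u + b *\<^sub>R v = 0" using abc by simp
    have "wedge v (a *\<^sub>R u + b *\<^sub>R v) = 0" "wedge (a *\<^sub>R u + b *\<^sub>R v) u = 0"
      unfolding z by (simp_all add: wedge_simps)
    then have "a = 0 \<and> b = 0" using uv(3) by (simp add: wedge_simps)
    then show False using abc c by simp
  qed
  then have "w = (1 / c) *\<^sub>R (c *\<^sub>R w)" by simp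
  also have "c *\<^sub>R w = - (a *\<^sub>R u + b *\<^sub>R v)" using abc(2) by (simp add: add_eq_0_iff)
  finally have "w = (1 / c) *\<^sub>R (- (a *\<^sub>R u + b *\<^sub>R v))" .
  moreover have "a *\<^sub>R u + b *\<^sub>R v \<in> F" using uv sub by (simp add: subspace_add subspace_scale)
  ultimately show ?thesis using sub by (metis subspace_neg subspace_scale)
qed

section \<open>Edges and quadrilaterals of a lattice domain\<close>

lemma edge_mem: "edge S i j \<Longrightarrow> i \<in> S" "edge S i j \<Longrightarrow> j \<in> S"
  by (auto simp: edge_def)

lemma edge_sym: "edge S i j \<Longrightarrow> edge S j i"
  by (auto simp: edge_def)

lemma quadE:
  assumes "quad S i j k l"
  obtains a b u v where "{i, j, k, l} \<subseteq> S" "a \<noteq> b" "u \<in> {axis a 1, - axis a 1}"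
    "v \<in> {axis b 1, - axis b 1}" "j = i + u" "k = i + u + v" "l = i + v"
  using assms unfolding quad_def by (elim conjE exE bexE) (rule that)

lemma quadI:
  assumes "{i, j, k, l} \<subseteq> S" "a \<noteq> b" "u \<in> {axis a 1, - axis a 1}"
    "v \<in> {axis b 1, - axis b 1}" "j = i + u" "k = i + u + v" "l = i + v"
  shows "quad S i j k l"
  unfolding quad_def
  by (intro conjI exI[of _ a] exI[of _ b] bexI[of _ u] bexI[of _ v]) (use assms in simp_all)

lemma quad_rotate:
  assumes "quad S i j k l" shows "quad S j k l i"
  using assms
proof (rule quadE)
  fix a b u v
  assume *: "{i, j, k, l} \<subseteq> S" "a \<noteq> b" "u \<in> {axis a 1, - axis a 1}"
    "v \<in> {axis b 1, - axis b 1}" "j = i + u" "k = i + u + v" "l = i + v"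
  show ?thesis
    by (rule quadI[of j k l i S b a v "- u"]) (use * in auto)
qed

lemma quad_first_edge: "quad S i j k l \<Longrightarrow> edge S i j"
  by (auto simp: quad_def edge_def algebra_simps)

lemma quad_edges:
  assumes "quad S i j k l"
  shows "edge S i j" "edge S j k" "edge S k l" "edge S l i"
  using assms quad_first_edge quad_rotate by blast+

subsection \<open>The doubled domain\<close>

lemma base_pt_simps:
  "base_pt (z + w) = base_pt z + base_pt w" "base_pt (- w) = - base_pt w"
  "base_pt (axis (Some a) 1) = axis a 1" "base_pt (axis None 1) = 0"
  by (auto simp: base_pt_def vec_eq_iff axis_def)

lemma axis_None:
  "(axis (Some a) 1 :: int ^ ('n::finite option)) $ None = 0" "(axis None 1 :: int ^ ('n::finite option)) $ None = 1"
  by (auto simp: axis_def)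

lemma doubled_edge_cases:
  assumes "edge (doubled S) z w"
  shows "z $ None = w $ None \<and> edge S (base_pt z) (base_pt w) \<or>
    base_pt z = base_pt w \<and> z $ None \<noteq> w $ None \<and> base_pt z \<in> S"
proof -
  obtain c where c: "z \<in> doubled S" "w \<in> doubled S" "w = z + axis c 1 \<or> z = w + axis c 1"
    using assms by (auto simp: edge_def)
  show ?thesis
  proof (cases c)
    case None
    have "base_pt z = base_pt w" "z $ None \<noteq> w $ None"
      using c(3) by (auto simp: None base_pt_simps axis_None)
    then show ?thesis using c(1) by (simp add: doubled_def)
  next
    case (Some a)
    have "base_pt w = base_pt z + axis a 1 \<or> base_pt z = base_pt w + axis a 1" "z $ None = w $ None"
      using c(3) by (auto simp: Some base_pt_simps axis_None)
    moreover have "base_pt z \<in> S" "base_pt w \<in> S" using c(1,2) by (simp_all add: doubled_def)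
    ultimately show ?thesis unfolding edge_def by blast
  qed
qed

text \<open>A quadrilateral of the doubled domain either lies in one level or stands on an edge of \<open>S\<close>; in
  the latter case its first side can be the vertical or the horizontal one.\<close>

lemma doubled_quad_cases:
  assumes "quad (doubled S) z1 z2 z3 z4"
  obtains
    "quad S (base_pt z1) (base_pt z2) (base_pt z3) (base_pt z4)"
    "z2 $ None = z1 $ None" "z3 $ None = z1 $ None" "z4 $ None = z1 $ None"
  | "base_pt z2 = base_pt z1" "base_pt z3 = base_pt z4" "edge S (base_pt z1) (base_pt z4)"
    "z4 $ None = z1 $ None" "z3 $ None = z2 $ None" "z2 $ None \<noteq> z1 $ None"
  | "base_pt z4 = base_pt z1" "base_pt z3 = base_pt z2" "edge S (base_pt z1) (base_pt z2)"
    "z2 $ None = z1 $ None" "z3 $ None = z4 $ None" "z4 $ None \<noteq> z1 $ None"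
proof -
  obtain a b u v where *: "{z1, z2, z3, z4} \<subseteq> doubled S" "a \<noteq> b"
    "u \<in> {axis a 1, - axis a 1}" "v \<in> {axis b 1, - axis b 1}"
    "z2 = z1 + u" "z3 = z1 + u + v" "z4 = z1 + v"
    using assms(1) by (rule quadE)
  have S: "{base_pt z1, base_pt z2, base_pt z3, base_pt z4} \<subseteq> S"
    using *(1) by (auto simp: doubled_def)
  have un: "a = None \<Longrightarrow> u $ None \<noteq> 0" "a = Some d \<Longrightarrow> u $ None = 0" for d
    using *(3) by (auto simp: axis_None)
  have vn: "b = None \<Longrightarrow> v $ None \<noteq> 0" "b = Some d \<Longrightarrow> v $ None = 0" for d
    using *(4) by (auto simp: axis_None)
  have e14: "edge S (base_pt z1) (base_pt z4)" if "b = Some d" for d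
    using *(4,7) S that by (auto simp: edge_def base_pt_simps)
  have e12: "edge S (base_pt z1) (base_pt z2)" if "a = Some d" for d
    using *(3,5) S that by (auto simp: edge_def base_pt_simps)
  show thesis
  proof (cases a)
    case None
    then obtain d where d: "b = Some d" using *(2) by (cases b) auto
    have "base_pt u = 0" using None *(3) by (auto simp: base_pt_simps)
    moreover have "v $ None = 0" using vn d by blast
    moreover have "u $ None \<noteq> 0" using un None by blast
    ultimately show ?thesis using that(2) * e14[OF d] by (simp add: base_pt_simps)
  next
    case (Some e)
    show ?thesis
    proof (cases b)
      case None
      have "base_pt v = 0" using None *(4) by (auto simp: base_pt_simps)
      moreover have "u $ None = 0" using un Some by blast
      moreover have "v $ None \<noteq> 0" using vn None by blast
      ultimately show ?thesis using that(3) * e12[OF Some] by (simp add: base_pt_simps)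
    next
      case (Some d)
      have ed: "e \<noteq> d" using \<open>a = Some e\<close> Some *(2) by simp
      have "base_pt u \<in> {axis e 1, - axis e 1}" "base_pt v \<in> {axis d 1, - axis d 1}"
        using \<open>a = Some e\<close> Some *(3,4) by (auto simp: base_pt_simps)
      moreover have "base_pt z2 = base_pt z1 + base_pt u"
        "base_pt z3 = base_pt z1 + base_pt u + base_pt v" "base_pt z4 = base_pt z1 + base_pt v"
        using *(5-7) by (simp_all add: base_pt_simps)
      ultimately have "quad S (base_pt z1) (base_pt z2) (base_pt z3) (base_pt z4)"
        using quadI[OF S ed] by blast
      moreover have "u $ None = 0" "v $ None = 0" using un vn \<open>a = Some e\<close> Some by blast+
      ultimately show ?thesis using that(1) *(5-7) by simp
    qed
  qed
qed

definition level_pt :: "int \<Rightarrow> int ^ 'n \<Rightarrow> int ^ ('n option)" where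
  "level_pt e i = (\<chi> c. case c of None \<Rightarrow> e | Some a \<Rightarrow> i $ a)"

lemma level_pt_simps [simp]: "base_pt (level_pt e i) = i" "level_pt e i $ None = e"
  by (simp_all add: base_pt_def level_pt_def)

lemma level_pt_doubled: "level_pt e i \<in> doubled S \<longleftrightarrow> e \<in> {0, 1} \<and> i \<in> S"
  by (simp add: doubled_def)

lemma join_level_pt: "join sp sm (level_pt 0 i) = sp i" "join sp sm (level_pt 1 i) = sm i"
  by (simp_all add: join_def)

lemma level_pt_axis:
  "level_pt e (i + axis a 1) = level_pt e i + axis (Some a) 1"
  "level_pt e (i - axis a 1) = level_pt e i - axis (Some a) 1"
  "level_pt 1 i = level_pt 0 i + axis None 1"
  by (auto simp: vec_eq_iff level_pt_def axis_def split: option.splits)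

lemma level_edge: "edge S i j \<Longrightarrow> e \<in> {0, 1} \<Longrightarrow> edge (doubled S) (level_pt e i) (level_pt e j)"
  by (auto simp: edge_def level_pt_doubled level_pt_axis)

lemma vertical_edge: "i \<in> S \<Longrightarrow> edge (doubled S) (level_pt 0 i) (level_pt 1 i)"
  by (auto simp: edge_def level_pt_doubled intro: level_pt_axis)

lemma level_quad:
  assumes "quad S i j k l" "e \<in> {0, 1}"
  shows "quad (doubled S) (level_pt e i) (level_pt e j) (level_pt e k) (level_pt e l)"
proof -
  obtain a b u v where *: "{i, j, k, l} \<subseteq> S" "a \<noteq> b" "u \<in> {axis a 1, - axis a 1}"
    "v \<in> {axis b 1, - axis b 1}" "j = i + u" "k = i + u + v" "l = i + v"
    using assms(1) by (rule quadE)
  define u' where "u' = (if u = axis a 1 then axis (Some a) 1 else - axis (Some a) (1 :: int))"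
  define v' where "v' = (if v = axis b 1 then axis (Some b) 1 else - axis (Some b) (1 :: int))"
  have u: "level_pt e (z + u) = level_pt e z + u'" for z
    using *(3) by (auto simp: u'_def level_pt_axis)
  have v: "level_pt e (z + v) = level_pt e z + v'" for z
    using *(4) by (auto simp: v'_def level_pt_axis)
  show ?thesis
  proof (rule quadI[of _ _ _ _ _ "Some a" "Some b" u' v'])
    show "{level_pt e i, level_pt e j, level_pt e k, level_pt e l} \<subseteq> doubled S"
      using *(1) assms(2) by (simp only: insert_subset level_pt_doubled) blast
  qed (use *(2) in \<open>simp_all add: *(5-7) u v u'_def v'_def\<close>)
qed

lemma vertical_quad:
  assumes "edge S i j"
  shows "quad (doubled S) (level_pt 0 i) (level_pt 0 j) (level_pt 1 j) (level_pt 1 i)"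
proof -
  obtain a where "j = i + axis a 1 \<or> i = j + axis a 1"
    using assms unfolding edge_def by blast
  then have "j = i + axis a 1 \<or> j = i - axis a 1" by (auto simp: algebra_simps)
  then have "level_pt 0 j = level_pt 0 i + axis (Some a) 1 \<or>
      level_pt 0 j = level_pt 0 i + - axis (Some a) 1"
    using level_pt_axis(1,2)[of 0 i a] by auto
  then obtain u where u: "u \<in> {axis (Some a) 1, - axis (Some a) 1}"
    "level_pt 0 j = level_pt 0 i + u"
    by blast
  show ?thesis
  proof (rule quadI[of _ _ _ _ _ "Some a" None u "axis None 1"])
    show "{level_pt 0 i, level_pt 0 j, level_pt 1 j, level_pt 1 i} \<subseteq> doubled S"
      using edge_mem[OF assms] by (simp only: insert_subset level_pt_doubled) blast
  qed (use u in \<open>simp_all add: level_pt_axis(3)\<close>)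
qed

section \<open>Transport along paths\<close>

fun along :: "('p \<Rightarrow> 'p \<Rightarrow> 'x \<Rightarrow> 'x) \<Rightarrow> 'p list \<Rightarrow> 'x \<Rightarrow> 'x" where
  "along U (i # j # xs) x = along U (j # xs) (U i j x)"
| "along U [i] x = x"
| "along U [] x = x"

lemma along_append: "along U (xs @ i # ys) x = along U (i # ys) (along U (xs @ [i]) x)"
proof (induction xs arbitrary: x)
  case (Cons a xs)
  then show ?case by (cases xs) auto
qed simp

lemma along_snoc: "xs \<noteq> [] \<Longrightarrow> along U (xs @ [j]) x = U (last xs) j (along U xs x)"
proof (induction xs arbitrary: x)
  case (Cons a xs)
  then show ?case by (cases xs) auto
qed simp

lemma edge_path_append:
  "edge_path S (xs @ i # ys) \<longleftrightarrow> edge_path S (xs @ [i]) \<and> edge_path S (i # ys)"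
  by (auto simp: edge_path_def successively_append_iff)

lemma edge_path_snoc:
  "edge_path S xs \<Longrightarrow> edge S (last xs) j \<Longrightarrow> edge_path S (xs @ [j])"
  by (auto simp: edge_path_def successively_append_iff edge_def)

lemma edge_path_Cons2: "edge_path S (i # j # xs) \<longleftrightarrow> edge S i j \<and> edge_path S (j # xs)"
  by (auto simp: edge_path_def edge_def)

lemma edge_path_single: "edge_path S [i] \<longleftrightarrow> i \<in> S"
  by (auto simp: edge_path_def)

lemma along_invariant:
  assumes "\<And>i j x. edge S i j \<Longrightarrow> x \<in> R i \<Longrightarrow> U i j x \<in> R j"
  shows "edge_path S xs \<Longrightarrow> x \<in> R (hd xs) \<Longrightarrow> along U xs x \<in> R (last xs)"
proof (induction xs arbitrary: x)
  case (Cons a xs)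
  show ?case
  proof (cases xs)
    case Nil
    then show ?thesis using Cons by simp
  next
    case (Cons b ys)
    then show ?thesis using Cons.IH Cons.prems assms by (auto simp: edge_path_Cons2)
  qed
qed (simp add: edge_path_def)

lemma simply_connected_induct:
  assumes "simply_connected_domain S" "b \<in> S" "i \<in> S" "P b"
    and "\<And>i j. edge S i j \<Longrightarrow> P i \<Longrightarrow> P j"
  shows "P i"
proof -
  obtain xs where "edge_path S xs" "hd xs = b" "last xs = i"
    using assms unfolding simply_connected_domain_def by blast
  moreover have "edge_path S xs \<Longrightarrow> P (hd xs) \<Longrightarrow> P (last xs)"
  proof (induction xs rule: induct_list012)
    case (3 i j ys)
    then show ?case using assms(5)[of i j] by (auto simp: edge_path_Cons2)
  qed (auto simp: edge_path_def)
  ultimately show ?thesis using assms(4) by simp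
qed

text \<open>Both moves exchange a piece of a path between two fixed points, so it is enough to compare the
  transports over that piece.\<close>

lemma path_move_along:
  assumes move: "path_move S xs ys" and path: "edge_path S xs \<or> edge_path S ys"
    and x: "x \<in> R (hd xs)"
    and step: "\<And>i j x. edge S i j \<Longrightarrow> x \<in> R i \<Longrightarrow> U i j x \<in> R j"
    and reverse: "\<And>i j x. edge S i j \<Longrightarrow> x \<in> R i \<Longrightarrow> U j i (U i j x) = x"
    and flat: "\<And>i j k l x. quad S i j k l \<Longrightarrow> x \<in> R k \<Longrightarrow> U l i (U k l x) = U j i (U k j x)"
  shows "edge_path S xs \<and> edge_path S ys \<and> hd xs = hd ys \<and> along U xs x = along U ys x"
  using move
proof cases
  case (spur i j us vs)
  have e: "edge S j i" using spur(3) edge_sym by blast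
  have p: "edge_path S (us @ [i])" "edge_path S (i # vs)"
    using path edge_path_append[of S us i vs] edge_path_append[of S us i "j # i # vs"]
    by (auto simp: spur(1,2) edge_path_Cons2)
  have h: "hd xs = hd (us @ [i])" by (cases us) (simp_all add: spur)
  have "along U (us @ [i]) x \<in> R i"
    using along_invariant[of S R U "us @ [i]" x, OF step p(1)] x h by simp
  then have "along U xs x = along U ys x"
    using reverse[OF spur(3)] along_append[of U us i vs x] along_append[of U us i "j # i # vs" x]
    by (simp add: spur(1,2))
  moreover have "hd xs = hd ys" by (cases us) (simp_all add: spur)
  moreover have "edge_path S xs" "edge_path S ys"
    using p e spur(3) edge_path_append[of S us i vs] edge_path_append[of S us i "j # i # vs"]
    by (auto simp: spur(1,2) edge_path_Cons2)
  ultimately show ?thesis by blast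
next
  case (flip i j k l us vs)
  have e: "edge S k l" "edge S l i" "edge S k j" "edge S j i"
    using quad_edges[OF flip(3)] edge_sym by blast+
  have p: "edge_path S (us @ [k])" "edge_path S (i # vs)"
    using path edge_path_append[of S us k "l # i # vs"] edge_path_append[of S us k "j # i # vs"]
    by (auto simp: flip(1,2) edge_path_Cons2)
  have h: "hd xs = hd (us @ [k])" by (cases us) (simp_all add: flip)
  have "along U (us @ [k]) x \<in> R k"
    using along_invariant[of S R U "us @ [k]" x, OF step p(1)] x h by simp
  then have "along U xs x = along U ys x"
    using flat[OF flip(3)] along_append[of U us k "l # i # vs" x]
      along_append[of U us k "j # i # vs" x]
    by (simp add: flip(1,2))
  moreover have "hd xs = hd ys" by (cases us) (simp_all add: flip)
  moreover have "edge_path S xs" "edge_path S ys"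
    using p e edge_path_append[of S us k "l # i # vs"] edge_path_append[of S us k "j # i # vs"]
    by (auto simp: flip(1,2) edge_path_Cons2)
  ultimately show ?thesis by blast
qed

text \<open>Discrete monodromy principle: a transport rule that is undone by walking back and agrees
  along the two halves of each quadrilateral integrates over a simply connected domain. The sets
  \<open>R i\<close> confine the values for which these rules are required.\<close>

proposition transport_exists:
  assumes sc: "simply_connected_domain S" and b: "b \<in> S" and x0: "x0 \<in> R b"
    and step: "\<And>i j x. edge S i j \<Longrightarrow> x \<in> R i \<Longrightarrow> U i j x \<in> R j"
    and reverse: "\<And>i j x. edge S i j \<Longrightarrow> x \<in> R i \<Longrightarrow> U j i (U i j x) = x"
    and flat: "\<And>i j k l x. quad S i j k l \<Longrightarrow> x \<in> R k \<Longrightarrow> U l i (U k l x) = U j i (U k j x)"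
  shows "\<exists>h. h b = x0 \<and> (\<forall>i j. edge S i j \<longrightarrow> h j = U i j (h i))"
proof -
  have same: "edge_path S zs \<and> hd zs = hd xs \<and> along U zs x0 = along U xs x0"
    if "edge_path S xs" "equivclp (path_move S) xs zs" "hd xs = b" for xs zs
    using that(2)
  proof (induction rule: equivclp_induct)
    case base
    then show ?case using that by simp
  next
    case (step y z)
    then show ?case
    proof (elim disjE)
      assume "path_move S y z"
      then show ?thesis
        using path_move_along[of S y z x0 R U, OF _ _ _ assms(4-6)] step.IH that(3) x0 by simp
    next
      assume m: "path_move S z y"
      have "hd z = hd y" using m by cases (auto simp: hd_append)
      then show ?thesis
        using path_move_along[of S z y x0 R U, OF m _ _ assms(4-6)] step.IH that(3) x0 by simp
    qed
  qed
  define path where "path i = (SOME xs. edge_path S xs \<and> hd xs = b \<and> last xs = i)" for i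
  have path: "edge_path S (path i) \<and> hd (path i) = b \<and> last (path i) = i" if "i \<in> S" for i
    unfolding path_def by (rule someI_ex) (use sc b that in \<open>auto simp: simply_connected_domain_def\<close>)
  define h where "h i = along U (path i) x0" for i
  have h: "h (last xs) = along U xs x0" if "edge_path S xs" "hd xs = b" for xs
  proof -
    have l: "last xs \<in> S" using that(1) by (auto simp: edge_path_def)
    have "equivclp (path_move S) xs (path (last xs))"
      using sc path[OF l] that unfolding simply_connected_domain_def by metis
    then show ?thesis using same that unfolding h_def by metis
  qed
  have "h b = x0" using h[of "[b]"] b by (simp add: edge_path_single)
  moreover have "h j = U i j (h i)" if e: "edge S i j" for i j
  proof -
    have p: "edge_path S (path i)" "hd (path i) = b" "last (path i) = i"
      using path edge_mem[OF e] by auto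
    then have ne: "path i \<noteq> []" by (auto simp: edge_path_def)
    have "h (last (path i @ [j])) = along U (path i @ [j]) x0"
      by (rule h) (use p e ne edge_path_snoc[of S "path i" j] in auto)
    then show ?thesis using along_snoc[OF ne] p h_def by simp
  qed
  ultimately show ?thesis by blast
qed

lemma closed_form_exact:
  fixes \<alpha> :: "int ^ 'n \<Rightarrow> int ^ 'n \<Rightarrow> 'v::real_vector"
  assumes "simply_connected_domain S" "closed_form S \<alpha>"
  shows "\<exists>y. \<forall>i j. edge S i j \<longrightarrow> df y j i = \<alpha> j i"
proof -
  obtain b where b: "b \<in> S" using assms(1) by (auto simp: simply_connected_domain_def)
  have anti: "\<alpha> j i = - \<alpha> i j" if "edge S i j" for i j
    using assms(2) that by (auto simp: closed_form_def)
  have "\<exists>h. h b = 0 \<and> (\<forall>i j. edge S i j \<longrightarrow> h j = h i + \<alpha> j i)"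
  proof (rule transport_exists[OF assms(1) b, where R = "\<lambda>_. UNIV"])
    fix i j :: "int ^ 'n" and x :: 'v assume "edge S i j"
    then show "x + \<alpha> j i + \<alpha> i j = x" using anti[of i j] by simp
  next
    fix i j k l :: "int ^ 'n" and x :: 'v assume q: "quad S i j k l"
    have "\<alpha> i l + \<alpha> l k + \<alpha> k j + \<alpha> j i = 0"
      using assms(2) q by (auto simp: closed_form_def)
    moreover have "\<alpha> k j = - \<alpha> j k" "\<alpha> j i = - \<alpha> i j"
      using anti quad_edges[OF q] edge_sym by blast+
    ultimately show "x + \<alpha> l k + \<alpha> i l = x + \<alpha> j k + \<alpha> i j"
      by (simp add: algebra_simps)
  qed auto
  then obtain h where "h j = h i + \<alpha> j i" if "edge S i j" for i j by blast
  then show ?thesis by (intro exI[of _ h]) (auto simp: df_def)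
qed

text \<open>The edge equation \<open>(h i - K) * (h j - K) = L\<close> is solved by a Moebius involution.
  With division by zero giving zero, its real formula fixes the pole and so is a bijection of the
  real line; hence each of the countably many paths excludes at most countably many initial
  values, namely those whose transport meets a pole.\<close>

proposition moebius_transport:
  fixes K L :: "int ^ 'n \<Rightarrow> int ^ 'n \<Rightarrow> real"
  assumes sc: "simply_connected_domain S" and b: "b \<in> S"
    and sym: "\<And>i j. edge S i j \<Longrightarrow> K i j = K j i" "\<And>i j. edge S i j \<Longrightarrow> L i j = L j i"
    and L: "\<And>i j. edge S i j \<Longrightarrow> L i j \<noteq> 0"
    and flat: "\<And>i j k l x y z w. quad S i j k l \<Longrightarrow>
      (y - K j k) * (z - K j k) = L j k \<Longrightarrow> (z - K k l) * (w - K k l) = L k l \<Longrightarrow>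
      (w - K l i) * (x - K l i) = L l i \<Longrightarrow> (x - K i j) * (y - K i j) = L i j"
  shows "\<exists>C. countable C \<and> (\<forall>x0. x0 \<notin> C \<longrightarrow>
    (\<exists>h. h b = x0 \<and> (\<forall>i j. edge S i j \<longrightarrow> (h i - K i j) * (h j - K i j) = L i j)))"
proof -
  define U where "U i j x = K i j + L i j / (x - K i j)" for i j and x :: real
  define C where "C = (\<Union>xs\<in>{xs. edge_path S xs}. \<Union>j. {x. along U xs x = K (last xs) j})"
  have U_inj: "inj (U i j)" if "edge S i j" for i j
    using L[OF that] by (auto simp: inj_on_def U_def divide_inverse)
  have inj: "inj (along U xs)" if "edge_path S xs" for xs
    using that
  proof (induction xs rule: induct_list012)
    case (3 i j ys)
    then have "inj (along U (j # ys))" "inj (U i j)" using U_inj by (auto simp: edge_path_Cons2)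
    then have "inj (along U (j # ys) \<circ> U i j)" by (rule inj_compose)
    moreover have "along U (i # j # ys) = along U (j # ys) \<circ> U i j" by (simp add: fun_eq_iff)
    ultimately show ?case by (simp only:)
  qed (simp_all add: edge_path_def inj_on_def)
  have "countable {x. along U xs x = K (last xs) j}" if "edge_path S xs" for xs j
  proof -
    have "{x. along U xs x = K (last xs) j} = along U xs -` {K (last xs) j}" by auto
    then show ?thesis using finite_vimageI[OF _ inj[OF that]] by (simp add: countable_finite)
  qed
  then have "countable C" unfolding C_def by (intro countable_UN) auto
  moreover have "\<exists>h. h b = x0 \<and> (\<forall>i j. edge S i j \<longrightarrow> (h i - K i j) * (h j - K i j) = L i j)"
    if x0: "x0 \<notin> C" for x0
  proof -
    define R where "R i = {along U xs x0 | xs. edge_path S xs \<and> hd xs = b \<and> last xs = i}" for i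
    have pole: "x \<noteq> K i j" if "x \<in> R i" for x i j
      using that x0 by (auto simp: R_def C_def)
    have rel: "(x - K i j) * (U i j x - K i j) = L i j" if "x \<in> R i" for x i j
      using pole[OF that, of j] by (simp add: U_def)
    have reverse: "x = U j i y" if "edge S i j" "(x - K i j) * (y - K i j) = L i j" for x y i j
    proof -
      have "y - K i j \<noteq> 0" using that L by force
      then show ?thesis using that sym[OF that(1)] by (simp add: U_def field_simps)
    qed
    have step: "U i j x \<in> R j" if e: "edge S i j" and x: "x \<in> R i" for i j x
    proof -
      obtain xs where xs: "x = along U xs x0" "edge_path S xs" "hd xs = b" "last xs = i"
        using x by (auto simp: R_def)
      then have "xs \<noteq> []" by (auto simp: edge_path_def)
      then have "U i j x = along U (xs @ [j]) x0" "hd (xs @ [j]) = b" "last (xs @ [j]) = j"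
        using xs along_snoc[of xs U j x0] by auto
      moreover have "edge_path S (xs @ [j])" using edge_path_snoc xs e by blast
      ultimately show ?thesis unfolding R_def by blast
    qed
    have "\<exists>h. h b = x0 \<and> (\<forall>i j. edge S i j \<longrightarrow> h j = U i j (h i))"
    proof (rule transport_exists[OF sc b, where R = R])
      show "x0 \<in> R b" unfolding R_def
        by (rule CollectI, rule exI[of _ "[b]"]) (use b in \<open>simp add: edge_path_single\<close>)
      show "U i j x \<in> R j" if "edge S i j" "x \<in> R i" for i j x using step that by blast
      show "U j i (U i j x) = x" if "edge S i j" "x \<in> R i" for i j x
        using reverse[OF that(1) rel[OF that(2)]] by simp
      show "U l i (U k l z) = U j i (U k j z)" if q: "quad S i j k l" and z: "z \<in> R k" for i j k l z
      proof -
        have e: "edge S k l" "edge S l i" "edge S k j" "edge S i j" "edge S j k"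
          using quad_edges[OF q] edge_sym by blast+
        let ?w = "U k l z" and ?y = "U k j z"
        let ?x = "U l i ?w"
        have "(?y - K j k) * (z - K j k) = L j k"
          using rel[OF z, of j] sym[OF e(5)] by (simp add: mult.commute)
        moreover have "(z - K k l) * (?w - K k l) = L k l" using rel[OF z] by simp
        moreover have "(?w - K l i) * (?x - K l i) = L l i" using rel[OF step[OF e(1) z]] by simp
        ultimately have "(?x - K i j) * (?y - K i j) = L i j" by (rule flat[OF q])
        then show ?thesis using reverse[OF e(4)] by blast
      qed
    qed
    then obtain h where h: "h b = x0" "\<And>i j. edge S i j \<Longrightarrow> h j = U i j (h i)" by blast
    have "h i \<in> R i" if "i \<in> S" for i
    proof (rule simply_connected_induct[OF sc b that])
      show "h b \<in> R b" unfolding R_def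
        by (rule CollectI, rule exI[of _ "[b]"]) (use b h in \<open>simp add: edge_path_single\<close>)
    qed (use h(2) step in auto)
    then show ?thesis using h rel edge_mem by metis
  qed
  ultimately show ?thesis by blast
qed

section \<open>Null vectors in general position\<close>

definition reflection42 :: "r42 \<Rightarrow> r42 \<Rightarrow> r42" where
  "reflection42 d z = z - (2 * form42 z d / form42 d d) *\<^sub>R d"

lemma reflection42_form:
  assumes "form42 d d \<noteq> 0"
  shows "form42 (reflection42 d u) (reflection42 d v) = form42 u v"
  using assms form42_commute[of d u] form42_commute[of d v]
  by (simp add: reflection42_def form42_simps field_simps)

lemma reflection42_involution:
  assumes "form42 d d \<noteq> 0"
  shows "reflection42 d (reflection42 d u) = u"
  using assms by (simp add: reflection42_def form42_simps scaleR_diff_left)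

text \<open>For the standard timelike vector, stereographic projection of a twisted cubic is a polynomial
  curve of null vectors spanning the complement of that vector, so each hyperplane condition
  excludes finitely many parameters. A reflection carries the general case to this one.\<close>

lemma null_vector_in_general_position:
  assumes pp: "form42 p p = -1" and W: "countable W"
    and w: "\<And>w. w \<in> W \<Longrightarrow> w \<noteq> 0 \<and> form42 p w = 0"
  shows "\<exists>q. form42 q q = 0 \<and> form42 p q = 0 \<and> (\<forall>w\<in>W. form42 q w \<noteq> 0)"
proof -
  define s where "s t = t ^ 2 + t ^ 4 + t ^ 6" for t :: real
  define e :: r42 where "e = (0, vector [0, 1])"
  define q0 :: "real \<Rightarrow> r42" where
    "q0 t = (vector [2 * t, 2 * t ^ 2, 2 * t ^ 3, s t - 1], vector [s t + 1, 0])" for t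
  have ee: "form42 e e = -1"
    by (simp add: e_def form42_def inner_vec_def sum_2)
  have q0: "form42 (q0 t) (q0 t) = 0" "form42 e (q0 t) = 0" for t
    by (simp_all add: q0_def e_def s_def form42_def inner_vec_def sum_2 sum_4 vector_4
        algebra_simps power2_eq_square power3_eq_cube power4_eq_xxxx numeral_eq_Suc)
  have fin: "finite {t. form42 (q0 t) u = 0}" if u: "u \<noteq> 0" "form42 e u = 0" for u
  proof -
    obtain a b where ab: "u = (a, b)" by (cases u)
    define P where "P = [: - a $ 4 - b $ 1, 2 * a $ 1, 2 * a $ 2 + (a $ 4 - b $ 1), 2 * a $ 3,
      a $ 4 - b $ 1, 0, a $ 4 - b $ 1 :]"
    have eq: "form42 (q0 t) u = poly P t" for t
      by (simp add: ab P_def q0_def s_def form42_def inner_vec_def sum_2 sum_4 vector_4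
          algebra_simps power2_eq_square power3_eq_cube power4_eq_xxxx numeral_eq_Suc)
    have b2: "b $ 2 = 0" using u(2) by (simp add: ab e_def form42_def inner_vec_def sum_2)
    have "P \<noteq> 0"
    proof
      assume "P = 0"
      then have "a $ 1 = 0 \<and> a $ 2 = 0 \<and> a $ 3 = 0 \<and> a $ 4 = 0 \<and> b $ 1 = 0"
        unfolding P_def pCons_eq_0_iff by linarith
      then have "a = 0" "b = 0" using b2 by (simp_all add: vec_eq_iff forall_2 forall_4)
      then show False using u(1) by (simp add: ab zero_prod_def)
    qed
    then show ?thesis using poly_roots_finite by (simp add: eq)
  qed
  obtain \<epsilon> :: real where eps: "\<epsilon> * \<epsilon> = 1" "form42 (p - \<epsilon> *\<^sub>R e) (p - \<epsilon> *\<^sub>R e) \<noteq> 0"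
  proof (cases "form42 (p - e) (p - e) = 0")
    case True
    then have "form42 (p - (- 1) *\<^sub>R e) (p - (- 1) *\<^sub>R e) \<noteq> 0"
      using pp ee form42_commute[of p e] by (simp add: form42_simps)
    then show ?thesis using that[of "-1"] by simp
  next
    case False
    then show ?thesis using that[of 1] by simp
  qed
  define d where "d = p - \<epsilon> *\<^sub>R e"
  let ?A = "reflection42 d"
  have dd: "form42 d d \<noteq> 0" using eps by (simp add: d_def)
  have Ae: "?A e = \<epsilon> *\<^sub>R p"
  proof -
    have "2 * form42 e d = - \<epsilon> * form42 d d"
      using eps(1) pp ee form42_commute[of p e]
      by (simp add: d_def form42_simps algebra_simps)
    then have "?A e = e + \<epsilon> *\<^sub>R d" using dd by (simp add: reflection42_def)
    then show ?thesis using eps(1) by (simp add: d_def algebra_simps)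
  qed
  have p: "p = \<epsilon> *\<^sub>R ?A e" using eps(1) by (simp add: Ae)
  have "countable (\<Union>w\<in>W. {t. form42 (q0 t) (?A w) = 0})"
  proof (intro countable_UN W countable_finite fin)
    fix u assume u: "u \<in> W"
    show "?A u \<noteq> 0"
    proof
      assume "?A u = 0"
      then have "u = ?A 0" using reflection42_involution[OF dd, of u] by simp
      then show False using w[OF u] by (simp add: reflection42_def form42_simps)
    qed
    have "form42 (?A e) u = 0" using w[OF u] by (simp add: Ae form42_simps)
    then show "form42 e (?A u) = 0"
      using reflection42_form[OF dd, of "?A e" u] reflection42_involution[OF dd, of e] by simp
  qed
  then obtain t where t: "t \<notin> (\<Union>w\<in>W. {t. form42 (q0 t) (?A w) = 0})"
    using uncountable_UNIV_real by (metis UNIV_eq_I)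
  have "form42 (?A (q0 t)) w = form42 (q0 t) (?A w)" for w
    using reflection42_form[OF dd, of "q0 t" "?A w"] reflection42_involution[OF dd, of w] by simp
  moreover have "form42 p (?A (q0 t)) = \<epsilon> * form42 e (q0 t)"
    by (subst p) (simp only: form42_simps reflection42_form[OF dd])
  ultimately show ?thesis
    using t q0 reflection42_form[OF dd]
    by (intro exI[of _ "?A (q0 t)"]) auto
qed

section \<open>Linear conserved quantities\<close>

lemma null_line_span:
  assumes "L \<in> null_lines" "u \<in> L" "u \<noteq> 0"
  shows "L = span {u}"
proof -
  have "subspace L" "dim L = 1" using assms(1) by (auto simp: null_lines_def)
  moreover have "span {u} \<subseteq> L" using assms(2) calculation(1) by (simp add: span_minimal)
  moreover have "dim (span {u}) = 1" using assms(3) by (simp add: dim_insert)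
  ultimately show ?thesis using subspace_dim_equal[of "span {u}" L] by auto
qed

text \<open>The two factors of a nonzero decomposable bivector on given lines are unique up to reciprocal
  scaling, which leaves their product unchanged; this makes the label well defined.\<close>

lemma inv_label_eq:
  assumes "s i = span {u}" "s j = span {v}" "\<eta> j i = wedge v u" "\<eta> j i \<noteq> 0"
  shows "inv_label s \<eta> i j = form42 u v"
  unfolding inv_label_def
proof (rule the_equality)
  show "\<exists>u'\<in>s i. \<exists>v'\<in>s j. \<eta> j i = wedge v' u' \<and> form42 u v = form42 u' v'"
    using assms by (intro bexI[of _ u] bexI[of _ v]) (auto simp: span_base)
  fix r assume "\<exists>u'\<in>s i. \<exists>v'\<in>s j. \<eta> j i = wedge v' u' \<and> r = form42 u' v'"
  then obtain a b where "\<eta> j i = wedge (b *\<^sub>R v) (a *\<^sub>R u)" "r = form42 (a *\<^sub>R u) (b *\<^sub>R v)"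
    using assms(1,2) by (auto simp: span_singleton)
  then have "(b * a - 1) *\<^sub>R wedge v u = 0" "r = b * a * form42 u v"
    using assms(3) by (simp_all add: wedge_simps form42_simps algebra_simps)
  then show "r = form42 u v" using assms(3,4) by simp
qed

lemma op_exp_square_zero:
  assumes "blinfun_apply A (blinfun_apply A z) = 0"
  shows "op_exp A z = z + blinfun_apply A z"
proof -
  have pow: "(blinfun_apply A ^^ n) z = 0" if "n \<notin> {0, 1}" for n
  proof -
    have "2 \<le> n" using that by (simp add: numeral_2_eq_2 Suc_le_eq)
    then obtain m where "n = m + 2" by (metis add.commute le_Suc_ex)
    then have "(blinfun_apply A ^^ n) z = (blinfun_apply A ^^ m) (blinfun_apply A (blinfun_apply A z))"
      by (simp only: funpow_add o_apply) (simp add: numeral_2_eq_2)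
    moreover have "(blinfun_apply A ^^ m) 0 = 0" for m by (induction m) auto
    ultimately show ?thesis using assms by simp
  qed
  have "op_exp A z = (\<Sum>n\<in>{0, 1}. (1 / fact n) *\<^sub>R (blinfun_apply A ^^ n) z)"
    unfolding op_exp_def by (rule suminf_finite) (use pow in auto)
  then show ?thesis by simp
qed

text \<open>The three eigenspaces for a finite label yield a formula without division by the label. For an
  orthogonal pair \<open>u\<close>, \<open>v\<close> the bivector squares to zero and the exponential series stops after the
  linear term, which gives the same formula.\<close>

lemma gamma_map_eq:
  assumes s: "s i = span {u}" "s j = span {v}" and eta: "\<eta> j i = wedge v u" "\<eta> j i \<noteq> 0"
    and null: "form42 u u = 0" "form42 v v = 0" and t: "t * form42 u v \<noteq> 1"
  shows "gamma_map s \<eta> t j i z =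
    z - (t * form42 u z) *\<^sub>R v + (t / (1 - t * form42 u v) * form42 v z) *\<^sub>R u"
proof -
  let ?r = "form42 u v"
  note r = inv_label_eq[where s = s and \<eta> = \<eta> and i = i and j = j, OF s eta]
  show ?thesis
  proof (cases "?r = 0")
    case True
    have A: "blinfun_apply (t *\<^sub>R \<eta> j i) w = (t * form42 v w) *\<^sub>R u - (t * form42 u w) *\<^sub>R v" for w
      by (simp add: eta wedge_apply blinfun.scaleR_left algebra_simps)
    have "blinfun_apply (t *\<^sub>R \<eta> j i) (blinfun_apply (t *\<^sub>R \<eta> j i) z) = 0"
      using True null form42_commute[of v u] by (simp add: A form42_simps)
    then show ?thesis
      using True r by (simp add: gamma_map_def Let_def op_exp_square_zero A)
  next
    case False
    define G where "G z = z - (t * form42 u z) *\<^sub>R v + (t / (1 - t * ?r) * form42 v z) *\<^sub>R u" for z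
    have t': "1 - t * ?r \<noteq> 0" using t by simp
    have Guv: "G v = (1 - t * ?r) *\<^sub>R v" "G u = inverse (1 - t * ?r) *\<^sub>R u"
    proof -
      show "G v = (1 - t * ?r) *\<^sub>R v" by (simp add: G_def null algebra_simps)
      have "G u = (1 + t / (1 - t * ?r) * ?r) *\<^sub>R u"
        using form42_commute[of v u] by (simp add: G_def null algebra_simps)
      also have "1 + t / (1 - t * ?r) * ?r = inverse (1 - t * ?r)" using t' by (simp add: field_simps)
      finally show "G u = inverse (1 - t * ?r) *\<^sub>R u" .
    qed
    have lin: "linear G"
      by (rule linearI) (simp_all add: G_def form42_simps add_divide_distrib algebra_simps)
    have perp: "w \<in> perp (s i \<union> s j) \<longleftrightarrow> form42 u w = 0 \<and> form42 v w = 0" for w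
    proof
      assume "w \<in> perp (s i \<union> s j)"
      moreover have "u \<in> s i" "v \<in> s j" by (simp_all add: s span_base)
      ultimately show "form42 u w = 0 \<and> form42 v w = 0" by (simp add: perp_def)
    next
      assume "form42 u w = 0 \<and> form42 v w = 0"
      then show "w \<in> perp (s i \<union> s j)" by (auto simp: perp_def s span_singleton form42_simps)
    qed
    have "(THE G. linear G \<and> (\<forall>v\<in>s j. G v = (1 - t * ?r) *\<^sub>R v) \<and>
        (\<forall>v\<in>perp (s i \<union> s j). G v = v) \<and> (\<forall>v\<in>s i. G v = inverse (1 - t * ?r) *\<^sub>R v)) = G"
    proof (rule the_equality)
      show "linear G \<and> (\<forall>v\<in>s j. G v = (1 - t * ?r) *\<^sub>R v) \<and>
        (\<forall>v\<in>perp (s i \<union> s j). G v = v) \<and> (\<forall>v\<in>s i. G v = inverse (1 - t * ?r) *\<^sub>R v)"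
      proof (intro conjI ballI)
        fix w assume "w \<in> s j"
        then obtain c where "w = c *\<^sub>R v" by (auto simp: s span_singleton)
        then show "G w = (1 - t * ?r) *\<^sub>R w"
          using linear_scale[OF lin, of c v] by (simp add: Guv mult.commute)
      next
        fix w assume "w \<in> s i"
        then obtain c where "w = c *\<^sub>R u" by (auto simp: s span_singleton)
        then show "G w = inverse (1 - t * ?r) *\<^sub>R w"
          using linear_scale[OF lin, of c u] by (simp add: Guv mult.commute)
      next
        fix w assume "w \<in> perp (s i \<union> s j)"
        then show "G w = w" by (simp add: perp G_def)
      qed (rule lin)
    next
      fix H assume H: "linear H \<and> (\<forall>v\<in>s j. H v = (1 - t * ?r) *\<^sub>R v) \<and>
        (\<forall>v\<in>perp (s i \<union> s j). H v = v) \<and> (\<forall>v\<in>s i. H v = inverse (1 - t * ?r) *\<^sub>R v)"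
      show "H = G"
      proof
        fix z
        define \<alpha> \<beta> where "\<alpha> = form42 u z / ?r" and "\<beta> = form42 v z / ?r"
        define z' where "z' = z - \<alpha> *\<^sub>R v - \<beta> *\<^sub>R u"
        have z': "z' \<in> perp (s i \<union> s j)"
          using False null form42_commute[of v u]
          by (simp add: perp z'_def form42_simps \<alpha>_def \<beta>_def)
        have z: "z = z' + \<alpha> *\<^sub>R v + \<beta> *\<^sub>R u" by (simp add: z'_def)
        have "H z = z' + \<alpha> *\<^sub>R H v + \<beta> *\<^sub>R H u"
          using H z' by (subst z) (simp add: linear_add linear_scale)
        moreover have "G z = z' + \<alpha> *\<^sub>R G v + \<beta> *\<^sub>R G u"
          using lin z' perp by (subst z) (simp add: linear_add linear_scale, simp add: G_def)
        moreover have "H v = G v" "H u = G u"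
          using H Guv by (auto simp: s span_base)
        ultimately show "H z = G z" by simp
      qed
    qed
    then show ?thesis using False r by (simp add: gamma_map_def Let_def G_def)
  qed
qed

text \<open>With the edge transport written out, parallelism of \<open>p 0 + t p 1\<close> becomes the vanishing of a
  quadratic polynomial in \<open>t\<close> for all admissible \<open>t\<close>. Its constant coefficient is the difference
  equation for \<open>p 1\<close>; on edges with infinite label its linear coefficient gives orthogonality.\<close>

lemma linear_conserved_quantityD:
  assumes iso: "isothermic_with D s \<eta>" and cons: "conserved_quantity D s \<eta> 1 p"
    and e: "edge D i j" and uv: "u \<in> s i" "v \<in> s j" "\<eta> j i = wedge v u"
  shows "p 0 j = p 0 i" "p 1 j = p 1 i + blinfun_apply (\<eta> j i) (p 0 i)"
    "form42 u v = 0 \<Longrightarrow> form42 u (p 1 i) = 0 \<and> form42 v (p 1 i) = 0"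
proof -
  let ?r = "form42 u v"
  have eta: "\<eta> j i \<noteq> 0" using iso e by (auto simp: isothermic_with_def)
  then have nz: "u \<noteq> 0" "v \<noteq> 0" using uv(3) by (auto simp: wedge_simps)
  have L: "s i \<in> null_lines" "s j \<in> null_lines"
    using iso edge_mem[OF e] by (auto simp: isothermic_with_def)
  note s = null_line_span[OF L(1) uv(1) nz(1)] null_line_span[OF L(2) uv(2) nz(2)]
  have null: "form42 u u = 0" "form42 v v = 0" using L uv by (auto simp: null_lines_def)
  have P: "poly_section 1 p t z = p 0 z + t *\<^sub>R p 1 z" for t z
    by (simp add: poly_section_def)
  have G: "p 0 j + t *\<^sub>R p 1 j = p 0 i + t *\<^sub>R p 1 i - (t * form42 u (p 0 i + t *\<^sub>R p 1 i)) *\<^sub>R v +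
      (t / (1 - t * ?r) * form42 v (p 0 i + t *\<^sub>R p 1 i)) *\<^sub>R u" if t: "t * ?r \<noteq> 1" for t
  proof -
    have "gamma_map s \<eta> t j i (poly_section 1 p t i) = poly_section 1 p t j"
      using cons e t inv_label_eq[where s = s and \<eta> = \<eta> and i = i and j = j, OF s uv(3) eta] by (auto simp: conserved_quantity_def)
    then show ?thesis using gamma_map_eq[where s = s and \<eta> = \<eta> and i = i and j = j, OF s uv(3) eta null t] unfolding P by simp
  qed
  show p0: "p 0 j = p 0 i" using G[of 0] by simp
  define C0 where "C0 = p 1 i - p 1 j + blinfun_apply (\<eta> j i) (p 0 i)"
  define C1 where "C1 = ?r *\<^sub>R (p 1 j - p 1 i + form42 u (p 0 i) *\<^sub>R v)
    - form42 u (p 1 i) *\<^sub>R v + form42 v (p 1 i) *\<^sub>R u"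
  define C2 where "C2 = (?r * form42 u (p 1 i)) *\<^sub>R v"
  have C: "C0 + t *\<^sub>R C1 + (t * t) *\<^sub>R C2 = 0" if t: "t \<noteq> 0" "t * ?r \<noteq> 1" for t
  proof -
    have "t *\<^sub>R (p 1 j - p 1 i + (form42 u (p 0 i + t *\<^sub>R p 1 i)) *\<^sub>R v -
      (1 / (1 - t * ?r) * form42 v (p 0 i + t *\<^sub>R p 1 i)) *\<^sub>R u) = 0"
      using G[OF t(2)] p0 by (simp add: algebra_simps)
    then have "(1 - t * ?r) *\<^sub>R (p 1 j - p 1 i + (form42 u (p 0 i + t *\<^sub>R p 1 i)) *\<^sub>R v -
      (1 / (1 - t * ?r) * form42 v (p 0 i + t *\<^sub>R p 1 i)) *\<^sub>R u) = 0"
      using t(1) by simp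
    moreover have "(1 - t * ?r) * (1 / (1 - t * ?r) * form42 v (p 0 i + t *\<^sub>R p 1 i))
        = form42 v (p 0 i + t *\<^sub>R p 1 i)" using t(2) by simp
    ultimately have "(1 - t * ?r) *\<^sub>R (p 1 j - p 1 i + (form42 u (p 0 i + t *\<^sub>R p 1 i)) *\<^sub>R v) -
      (form42 v (p 0 i + t *\<^sub>R p 1 i)) *\<^sub>R u = 0"
      by (simp only: scaleR_diff_right scaleR_scaleR)
    then show ?thesis
      by (simp add: C0_def C1_def C2_def uv(3) wedge_apply form42_simps algebra_simps)
  qed
  \<comment> \<open>small enough for \<open>t\<close>, \<open>2 t\<close>, \<open>3 t\<close> to stay away from the pole at \<open>1 / r\<close>\<close>
  define t where "t = 1 / (6 * (1 + \<bar>?r\<bar>))"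
  have t: "t > 0" "\<bar>t * ?r\<bar> < 1 / 3" "t \<noteq> 0"
    by (simp_all add: t_def abs_mult field_simps add_pos_nonneg)
  have "t * ?r \<noteq> 1" "2 * t * ?r \<noteq> 1" "3 * t * ?r \<noteq> 1" using t(2) by auto
  then have zero: "C0 + t *\<^sub>R C1 + (t * t) *\<^sub>R C2 = 0"
    "C0 + (2 * t) *\<^sub>R C1 + (2 * t * (2 * t)) *\<^sub>R C2 = 0"
    "C0 + (3 * t) *\<^sub>R C1 + (3 * t * (3 * t)) *\<^sub>R C2 = 0"
    using C[of t] C[of "2 * t"] C[of "3 * t"] t(3) by auto
  \<comment> \<open>the third difference of a quadratic polynomial vanishes\<close>
  have "C0 = 3 *\<^sub>R (C0 + t *\<^sub>R C1 + (t * t) *\<^sub>R C2)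
      - 3 *\<^sub>R (C0 + (2 * t) *\<^sub>R C1 + (2 * t * (2 * t)) *\<^sub>R C2)
      + (C0 + (3 * t) *\<^sub>R C1 + (3 * t * (3 * t)) *\<^sub>R C2)"
    by (simp add: algebra_simps flip: scaleR_add_left)
  then have C0: "C0 = 0" unfolding zero by simp
  have "p 1 j = p 1 i + blinfun_apply (\<eta> j i) (p 0 i) - C0" by (simp add: C0_def)
  then show "p 1 j = p 1 i + blinfun_apply (\<eta> j i) (p 0 i)" using C0 by simp
  show "form42 u (p 1 i) = 0 \<and> form42 v (p 1 i) = 0" if r: "?r = 0"
  proof -
    have "form42 u (p 1 i) *\<^sub>R v = form42 v (p 1 i) *\<^sub>R u"
      using C[of 1] C0 r by (simp add: C1_def C2_def)
    then have "form42 v (p 1 i) *\<^sub>R wedge v u = 0" "form42 u (p 1 i) *\<^sub>R wedge v u = 0"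
      by (metis wedge_scale_left wedge_scale_right wedge_self scale_eq_0_iff)+
    then show ?thesis using eta uv(3) by simp
  qed
qed

section \<open>Koenigs nets of null vectors\<close>

text \<open>Parallel diagonals express that the bivectors \<open>g j \<and> g i\<close> sum to zero around a quadrilateral,
  so this is the closing condition of the isothermic 1-form written without the 1-form. Since
  quadrilaterals may start at any vertex, the last condition speaks of both diagonals.\<close>

definition null_koenigs :: "(int ^ 'n) set \<Rightarrow> r42 \<Rightarrow> (int ^ 'n \<Rightarrow> r42) \<Rightarrow> bool" where
  "null_koenigs D p g \<longleftrightarrow> (\<forall>i\<in>D. form42 (g i) (g i) = 0 \<and> form42 p (g i) = -1) \<and>
     (\<forall>i j. edge D i j \<longrightarrow> g i \<noteq> g j) \<and>
     (\<forall>i j k l. quad D i j k l \<longrightarrow>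
        wedge (g k - g i) (g l - g j) = 0 \<and> form42 (g j) (g l) \<noteq> 0)"

lemma normalised_span_eq:
  assumes "form42 p a = -1" "form42 p b = -1" "span {a} = span {b}"
  shows "a = b"
proof -
  obtain r where "a = r *\<^sub>R b"
    using assms(3) span_base[of a "{a}"] by (auto simp: span_singleton)
  then show ?thesis using assms(1,2) by (simp add: form42_simps)
qed

lemma null_in_hyperbolic_plane:
  assumes "c = \<alpha> *\<^sub>R a + \<beta> *\<^sub>R b" "form42 a a = 0" "form42 b b = 0" "form42 c c = 0" "form42 a b \<noteq> 0"
  shows "\<alpha> = 0 \<or> \<beta> = 0"
proof -
  have "form42 c c = 2 * (\<alpha> * \<beta> * form42 a b)"
    using assms(2,3) form42_commute[of b a] by (simp add: assms(1) form42_simps)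
  then show ?thesis using assms by simp
qed

text \<open>A plane spanned by two nonorthogonal null vectors contains no further null lines. So the
  nonorthogonal diagonals and the distinct neighbours, compared through the normalisation against
  \<open>p\<close>, imply all regularity conditions.\<close>

lemma null_koenigs_isothermic:
  assumes g: "null_koenigs D p g"
  shows "isothermic_with D (\<lambda>i. span {g i}) (\<lambda>j i. wedge (g j) (g i))"
proof -
  have v: "form42 (g i) (g i) = 0" "form42 p (g i) = -1" if "i \<in> D" for i
    using g that by (auto simp: null_koenigs_def)
  have ne: "g i \<noteq> g j" if "edge D i j" for i j
    using g that by (auto simp: null_koenigs_def)
  have nz: "g i \<noteq> 0" if "i \<in> D" for i
    using v[OF that] by (auto simp: form42_simps)
  have wne: "wedge (g j) (g i) \<noteq> 0" if e: "edge D i j" for i j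
  proof
    assume "wedge (g j) (g i) = 0"
    then obtain m where "g j = m *\<^sub>R g i" using wedge_eq_0 nz edge_mem[OF e] by blast
    moreover have "m = 1"
      using v(2)[OF edge_mem(1)[OF e]] v(2)[OF edge_mem(2)[OF e]] calculation
      by (simp add: form42_simps)
    ultimately show False using ne[OF e] by simp
  qed
  have reg: "isothermic_regular D (\<lambda>i. span {g i})"
    unfolding isothermic_regular_def
  proof (intro allI impI)
    fix i j k l assume q: "quad D i j k l"
    note E = quad_edges[OF q]
    have D: "i \<in> D" "j \<in> D" "k \<in> D" "l \<in> D" using E edge_mem by blast+
    have jl: "form42 (g j) (g l) \<noteq> 0" and ik: "form42 (g k) (g i) \<noteq> 0"
      using g q quad_rotate[OF q] by (auto simp: null_koenigs_def)
    have d: "g i \<noteq> g j" "g j \<noteq> g k" "g k \<noteq> g l" "g l \<noteq> g i" "g i \<noteq> g k" "g j \<noteq> g l"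
      using ne E jl ik v D by auto
    have seq: "span {g a} = span {g b} \<longleftrightarrow> g a = g b" if "a \<in> D" "b \<in> D" for a b
      using normalised_span_eq[of p "g a" "g b"] v that by auto
    have "distinct [span {g i}, span {g j}, span {g k}, span {g l}]"
      using d D by (auto simp: seq)
    moreover have "\<not> span {g i} \<subseteq> perp (span {g k})" "\<not> span {g j} \<subseteq> perp (span {g l})"
      using jl ik form42_commute[of "g j" "g l"] span_base[of _ "{_}"]
      by (fastforce simp: perp_def)+
    moreover have "dim (span (span {g i} \<union> span {g j} \<union> span {g k} \<union> span {g l})) \<ge> 3"
    proof -
      have "g j \<notin> span {g i, g k}"
      proof
        assume "g j \<in> span {g i, g k}"
        then obtain \<alpha> \<beta> where ab: "g j = \<alpha> *\<^sub>R g i + \<beta> *\<^sub>R g k"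
          by (auto simp: span_insert span_singleton algebra_simps)
        moreover have "\<alpha> = 0 \<or> \<beta> = 0"
          by (rule null_in_hyperbolic_plane[OF ab]) (use v D ik form42_commute in \<open>auto simp: form42_commute\<close>)
        ultimately show False
          using d v(2)[OF D(1)] v(2)[OF D(2)] v(2)[OF D(3)] by (auto simp: form42_simps)
      qed
      moreover have "g i \<notin> span {g k}"
        using ik v D by (auto simp: span_singleton form42_simps)
      ultimately have "independent {g j, g i, g k}"
        using nz D by (simp add: independent_insert)
      moreover have "card {g j, g i, g k} = 3" using d by simp
      moreover have "{g j, g i, g k} \<subseteq> span (span {g i} \<union> span {g j} \<union> span {g k} \<union> span {g l})"
        using span_base[of "g i" "{g i}"] span_base[of "g j" "{g j}"] span_base[of "g k" "{g k}"]
        by (auto intro!: span_base)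
      ultimately show ?thesis by (metis independent_card_le_dim)
    qed
    ultimately show "distinct [span {g i}, span {g j}, span {g k}, span {g l}] \<and>
      3 \<le> dim (span (span {g i} \<union> span {g j} \<union> span {g k} \<union> span {g l})) \<and>
      \<not> span {g i} \<subseteq> perp (span {g k}) \<and> \<not> span {g j} \<subseteq> perp (span {g l})"
      by blast
  qed
  have "closed_form D (\<lambda>j i. wedge (g j) (g i))"
    unfolding closed_form_def
  proof (intro conjI allI impI)
    show "wedge (g j) (g i) = - wedge (g i) (g j)" for i j by (rule wedge_anticommute)
    fix i j k l assume "quad D i j k l"
    then have "wedge (g k - g i) (g l - g j) = 0" using g by (auto simp: null_koenigs_def)
    moreover have "wedge (g i) (g l) + wedge (g l) (g k) + wedge (g k) (g j) + wedge (g j) (g i)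
        = - wedge (g k - g i) (g l - g j)"
      by (simp add: wedge_simps wedge_anticommute[of "g k" "g l"] wedge_anticommute[of "g i" "g j"])
    ultimately show
      "wedge (g i) (g l) + wedge (g l) (g k) + wedge (g k) (g j) + wedge (g j) (g i) = 0"
      by simp
  qed
  moreover have "span {g i} \<in> null_lines" if "i \<in> D" for i
  proof -
    have "form42 u u = 0" if "u \<in> span {g i}" for u
      using that v[OF \<open>i \<in> D\<close>] by (auto simp: span_singleton form42_simps)
    then show ?thesis using nz[OF that] by (simp add: null_lines_def dim_insert)
  qed
  moreover have "\<exists>v\<in>span {g j}. \<exists>u\<in>span {g i}. wedge (g j) (g i) = wedge v u" for i j
    by (intro bexI[of _ "g j"] bexI[of _ "g i"]) (auto simp: span_base)
  ultimately show ?thesis using reg wne by (auto simp: isothermic_with_def)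
qed

text \<open>The edge transport of \<open>p + t g i\<close> adds \<open>t g j\<close> and, because of \<open>(g j, p + t g i) = t r - 1\<close> for the
  inverse label \<open>r\<close>, removes \<open>t g i\<close>. Hence a Koenigs net is the linear part of a conserved
  quantity.\<close>

lemma null_koenigs_conserved:
  assumes g: "null_koenigs D p g" and D: "D \<noteq> {}"
  shows "conserved_quantity D (\<lambda>i. span {g i}) (\<lambda>j i. wedge (g j) (g i)) 1
    (\<lambda>n i. if n = 0 then p else g i)"
  unfolding conserved_quantity_def
proof (intro conjI allI impI)
  have v: "form42 (g i) (g i) = 0" "form42 p (g i) = -1" if "i \<in> D" for i
    using g that by (auto simp: null_koenigs_def)
  then show "\<exists>i\<in>D. (if (1::nat) = 0 then p else g i) \<noteq> 0" using D by (force simp: form42_simps)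
  fix i j and t :: real
  let ?s = "\<lambda>i. span {g i}" and ?\<eta> = "\<lambda>j i. wedge (g j) (g i)"
  assume *: "edge D i j \<and> t * inv_label ?s ?\<eta> i j \<noteq> 1"
  then have e: "edge D i j" by blast
  have eta: "?\<eta> j i \<noteq> 0"
    using null_koenigs_isothermic[OF g] e by (auto simp: isothermic_with_def)
  let ?r = "form42 (g i) (g j)"
  have r: "inv_label ?s ?\<eta> i j = ?r" by (rule inv_label_eq) (use eta in auto)
  then have t: "t * ?r \<noteq> 1" using * by simp
  have D: "i \<in> D" "j \<in> D" using edge_mem[OF e] by auto
  have p: "form42 (g i) p = -1" "form42 (g j) p = -1" using v D form42_commute by metis+
  have "t / (1 - t * ?r) * (t * ?r - 1) = - t" using t by (simp add: field_simps)
  then show "gamma_map ?s ?\<eta> t j i (poly_section 1 (\<lambda>n i. if n = 0 then p else g i) t i) =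
    poly_section 1 (\<lambda>n i. if n = 0 then p else g i) t j"
    using form42_commute[of "g j" "g i"]
    by (subst gamma_map_eq[where u = "g i" and v = "g j"])
       (use eta v D t in \<open>auto simp: poly_section_def form42_simps p\<close>)
qed

section \<open>Euclidean projection of a Lie frame\<close>

definition frame_proj :: "r42 \<Rightarrow> r42 \<Rightarrow> r42 \<Rightarrow> r42 \<Rightarrow> r42" where
  "frame_proj \<pp> \<oo> \<qq> z =
     z + form42 z \<pp> *\<^sub>R \<pp> + form42 z \<qq> *\<^sub>R \<oo> + form42 z \<oo> *\<^sub>R \<qq>"

lemma lie_frameD:
  assumes "lie_frame \<pp> \<oo> \<qq>"
  shows "form42 \<pp> \<pp> = -1" "form42 \<oo> \<oo> = 0" "form42 \<qq> \<qq> = 0" "form42 \<oo> \<pp> = 0"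
    "form42 \<pp> \<oo> = 0" "form42 \<qq> \<pp> = 0" "form42 \<pp> \<qq> = 0" "form42 \<oo> \<qq> = -1" "form42 \<qq> \<oo> = -1"
  using assms form42_commute[of \<pp> \<oo>] form42_commute[of \<pp> \<qq>] form42_commute[of \<qq> \<oo>]
  by (auto simp: lie_frame_def)

lemma frame_proj_linear:
  "frame_proj \<pp> \<oo> \<qq> (u + v) = frame_proj \<pp> \<oo> \<qq> u + frame_proj \<pp> \<oo> \<qq> v"
  "frame_proj \<pp> \<oo> \<qq> (u - v) = frame_proj \<pp> \<oo> \<qq> u - frame_proj \<pp> \<oo> \<qq> v"
  "frame_proj \<pp> \<oo> \<qq> (r *\<^sub>R u) = r *\<^sub>R frame_proj \<pp> \<oo> \<qq> u"
  "frame_proj \<pp> \<oo> \<qq> 0 = 0"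
  by (simp_all add: frame_proj_def form42_simps algebra_simps)

lemma frame_proj_adjoint:
  "form42 (frame_proj \<pp> \<oo> \<qq> u) v = form42 u (frame_proj \<pp> \<oo> \<qq> v)"
  using form42_commute[of \<pp> v] form42_commute[of \<oo> v] form42_commute[of \<qq> v]
  by (simp add: frame_proj_def form42_simps)

lemma frame_proj_perp:
  assumes "lie_frame \<pp> \<oo> \<qq>"
  shows "frame_proj \<pp> \<oo> \<qq> z \<in> perp {\<pp>, \<oo>, \<qq>}"
  using lie_frameD[OF assms] form42_commute[of z] by (simp add: perp_def frame_proj_def form42_simps)

lemma frame_proj_fixes:
  assumes "z \<in> perp {\<pp>, \<oo>, \<qq>}"
  shows "frame_proj \<pp> \<oo> \<qq> z = z"
  using assms form42_commute[of z] by (simp add: perp_def frame_proj_def)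

lemma frame_proj_qq:
  assumes "lie_frame \<pp> \<oo> \<qq>"
  shows "frame_proj \<pp> \<oo> \<qq> \<qq> = 0"
  using lie_frameD[OF assms] by (simp add: frame_proj_def)

lemma frame_decomposition:
  "z = frame_proj \<pp> \<oo> \<qq> z - form42 z \<pp> *\<^sub>R \<pp> - form42 z \<qq> *\<^sub>R \<oo> - form42 z \<oo> *\<^sub>R \<qq>"
  by (simp add: frame_proj_def)

lemma wedge_frame_proj:
  "form42 (blinfun_apply (wedge (frame_proj \<pp> \<oo> \<qq> a) (frame_proj \<pp> \<oo> \<qq> b)) u) v =
   form42 (blinfun_apply (wedge a b) (frame_proj \<pp> \<oo> \<qq> u)) (frame_proj \<pp> \<oo> \<qq> v)"
  by (simp add: form42_wedge frame_proj_adjoint)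

text \<open>The kernel vector \<open>z\<close> replaces \<open>\<oo>\<close> as the fourth vector of a basis: only the components of
  \<open>B\<close> that do not involve \<open>\<oo>\<close> have to be controlled.\<close>

lemma bivector_eq_0_frame:
  fixes B :: bivector
  assumes frame: "lie_frame \<pp> \<oo> \<qq>"
    and skew: "\<And>u v. form42 (blinfun_apply B u) v = - form42 (blinfun_apply B v) u"
    and Bp: "blinfun_apply B \<pp> = 0"
    and Bq: "\<And>u. form42 (blinfun_apply B \<qq>) (frame_proj \<pp> \<oo> \<qq> u) = 0"
    and BE: "\<And>u v. form42 (blinfun_apply B (frame_proj \<pp> \<oo> \<qq> u)) (frame_proj \<pp> \<oo> \<qq> v) = 0"
    and z: "blinfun_apply B z = 0" "form42 z \<qq> \<noteq> 0"
  shows "B = 0"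
proof -
  let ?\<pi> = "frame_proj \<pp> \<oo> \<qq>"
  have zero: "blinfun_apply B u = 0"
    if p: "form42 (blinfun_apply B u) \<pp> = 0" and q: "form42 (blinfun_apply B u) \<qq> = 0"
      and E: "\<And>w. form42 (blinfun_apply B u) (?\<pi> w) = 0" for u
  proof (rule form42_nondegenerate)
    fix w
    have *: "form42 (blinfun_apply B u) w = - form42 w \<qq> * form42 (blinfun_apply B u) \<oo>" for w
      by (subst (1) frame_decomposition[of w \<pp> \<oo> \<qq>]) (simp add: form42_simps p q E)
    have "form42 (blinfun_apply B u) z = 0" using skew[of u z] z by (simp add: form42_simps)
    then have "form42 (blinfun_apply B u) \<oo> = 0" using *[of z] z by simp
    then show "form42 w (blinfun_apply B u) = 0" using * form42_commute by simp
  qed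
  have p0: "form42 (blinfun_apply B u) \<pp> = 0" for u using skew[of u \<pp>] Bp by (simp add: form42_simps)
  have "form42 (blinfun_apply B \<qq>) \<qq> = 0" using skew[of \<qq> \<qq>] by linarith
  then have Bq0: "blinfun_apply B \<qq> = 0"
    using zero[OF p0 _ Bq] by blast
  then have q0: "form42 (blinfun_apply B u) \<qq> = 0" for u using skew[of u \<qq>] by (simp add: form42_simps)
  have BE0: "blinfun_apply B (?\<pi> u) = 0" for u by (rule zero[OF p0 q0 BE])
  have B: "blinfun_apply B u = - form42 u \<qq> *\<^sub>R blinfun_apply B \<oo>" for u
    by (subst (1) frame_decomposition[of u \<pp> \<oo> \<qq>])
       (simp add: blinfun.add_right blinfun.diff_right blinfun.scaleR_right BE0 Bp Bq0)
  have "blinfun_apply B \<oo> = 0" using B[of z] z by simp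
  then have "blinfun_apply B u = 0" for u using B[of u] by simp
  then show ?thesis by (intro blinfun_eqI) simp
qed

section \<open>Mixed areas\<close>

text \<open>If \<open>y\<close> is edge-parallel to \<open>x\<close>, each term \<open>\<rho> x j \<and> x i\<close> is the wedge product of the edge of \<open>y\<close>
  with the midpoint of the edge of \<open>x\<close>; summed over a quadrilateral this is a mixed area.\<close>

lemma closure_mixed_area:
  fixes x y n :: "int ^ 'n \<Rightarrow> r42"
  assumes "y j - y i = a *\<^sub>R (x j - x i)" "y k - y j = b *\<^sub>R (x k - x j)"
    "y l - y k = c *\<^sub>R (x l - x k)" "y i - y l = d *\<^sub>R (x i - x l)"
  shows "(d *\<^sub>R wedge (x i) (x l) + wedge (n i) (n l)) + (c *\<^sub>R wedge (x l) (x k) + wedge (n l) (n k))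
      + (b *\<^sub>R wedge (x k) (x j) + wedge (n k) (n j)) + (a *\<^sub>R wedge (x j) (x i) + wedge (n j) (n i))
    = - (form_wedge (df y) (df x) l k j i + form_wedge (df n) (df n) l k j i)"
proof -
  have half: "r *\<^sub>R wedge v u = (1/2) *\<^sub>R wedge t (u + v)" if "t = r *\<^sub>R (v - u)" for r t u v
    by (rule bivector_eqI) (simp add: that form42_wedge form42_simps blinfun_left_simps field_simps)
  show ?thesis
    unfolding half[OF assms(1)] half[OF assms(2)] half[OF assms(3)] half[OF assms(4)]
    by (rule bivector_eqI)
       (simp add: form_wedge_def df_def form42_wedge form42_simps blinfun_left_simps field_simps)
qed

section \<open>Framed nets\<close>

text \<open>The point and tangent plane spheres of the principal net span the null planes of its lift;
  they are normalised against the frame. In one direction of the equivalence these spheres come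
  from the lift, in the other one from the conserved quantity.\<close>

locale framed_net =
  fixes S :: "(int ^ 'n) set" and f :: "int ^ 'n \<Rightarrow> r42 set" and \<pp> \<oo> \<qq> :: r42
    and X N :: "int ^ 'n \<Rightarrow> r42"
  assumes omega: "omega_net S f" and frame: "lie_frame \<pp> \<oo> \<qq>"
    and plane: "\<And>i. i \<in> S \<Longrightarrow> f i = span {X i, N i}"
    and X_pp: "\<And>i. i \<in> S \<Longrightarrow> form42 (X i) \<pp> = 0" and X_qq: "\<And>i. i \<in> S \<Longrightarrow> form42 (X i) \<qq> = -1"
    and N_pp: "\<And>i. i \<in> S \<Longrightarrow> form42 (N i) \<pp> = -1" and N_qq: "\<And>i. i \<in> S \<Longrightarrow> form42 (N i) \<qq> = 0"
    and curvature_sphere: "\<And>i j. edge S i j \<Longrightarrow> \<exists>\<kappa>. \<kappa> *\<^sub>R X i + N i = \<kappa> *\<^sub>R X j + N j"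
begin

abbreviation \<pi> :: "r42 \<Rightarrow> r42" where "\<pi> \<equiv> frame_proj \<pp> \<oo> \<qq>"

lemma X_in: "i \<in> S \<Longrightarrow> X i \<in> f i" and N_in: "i \<in> S \<Longrightarrow> N i \<in> f i"
  by (simp_all add: plane span_base)

lemma null:
  assumes "i \<in> S"
  shows "form42 (X i) (X i) = 0" "form42 (X i) (N i) = 0" "form42 (N i) (X i) = 0"
    "form42 (N i) (N i) = 0"
  using omega X_in[OF assms] N_in[OF assms] assms by (auto simp: omega_net_def null_planes_def)

lemma X_distinct:
  assumes e: "edge S i j" shows "X i \<noteq> X j"
proof
  assume X: "X i = X j"
  then have "N i = N j" using curvature_sphere[OF e] by auto
  then have "f i = f j" using X plane edge_mem[OF e] by simp
  moreover have "dim (span (f i \<union> f j)) = 3" using omega e by (auto simp: omega_net_def omega_regular_def)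
  moreover have "dim (f i) = 2" using omega edge_mem[OF e] by (auto simp: omega_net_def null_planes_def)
  ultimately show False by simp
qed

lemma X_nonorth:
  assumes e: "edge S i j" shows "form42 (X i) (X j) \<noteq> 0"
proof
  note S = edge_mem[OF e]
  assume "form42 (X i) (X j) = 0"
  moreover have "form42 \<pp> (X i) = 0" "form42 \<pp> (X j) = 0" using X_pp S form42_commute by simp_all
  ultimately obtain a b where ab: "(a, b) \<noteq> (0, 0)" "a *\<^sub>R X i + b *\<^sub>R X j = 0"
    using null_dependent_2[of "X i" "X j" \<pp>] null S lie_frameD[OF frame] by blast
  have "form42 (a *\<^sub>R X i + b *\<^sub>R X j) \<qq> = 0" using ab by (simp add: form42_simps)
  then have "b = - a" using X_qq S by (simp add: form42_simps)
  then have "a *\<^sub>R (X i - X j) = 0" "a \<noteq> 0" using ab by (auto simp: algebra_simps)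
  then show False using X_distinct[OF e] by simp
qed

lemma wedge_X_nonzero:
  assumes e: "edge S i j" shows "wedge (X j) (X i) \<noteq> 0"
proof
  note S = edge_mem[OF e]
  assume "wedge (X j) (X i) = 0"
  moreover have "X i \<noteq> 0" using X_qq[OF S(1)] by (auto simp: form42_simps)
  ultimately obtain m where "X j = m *\<^sub>R X i" using wedge_eq_0 by blast
  then have "form42 (X i) (X j) = 0" using null(1)[OF S(1)] by (simp add: form42_simps)
  then show False using X_nonorth[OF e] by blast
qed

text \<open>The curvature sphere \<open>sig i j\<close> spans the intersection of the two null planes. Its coefficient
  \<open>kap i j\<close> is unique because \<open>X i\<close> and \<open>X j\<close> differ; it is the principal curvature of the edge.\<close>

definition kap :: "int ^ 'n \<Rightarrow> int ^ 'n \<Rightarrow> real" where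
  "kap i j = (SOME \<kappa>. \<kappa> *\<^sub>R X i + N i = \<kappa> *\<^sub>R X j + N j)"

definition sig :: "int ^ 'n \<Rightarrow> int ^ 'n \<Rightarrow> r42" where
  "sig i j = kap i j *\<^sub>R X i + N i"

lemma kap: "edge S i j \<Longrightarrow> kap i j *\<^sub>R X i + N i = kap i j *\<^sub>R X j + N j"
  unfolding kap_def by (rule someI_ex) (rule curvature_sphere)

lemma kap_unique:
  assumes e: "edge S i j" and "\<kappa> *\<^sub>R X i + N i = \<kappa> *\<^sub>R X j + N j"
  shows "\<kappa> = kap i j"
proof -
  have "(\<kappa> - kap i j) *\<^sub>R (X i - X j)
      = (\<kappa> *\<^sub>R X i + N i - (\<kappa> *\<^sub>R X j + N j)) - (kap i j *\<^sub>R X i + N i - (kap i j *\<^sub>R X j + N j))"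
    by (simp add: algebra_simps)
  then have "(\<kappa> - kap i j) *\<^sub>R (X i - X j) = 0" using assms kap[OF e] by simp
  then show ?thesis using X_distinct[OF e] by simp
qed

lemma kap_sym: "edge S i j \<Longrightarrow> kap i j = kap j i"
  using kap_unique[of i j "kap j i"] kap[of j i] edge_sym[of S i j] by simp

lemma sig_eq:
  assumes "edge S i j"
  shows "sig i j = kap i j *\<^sub>R X j + N j" "sig j i = kap i j *\<^sub>R X i + N i"
  using kap[OF assms] kap_sym[OF assms] by (simp_all add: sig_def)

lemma plane_element:
  assumes "i \<in> S" "a \<in> f i"
  shows "a = (- form42 a \<qq>) *\<^sub>R X i + (- form42 a \<pp>) *\<^sub>R N i"
proof -
  obtain r s where "a = r *\<^sub>R X i + s *\<^sub>R N i"
    using assms by (auto simp: plane span_insert span_singleton algebra_simps)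
  then show ?thesis using X_pp X_qq N_pp N_qq assms(1) by (simp add: form42_simps)
qed

lemma meet_eq_sig:
  assumes e: "edge S i j" and a: "a \<in> f i \<inter> f j"
  shows "\<exists>c. a = c *\<^sub>R sig i j"
proof -
  obtain u v where i: "a = u *\<^sub>R X i + v *\<^sub>R N i" and j: "a = u *\<^sub>R X j + v *\<^sub>R N j"
    using plane_element a edge_mem[OF e] by blast
  have Ni: "N i = sig i j - kap i j *\<^sub>R X i" and Nj: "N j = sig i j - kap i j *\<^sub>R X j"
    using sig_eq(1)[OF e] sig_def[of i j] by (metis add_diff_cancel_left')+
  have i': "a = (u - v * kap i j) *\<^sub>R X i + v *\<^sub>R sig i j"
    by (subst i, subst Ni) (simp add: algebra_simps)
  have j': "a = (u - v * kap i j) *\<^sub>R X j + v *\<^sub>R sig i j"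
    by (subst j, subst Nj) (simp add: algebra_simps)
  have "(u - v * kap i j) *\<^sub>R (X i - X j) = ((u - v * kap i j) *\<^sub>R X i + v *\<^sub>R sig i j)
      - ((u - v * kap i j) *\<^sub>R X j + v *\<^sub>R sig i j)"
    by (simp add: scaleR_diff_right)
  then have "(u - v * kap i j) *\<^sub>R (X i - X j) = 0" by (metis i' j' cancel_comm_monoid_add_class.diff_cancel)
  then have "u - v * kap i j = 0" using X_distinct[OF e] by simp
  then show ?thesis using i' by auto
qed

text \<open>The independent vectors that regularity provides in the intersections of adjacent null planes are
  nonzero multiples of the curvature spheres.\<close>

lemma quad_independent:
  assumes q: "quad S i j k l"
    and "\<alpha> *\<^sub>R sig i j + \<beta> *\<^sub>R sig j k + \<gamma> *\<^sub>R sig k l + \<delta> *\<^sub>R sig l i = 0"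
  shows "\<alpha> = 0 \<and> \<beta> = 0 \<and> \<gamma> = 0 \<and> \<delta> = 0"
proof -
  note E = quad_edges[OF q]
  obtain a b c d where w: "a \<in> f i \<inter> f j" "b \<in> f j \<inter> f k" "c \<in> f k \<inter> f l" "d \<in> f l \<inter> f i"
    "wedge4 a b c d \<noteq> (\<lambda>_. 0)"
    using omega q unfolding omega_net_def omega_regular_def by blast
  obtain a' b' c' d' where s: "a = a' *\<^sub>R sig i j" "b = b' *\<^sub>R sig j k" "c = c' *\<^sub>R sig k l"
    "d = d' *\<^sub>R sig l i"
    using meet_eq_sig w E by metis
  note ind = wedge4_independent[OF w(5)]
  have nz: "a' \<noteq> 0" "b' \<noteq> 0" "c' \<noteq> 0" "d' \<noteq> 0"
    using ind[of 1 0 0 0] ind[of 0 1 0 0] ind[of 0 0 1 0] ind[of 0 0 0 1] s by auto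
  have "(\<alpha> / a') *\<^sub>R a + (\<beta> / b') *\<^sub>R b + (\<gamma> / c') *\<^sub>R c + (\<delta> / d') *\<^sub>R d = 0"
    using assms(2) nz by (simp add: s)
  from ind[OF this] nz show ?thesis by simp
qed

lemma kap_adjacent_distinct:
  assumes q: "quad S i j k l" shows "kap i j \<noteq> kap l i"
proof
  assume "kap i j = kap l i"
  then have "sig i j = sig l i" using sig_eq(1)[OF quad_edges(4)[OF q]] by (simp add: sig_def)
  then show False using quad_independent[OF q, of 1 0 0 "-1"] by simp
qed

text \<open>Each point sphere is proportional to the difference of the two curvature spheres at its
  vertex, so coinciding opposite points would give a linear relation between all four.\<close>

lemma X_opposite_distinct:
  assumes q: "quad S i j k l" shows "X i \<noteq> X k"
proof
  assume X: "X i = X k"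
  note E = quad_edges[OF q]
  have i: "sig i j - sig l i = (kap i j - kap l i) *\<^sub>R X i"
    using sig_eq(1)[OF E(4)] by (simp add: sig_def algebra_simps)
  have k: "sig k l - sig j k = (kap k l - kap j k) *\<^sub>R X k"
    using sig_eq(1)[OF E(2)] by (simp add: sig_def algebra_simps)
  let ?a = "kap i j - kap l i" and ?b = "kap k l - kap j k"
  have "?b *\<^sub>R (sig i j - sig l i) = ?a *\<^sub>R (sig k l - sig j k)"
    by (simp add: i k X)
  then have "?b *\<^sub>R sig i j + ?a *\<^sub>R sig j k + (- ?a) *\<^sub>R sig k l + (- ?b) *\<^sub>R sig l i = 0"
    by (simp add: algebra_simps)
  from quad_independent[OF q this] show False using kap_adjacent_distinct[OF q] by simp
qed

text \<open>A vector orthogonal to three of the curvature spheres of a quadrilateral, but not to the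
  fourth: it detects the two vertices of the edge \<open>(k, l)\<close>.\<close>

lemma dual_vector:
  assumes q: "quad S i j k l"
  obtains z where "form42 (X i) z = 0" "form42 (N i) z = 0" "form42 (X j) z = 0"
    "form42 (N j) z = 0" "form42 (X k) z \<noteq> 0" "form42 (N k) z = - kap j k * form42 (X k) z"
    "form42 (X l) z \<noteq> 0" "form42 (N l) z = - kap l i * form42 (X l) z"
proof -
  note E = quad_edges[OF q]
  have "sig k l \<notin> span {sig i j, sig j k, sig l i}"
  proof
    assume "sig k l \<in> span {sig i j, sig j k, sig l i}"
    then obtain a b c where "sig k l = a *\<^sub>R sig i j + b *\<^sub>R sig j k + c *\<^sub>R sig l i"
      by (auto simp: span_insert span_singleton algebra_simps)
    then have "a *\<^sub>R sig i j + b *\<^sub>R sig j k + (- 1) *\<^sub>R sig k l + c *\<^sub>R sig l i = 0" by simp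
    from quad_independent[OF q this] show False by simp
  qed
  then obtain z where "\<forall>w\<in>span {sig i j, sig j k, sig l i}. form42 z w = 0" "form42 z (sig k l) \<noteq> 0"
    using form42_separates by blast
  then have z: "form42 (sig i j) z = 0" "form42 (sig j k) z = 0" "form42 (sig l i) z = 0"
    "form42 (sig k l) z \<noteq> 0"
    using span_base[of _ "{sig i j, sig j k, sig l i}"] form42_commute[of z] by auto
  have i: "kap i j * form42 (X i) z + form42 (N i) z = 0" "kap l i * form42 (X i) z + form42 (N i) z = 0"
    using z(1)[unfolded sig_def] z(3)[unfolded sig_eq(1)[OF E(4)]] by (simp_all add: form42_simps)
  have j: "kap i j * form42 (X j) z + form42 (N j) z = 0" "kap j k * form42 (X j) z + form42 (N j) z = 0"
    using z(2)[unfolded sig_def] z(1)[unfolded sig_eq(1)[OF E(1)]] by (simp_all add: form42_simps)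
  have k: "kap j k * form42 (X k) z + form42 (N k) z = 0" "kap k l * form42 (X k) z + form42 (N k) z \<noteq> 0"
    using z(4)[unfolded sig_def] z(2)[unfolded sig_eq(1)[OF E(2)]] by (simp_all add: form42_simps)
  have l: "kap l i * form42 (X l) z + form42 (N l) z = 0" "kap k l * form42 (X l) z + form42 (N l) z \<noteq> 0"
    using z(3)[unfolded sig_def] z(4)[unfolded sig_eq(1)[OF E(3)]] by (simp_all add: form42_simps)
  have "(kap i j - kap l i) * form42 (X i) z = 0" using i unfolding left_diff_distrib by linarith
  then have Xi: "form42 (X i) z = 0" using kap_adjacent_distinct[OF q] by simp
  have "(kap i j - kap j k) * form42 (X j) z = 0" using j unfolding left_diff_distrib by linarith
  then have Xj: "form42 (X j) z = 0" using kap_adjacent_distinct[OF quad_rotate[OF q]] by simp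
  show thesis
    by (rule that[of z]) (use i j k l Xi Xj in auto)
qed

text \<open>On an edge, the wedge product of sections \<open>N + a X\<close> differs from the 1-form
  \<open>\<rho> X \<and> X + N \<and> N\<close> by an exact term and the defect of the Moebius relation.\<close>

lemma edge_wedge:
  assumes e: "edge S i j"
  shows "wedge (N j + b *\<^sub>R X j) (N i + a *\<^sub>R X i) =
    (\<rho> *\<^sub>R wedge (X j) (X i) + wedge (N j) (N i)) + b *\<^sub>R wedge (X j) (N j) - a *\<^sub>R wedge (X i) (N i)
    + ((a - kap i j) * (b - kap i j) - (\<rho> + (kap i j)\<^sup>2)) *\<^sub>R wedge (X j) (X i)"
proof -
  have N: "N i = N j + kap i j *\<^sub>R X j - kap i j *\<^sub>R X i"
    using kap[OF e] by (simp add: algebra_simps)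
  show ?thesis
    by (rule bivector_eqI)
       (simp add: N form42_wedge form42_simps blinfun_left_simps algebra_simps power2_eq_square)
qed

text \<open>The curvature sphere is orthogonal to both null planes, so only the parts along \<open>X\<close> contribute.\<close>

lemma edge_products:
  assumes e: "edge S i j"
  shows "form42 (N i + a *\<^sub>R X i) (N j + b *\<^sub>R X j) = (a - kap i j) * (b - kap i j) * form42 (X i) (X j)"
proof -
  have N: "N i + a *\<^sub>R X i = sig i j + (a - kap i j) *\<^sub>R X i"
    "N j + b *\<^sub>R X j = sig i j + (b - kap i j) *\<^sub>R X j"
    using sig_eq(1)[OF e] by (simp_all add: sig_def algebra_simps)
  have s: "form42 (sig i j) (sig i j) = 0" "form42 (X i) (sig i j) = 0"
    using null edge_mem[OF e] by (simp_all add: sig_def form42_simps)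
  have s': "form42 (sig i j) (X j) = 0"
    using null edge_mem[OF e] by (simp add: sig_eq(1)[OF e] form42_simps)
  show ?thesis unfolding N by (simp add: form42_simps s s')
qed

text \<open>The 1-form of the Omega-structure associated to an edge-parallel net \<open>dy = \<rho> dx\<close>.\<close>

definition omega_form :: "(int ^ 'n \<Rightarrow> int ^ 'n \<Rightarrow> real) \<Rightarrow> int ^ 'n \<Rightarrow> int ^ 'n \<Rightarrow> bivector" where
  "omega_form \<rho> j i = \<rho> i j *\<^sub>R wedge (X j) (X i) + wedge (N j) (N i)"

text \<open>If the Moebius relation holds on three edges of a quadrilateral, then by closedness the
  wedge product of the diagonals is a multiple of \<open>X \<and> X\<close> on the fourth. The dual vector shows
  that the diagonals are parallel, so that the relation holds there too.\<close>

lemma moebius_flat: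
  assumes q: "quad S i j k l"
    and sum: "omega_form \<rho> i l + omega_form \<rho> l k + omega_form \<rho> k j + omega_form \<rho> j i = 0"
    and L: "\<rho> j k + (kap j k)\<^sup>2 \<noteq> 0" "\<rho> l i + (kap l i)\<^sup>2 \<noteq> 0"
    and sym: "\<And>a b. edge S a b \<Longrightarrow> \<rho> a b = \<rho> b a"
    and jk: "(y - kap j k) * (z - kap j k) = \<rho> j k + (kap j k)\<^sup>2"
    and kl: "(z - kap k l) * (w - kap k l) = \<rho> k l + (kap k l)\<^sup>2"
    and li: "(w - kap l i) * (x - kap l i) = \<rho> l i + (kap l i)\<^sup>2"
  shows "(x - kap i j) * (y - kap i j) = \<rho> i j + (kap i j)\<^sup>2"
    "wedge ((N k + z *\<^sub>R X k) - (N i + x *\<^sub>R X i)) ((N l + w *\<^sub>R X l) - (N j + y *\<^sub>R X j)) = 0"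
proof -
  note E = quad_edges[OF q]
  let ?gi = "N i + x *\<^sub>R X i" and ?gj = "N j + y *\<^sub>R X j"
    and ?gk = "N k + z *\<^sub>R X k" and ?gl = "N l + w *\<^sub>R X l"
  let ?\<delta> = "(x - kap i j) * (y - kap i j) - (\<rho> i j + (kap i j)\<^sup>2)"
  have w1: "wedge ?gj ?gi = omega_form \<rho> j i + y *\<^sub>R wedge (X j) (N j) - x *\<^sub>R wedge (X i) (N i)
      + ?\<delta> *\<^sub>R wedge (X j) (X i)"
    using edge_wedge[OF E(1), of y x "\<rho> i j"] by (simp add: omega_form_def)
  have w2: "wedge ?gk ?gj = omega_form \<rho> k j + z *\<^sub>R wedge (X k) (N k) - y *\<^sub>R wedge (X j) (N j)"
    using edge_wedge[OF E(2), of z y "\<rho> j k"] jk by (simp add: omega_form_def)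
  have w3: "wedge ?gl ?gk = omega_form \<rho> l k + w *\<^sub>R wedge (X l) (N l) - z *\<^sub>R wedge (X k) (N k)"
    using edge_wedge[OF E(3), of w z "\<rho> k l"] kl by (simp add: omega_form_def)
  have w4: "wedge ?gi ?gl = omega_form \<rho> i l + x *\<^sub>R wedge (X i) (N i) - w *\<^sub>R wedge (X l) (N l)"
    using edge_wedge[OF E(4), of x w "\<rho> l i"] li by (simp add: omega_form_def)
  have "wedge (?gk - ?gi) (?gl - ?gj) =
      - (wedge ?gi ?gl + wedge ?gl ?gk + wedge ?gk ?gj + wedge ?gj ?gi)"
    by (rule bivector_eqI) (simp only: form42_wedge form42_simps blinfun_left_simps, simp add: algebra_simps)
  also have "\<dots> = - (?\<delta> *\<^sub>R wedge (X j) (X i)) - (omega_form \<rho> i l + omega_form \<rho> l k + omega_form \<rho> k j + omega_form \<rho> j i)"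
    unfolding w1 w2 w3 w4 by simp
  finally have W: "wedge (?gk - ?gi) (?gl - ?gj) = - (?\<delta> *\<^sub>R wedge (X j) (X i))"
    using sum by simp
  obtain v where v: "form42 (X i) v = 0" "form42 (N i) v = 0" "form42 (X j) v = 0"
    "form42 (N j) v = 0" "form42 (X k) v \<noteq> 0" "form42 (N k) v = - kap j k * form42 (X k) v"
    "form42 (X l) v \<noteq> 0" "form42 (N l) v = - kap l i * form42 (X l) v"
    by (rule dual_vector[OF q])
  have gk: "form42 ?gk v = (z - kap j k) * form42 (X k) v"
    and gl: "form42 ?gl v = (w - kap l i) * form42 (X l) v"
    and gij: "form42 ?gi v = 0" "form42 ?gj v = 0"
    using v by (simp_all add: form42_simps algebra_simps)
  have gk0: "form42 ?gk v \<noteq> 0"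
    unfolding gk using jk L(1) v by auto
  have "blinfun_apply (wedge (?gk - ?gi) (?gl - ?gj)) v = 0"
    unfolding W using v by (simp add: blinfun_left_simps wedge_apply)
  then have "form42 ?gk v *\<^sub>R (?gl - ?gj) = form42 ?gl v *\<^sub>R (?gk - ?gi)"
    by (simp add: wedge_apply form42_diff_left gij)
  then have "form42 ?gk v *\<^sub>R wedge (?gk - ?gi) (?gl - ?gj) = 0"
    by (metis wedge_scale_right wedge_self scaleR_zero_right)
  then show par: "wedge (?gk - ?gi) (?gl - ?gj) = 0" using gk0 by simp
  then have "?\<delta> *\<^sub>R wedge (X j) (X i) = 0" using W by simp
  then show "(x - kap i j) * (y - kap i j) = \<rho> i j + (kap i j)\<^sup>2"
    using wedge_X_nonzero[OF E(1)] by simp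
qed

text \<open>Bivectors of the span of the four null planes are killed by every vector orthogonal to it,
  and one of these vectors is not orthogonal to \<open>\<qq>\<close>: otherwise \<open>\<qq>\<close> would lie in the span, whose part
  orthogonal to \<open>\<pp>\<close> and \<open>\<qq>\<close> is a plane, and its Euclidean projection a line through all differences
  of points.\<close>

lemma quad_kernel_vector:
  assumes q: "quad S i j k l" and nc: "\<not> collinear {\<pi> (X i), \<pi> (X j), \<pi> (X k), \<pi> (X l)}"
  obtains z where "form42 z \<qq> \<noteq> 0" "\<And>a. a \<in> {i, j, k, l} \<Longrightarrow> form42 (X a) z = 0 \<and> form42 (N a) z = 0"
proof -
  note E = quad_edges[OF q]
  have S: "i \<in> S" "j \<in> S" "k \<in> S" "l \<in> S" using edge_mem E by blast+
  let ?V = "span {X i, N i, X k, N k}"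
  have Vik: "X i \<in> ?V" "N i \<in> ?V" "X k \<in> ?V" "N k \<in> ?V" by (simp_all add: span_base)
  have mid: "X b \<in> ?V \<and> N b \<in> ?V"
    if e: "edge S a b" "edge S b c" and ne: "kap a b \<noteq> kap b c"
      and V: "X a \<in> ?V" "N a \<in> ?V" "X c \<in> ?V" "N c \<in> ?V" for a b c
  proof -
    have s: "sig a b \<in> ?V" "sig b c \<in> ?V"
      using V sig_eq(1)[OF e(2)] by (simp_all add: sig_def span_add span_scale)
    have "sig a b - sig b c = (kap a b - kap b c) *\<^sub>R X b"
      using sig_eq(1)[OF e(1)] by (simp add: sig_def algebra_simps)
    then have "X b = (1 / (kap a b - kap b c)) *\<^sub>R (sig a b - sig b c)" using ne by simp
    then have X: "X b \<in> ?V" using s span_diff span_scale by metis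
    have "N b = sig b c - kap b c *\<^sub>R X b" by (simp add: sig_def)
    then show ?thesis using X s span_diff span_scale by metis
  qed
  have j: "X j \<in> ?V \<and> N j \<in> ?V"
    by (rule mid[OF E(1,2)]) (use Vik kap_adjacent_distinct[OF quad_rotate[OF q]] in auto)
  have l: "X l \<in> ?V \<and> N l \<in> ?V"
    using mid[OF E(3,4)] Vik kap_adjacent_distinct[OF quad_rotate[OF quad_rotate[OF quad_rotate[OF q]]]]
    by metis
  have "\<qq> \<notin> ?V"
  proof
    assume "\<qq> \<in> ?V"
    have rep: "\<exists>c d. v = c *\<^sub>R (X k - X i) + d *\<^sub>R (N k - N i)"
      if v: "v \<in> ?V" "form42 v \<pp> = 0" "form42 v \<qq> = 0" for v
    proof -
      obtain a b c d where v': "v = a *\<^sub>R X i + b *\<^sub>R N i + c *\<^sub>R X k + d *\<^sub>R N k"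
        using v(1) by (auto simp: span_insert span_singleton algebra_simps)
      have "a = - c" "b = - d"
        using v(2,3) X_pp X_qq N_pp N_qq S by (simp_all add: v' form42_simps)
      then show ?thesis by (intro exI[of _ c] exI[of _ d]) (simp add: v' algebra_simps)
    qed
    obtain a b where ab: "\<qq> = a *\<^sub>R (X k - X i) + b *\<^sub>R (N k - N i)"
      using rep[OF \<open>\<qq> \<in> ?V\<close>] lie_frameD[OF frame] by blast
    let ?e = "\<pi> (X k - X i)" and ?e' = "\<pi> (N k - N i)"
    have rel: "a *\<^sub>R ?e + b *\<^sub>R ?e' = 0"
    proof -
      have "a *\<^sub>R ?e + b *\<^sub>R ?e' = \<pi> (a *\<^sub>R (X k - X i) + b *\<^sub>R (N k - N i))"
        by (simp only: frame_proj_linear)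
      then show ?thesis using frame_proj_qq[OF frame] ab by simp
    qed
    have "a \<noteq> 0 \<or> b \<noteq> 0" using ab lie_frameD(8)[OF frame] by (auto simp: form42_simps)
    then obtain u r s where u: "?e = r *\<^sub>R u" "?e' = s *\<^sub>R u"
    proof (cases "b = 0")
      case True
      then have "?e = 0 *\<^sub>R ?e'" using rel \<open>a \<noteq> 0 \<or> b \<noteq> 0\<close> by simp
      then show ?thesis using that[of 0 ?e' 1] by simp
    next
      case False
      have "b *\<^sub>R ?e' = - a *\<^sub>R ?e" using rel by (simp add: add_eq_0_iff2)
      then have "?e' = (1 / b) *\<^sub>R (- a *\<^sub>R ?e)" using False by (metis divideR_right inverse_eq_divide)
      then show ?thesis using that[of 1 ?e "- a / b"] by simp
    qed
    have on_line: "\<exists>c. \<pi> (X m) - \<pi> (X i) = c *\<^sub>R u" if "X m \<in> ?V" "m \<in> S" for m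
    proof -
      have "X m - X i \<in> ?V" using that Vik span_diff by blast
      moreover have "form42 (X m - X i) \<pp> = 0" "form42 (X m - X i) \<qq> = 0"
        using X_pp X_qq S(1) that(2) by (simp_all add: form42_simps)
      ultimately obtain c d where "X m - X i = c *\<^sub>R (X k - X i) + d *\<^sub>R (N k - N i)"
        using rep by blast
      then have "\<pi> (X m - X i) = (c * r + d * s) *\<^sub>R u"
        using u by (simp only: frame_proj_linear) (simp add: algebra_simps)
      then show ?thesis by (auto simp: frame_proj_linear)
    qed
    have "\<exists>c. v - \<pi> (X i) = c *\<^sub>R u" if "v \<in> {\<pi> (X i), \<pi> (X j), \<pi> (X k), \<pi> (X l)}" for v
      using that on_line[OF _ S(1)] on_line[OF _ S(2)] on_line[OF _ S(3)] on_line[OF _ S(4)] Vik j l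
      by auto
    then obtain c where c: "\<And>v. v \<in> {\<pi> (X i), \<pi> (X j), \<pi> (X k), \<pi> (X l)} \<Longrightarrow> v - \<pi> (X i) = c v *\<^sub>R u"
      by metis
    have "collinear {\<pi> (X i), \<pi> (X j), \<pi> (X k), \<pi> (X l)}"
      unfolding collinear_def
    proof (intro exI[of _ u] ballI)
      fix v w assume vw: "v \<in> {\<pi> (X i), \<pi> (X j), \<pi> (X k), \<pi> (X l)}"
        "w \<in> {\<pi> (X i), \<pi> (X j), \<pi> (X k), \<pi> (X l)}"
      have "v - w = (v - \<pi> (X i)) - (w - \<pi> (X i))" by simp
      also have "\<dots> = (c v - c w) *\<^sub>R u" using c[OF vw(1)] c[OF vw(2)] by (simp add: scaleR_diff_left)
      finally show "\<exists>c. v - w = c *\<^sub>R u" by blast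
    qed
    then show False using nc by blast
  qed
  then obtain z where z: "\<forall>w\<in>?V. form42 z w = 0" "form42 z \<qq> \<noteq> 0" using form42_separates by blast
  show thesis
    by (rule that[OF z(2)]) (use z(1) Vik j l form42_commute[of z] in auto)
qed

text \<open>The Guichard condition is the Euclidean part of the closing condition for \<open>omega_form\<close>; the
  remaining parts of the closing condition follow from it and the kernel vector.\<close>

lemma omega_form_closes:
  assumes q: "quad S i j k l" and nc: "\<not> collinear {\<pi> (X i), \<pi> (X j), \<pi> (X k), \<pi> (X l)}"
    and y: "y j - y i = \<rho> i j *\<^sub>R (\<pi> (X j) - \<pi> (X i))" "y k - y j = \<rho> j k *\<^sub>R (\<pi> (X k) - \<pi> (X j))"
      "y l - y k = \<rho> k l *\<^sub>R (\<pi> (X l) - \<pi> (X k))" "y i - y l = \<rho> l i *\<^sub>R (\<pi> (X i) - \<pi> (X l))"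
    and area: "form_wedge (df y) (df (\<lambda>a. \<pi> (X a))) l k j i
      + form_wedge (df (\<lambda>a. \<pi> (N a))) (df (\<lambda>a. \<pi> (N a))) l k j i = 0"
  shows "omega_form \<rho> i l + omega_form \<rho> l k + omega_form \<rho> k j + omega_form \<rho> j i = 0" (is "?B = 0")
proof -
  note E = quad_edges[OF q]
  have S: "i \<in> S" "j \<in> S" "k \<in> S" "l \<in> S" using edge_mem E by blast+
  obtain z where z: "form42 z \<qq> \<noteq> 0"
    "\<And>a. a \<in> {i, j, k, l} \<Longrightarrow> form42 (X a) z = 0 \<and> form42 (N a) z = 0"
    using quad_kernel_vector[OF q nc] by blast
  note fr = X_pp[OF S(1)] X_pp[OF S(2)] X_pp[OF S(3)] X_pp[OF S(4)]
    X_qq[OF S(1)] X_qq[OF S(2)] X_qq[OF S(3)] X_qq[OF S(4)]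
    N_pp[OF S(1)] N_pp[OF S(2)] N_pp[OF S(3)] N_pp[OF S(4)]
    N_qq[OF S(1)] N_qq[OF S(2)] N_qq[OF S(3)] N_qq[OF S(4)]
  show ?thesis
  proof (rule bivector_eq_0_frame[OF frame _ _ _ _ _ z(1)])
    show "form42 (blinfun_apply ?B u) v = - form42 (blinfun_apply ?B v) u" for u v
      by (simp add: omega_form_def blinfun_left_simps form42_simps form42_wedge algebra_simps)
    show "blinfun_apply ?B \<pp> = 0"
      by (simp add: omega_form_def blinfun_left_simps wedge_apply fr)
    show "blinfun_apply ?B z = 0"
      using z(2)[of i] z(2)[of j] z(2)[of k] z(2)[of l]
      by (simp add: omega_form_def blinfun_left_simps wedge_apply)
    show "form42 (blinfun_apply ?B (\<pi> u)) (\<pi> v) = 0" for u v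
    proof -
      have "form42 (blinfun_apply ?B (\<pi> u)) (\<pi> v) = form42 (blinfun_apply
        ((\<rho> l i *\<^sub>R wedge (\<pi> (X i)) (\<pi> (X l)) + wedge (\<pi> (N i)) (\<pi> (N l)))
        + (\<rho> k l *\<^sub>R wedge (\<pi> (X l)) (\<pi> (X k)) + wedge (\<pi> (N l)) (\<pi> (N k)))
        + (\<rho> j k *\<^sub>R wedge (\<pi> (X k)) (\<pi> (X j)) + wedge (\<pi> (N k)) (\<pi> (N j)))
        + (\<rho> i j *\<^sub>R wedge (\<pi> (X j)) (\<pi> (X i)) + wedge (\<pi> (N j)) (\<pi> (N i)))) u) v"
        by (simp add: omega_form_def blinfun_left_simps form42_simps wedge_frame_proj)
      also have "\<dots> = 0"
        using area closure_mixed_area[where x = "\<lambda>a. \<pi> (X a)" and n = "\<lambda>a. \<pi> (N a)", OF y]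
        by (simp add: blinfun_left_simps form42_simps)
      finally show ?thesis .
    qed
    show "form42 (blinfun_apply ?B \<qq>) (\<pi> u) = 0" for u
    proof -
      have "blinfun_apply ?B \<qq> = \<rho> l i *\<^sub>R (X i - X l) + \<rho> k l *\<^sub>R (X l - X k)
          + \<rho> j k *\<^sub>R (X k - X j) + \<rho> i j *\<^sub>R (X j - X i)"
        by (simp add: omega_form_def blinfun_left_simps wedge_apply fr algebra_simps)
      then have "\<pi> (blinfun_apply ?B \<qq>) = (y i - y l) + (y l - y k) + (y k - y j) + (y j - y i)"
        unfolding y by (simp only: frame_proj_linear)
      then have "\<pi> (blinfun_apply ?B \<qq>) = 0" by simp
      then show ?thesis using frame_proj_adjoint[of \<pp> \<oo> \<qq> "blinfun_apply ?B \<qq>" u]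
        by (simp add: form42_simps)
    qed
  qed
qed

end

section \<open>From Guichard nets to conserved quantities\<close>

text \<open>The edge equation of a principal net is the Euclidean part of the statement that the two null
  planes share a sphere.\<close>

lemma lift_framed:
  assumes omega: "omega_net S f" and frame: "lie_frame \<pp> \<oo> \<qq>"
    and pn: "principal_net S \<pp> \<oo> \<qq> x n" and lift: "lifts S \<pp> \<oo> \<qq> f x n"
    and X: "X = (\<lambda>i. \<oo> + x i + (form42 (x i) (x i) / 2) *\<^sub>R \<qq>)"
    and N: "N = (\<lambda>i. n i + \<pp> + form42 (x i) (n i) *\<^sub>R \<qq>)"
  shows "framed_net S f \<pp> \<oo> \<qq> X N"
    and "\<And>i. i \<in> S \<Longrightarrow> frame_proj \<pp> \<oo> \<qq> (X i) = x i \<and> frame_proj \<pp> \<oo> \<qq> (N i) = n i"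
    and "\<And>i j \<kappa>. edge S i j \<Longrightarrow> \<kappa> \<noteq> 0 \<Longrightarrow> \<kappa> *\<^sub>R x i + n i = \<kappa> *\<^sub>R x j + n j \<Longrightarrow>
      \<kappa> *\<^sub>R X i + N i = \<kappa> *\<^sub>R X j + N j"
proof -
  note fr = lie_frameD[OF frame]
  have E: "x i \<in> perp {\<pp>, \<oo>, \<qq>}" "n i \<in> perp {\<pp>, \<oo>, \<qq>}" "form42 (n i) (n i) = 1" if "i \<in> S" for i
    using pn that by (auto simp: principal_net_def)
  have o: "form42 (x i) \<pp> = 0" "form42 (x i) \<qq> = 0" "form42 (x i) \<oo> = 0"
    "form42 (n i) \<pp> = 0" "form42 (n i) \<qq> = 0" "form42 (n i) \<oo> = 0" if "i \<in> S" for i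
    using E(1,2)[OF that] by (simp_all add: perp_def form42_commute[of _ \<pp>] form42_commute[of _ \<oo>]
        form42_commute[of _ \<qq>])
  show proj: "frame_proj \<pp> \<oo> \<qq> (X i) = x i \<and> frame_proj \<pp> \<oo> \<qq> (N i) = n i" if "i \<in> S" for i
    using o[OF that] fr by (simp add: X N frame_proj_def form42_simps)
  show sphere: "\<kappa> *\<^sub>R X i + N i = \<kappa> *\<^sub>R X j + N j"
    if e: "edge S i j" and k: "\<kappa> \<noteq> 0" and eq: "\<kappa> *\<^sub>R x i + n i = \<kappa> *\<^sub>R x j + n j" for i j \<kappa>
  proof -
    \<comment> \<open>the coefficient of \<open>\<qq>\<close> is determined by the squared length of the Euclidean part\<close>
    have h: "\<kappa> * (form42 (x a) (x a) / 2) + form42 (x a) (n a)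
        = (form42 (\<kappa> *\<^sub>R x a + n a) (\<kappa> *\<^sub>R x a + n a) - 1) / (2 * \<kappa>)" if "a \<in> S" for a
      using E(3)[OF that] k form42_commute[of "n a" "x a"]
      by (simp add: form42_simps field_simps)
    have rep: "\<kappa> *\<^sub>R X a + N a = \<kappa> *\<^sub>R \<oo> + \<pp> + (\<kappa> *\<^sub>R x a + n a)
        + (\<kappa> * (form42 (x a) (x a) / 2) + form42 (x a) (n a)) *\<^sub>R \<qq>" for a
      by (simp add: X N algebra_simps)
    show ?thesis unfolding rep using h[OF edge_mem(1)[OF e]] h[OF edge_mem(2)[OF e]] eq by simp
  qed
  show "framed_net S f \<pp> \<oo> \<qq> X N"
  proof
    show "f i = span {X i, N i}" if "i \<in> S" for i using lift that by (simp add: lifts_def X N)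
    show "\<exists>\<kappa>. \<kappa> *\<^sub>R X i + N i = \<kappa> *\<^sub>R X j + N j" if "edge S i j" for i j
      using pn sphere[OF that] that unfolding principal_net_def by blast
  qed (use omega frame o fr in \<open>simp_all add: X N form42_simps\<close>)
qed

text \<open>Pairing the relation \<open>gk - gi = m (gl - gj)\<close> with \<open>gj\<close> expresses the difference of two adjacent
  inverse labels as a multiple of \<open>(gj, gl)\<close>.\<close>

lemma diagonal_nonorthogonal:
  assumes null: "form42 gj gj = 0" and par: "wedge (gk - gi) (gl - gj) = 0"
    and "form42 gj gk \<noteq> form42 gi gj" "form42 gl gi \<noteq> form42 gi gj"
  shows "form42 gj gl \<noteq> 0"
proof -
  have "gl - gj \<noteq> 0" using assms(4) form42_commute by auto
  then obtain m where "gk - gi = m *\<^sub>R (gl - gj)" using wedge_eq_0[OF par] by blast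
  then have "form42 gj (gk - gi) = m * (form42 gj gl - form42 gj gj)" by (simp add: form42_simps)
  then show ?thesis using assms form42_commute[of gi gj] by (auto simp: form42_simps)
qed

context framed_net
begin

text \<open>On a quadrilateral standing on an edge the diagonals involve \<open>X i\<close> and \<open>X j\<close> only, and the two
  products in the Moebius relations cancel.\<close>

lemma edge_diagonals_parallel:
  assumes e: "edge S i j"
    and "(a - kap i j) * (b - kap i j) = L" "(c - kap i j) * (d - kap i j) = L"
  shows "wedge ((N j + d *\<^sub>R X j) - (N i + a *\<^sub>R X i)) ((N i + c *\<^sub>R X i) - (N j + b *\<^sub>R X j)) = 0"
proof -
  have N: "N i = N j + kap i j *\<^sub>R X j - kap i j *\<^sub>R X i"
    using kap[OF e] by (metis add.commute add_diff_cancel_right')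
  have diff: "(N j + d *\<^sub>R X j) - (N i + a *\<^sub>R X i) = (d - kap i j) *\<^sub>R X j - (a - kap i j) *\<^sub>R X i"
    "(N i + c *\<^sub>R X i) - (N j + b *\<^sub>R X j) = (c - kap i j) *\<^sub>R X i - (b - kap i j) *\<^sub>R X j"
    by (simp_all add: N algebra_simps)
  have "wedge ((N j + d *\<^sub>R X j) - (N i + a *\<^sub>R X i)) ((N i + c *\<^sub>R X i) - (N j + b *\<^sub>R X j))
    = ((c - kap i j) * (d - kap i j) - (a - kap i j) * (b - kap i j)) *\<^sub>R wedge (X j) (X i)"
    unfolding diff using wedge_anticommute[of "X i" "X j"] by (simp add: wedge_simps algebra_simps)
  then show ?thesis using assms by simp
qed

text \<open>Two solutions of the Moebius relation that differ everywhere give the two spanning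
  isothermic nets. Their union is a Koenigs net on the doubled domain.\<close>

lemma special_omega_from_solutions:
  assumes ne: "S \<noteq> {}"
    and sol: "\<And>i j. edge S i j \<Longrightarrow> (\<alpha> i - kap i j) * (\<alpha> j - kap i j) = L i j"
      "\<And>i j. edge S i j \<Longrightarrow> (\<beta> i - kap i j) * (\<beta> j - kap i j) = L i j"
    and L: "\<And>i j. edge S i j \<Longrightarrow> L i j \<noteq> 0" and dist: "\<And>i. i \<in> S \<Longrightarrow> \<alpha> i \<noteq> \<beta> i"
    and par: "\<And>h i j k l. (\<And>i j. edge S i j \<Longrightarrow> (h i - kap i j) * (h j - kap i j) = L i j) \<Longrightarrow>
      quad S i j k l \<Longrightarrow>
      wedge ((N k + h k *\<^sub>R X k) - (N i + h i *\<^sub>R X i)) ((N l + h l *\<^sub>R X l) - (N j + h j *\<^sub>R X j)) = 0"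
    and labels: "\<And>i j k l. quad S i j k l \<Longrightarrow>
      L i j * form42 (X i) (X j) \<noteq> L j k * form42 (X j) (X k)"
  shows "\<exists>g. special_omega_with S f 1 (\<lambda>n z. if n = 0 then \<pp> else g z) \<and>
    (\<forall>z\<in>doubled S. form42 (g z) (g z) = 0 \<and> form42 \<pp> (g z) = -1)"
proof -
  define g where "g h i = N i + h i *\<^sub>R X i" for h :: "int ^ 'n \<Rightarrow> real" and i
  have norm: "form42 (g h i) (g h i) = 0" "form42 \<pp> (g h i) = -1" if "i \<in> S" for h i
    using null[OF that] N_pp[OF that] X_pp[OF that] form42_commute[of \<pp>]
    by (simp_all add: g_def form42_simps)
  have XX: "X i \<noteq> 0" if "i \<in> S" for i using X_qq[OF that] by (auto simp: form42_simps)
  have cross: "form42 (g h i) (g h' j) \<noteq> 0"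
    if e: "edge S i j" and h: "h \<in> {\<alpha>, \<beta>}" "h' \<in> {\<alpha>, \<beta>}" for h h' i j
  proof -
    have "h i \<noteq> kap i j" "h' j \<noteq> kap i j" using sol[OF e] L[OF e] h by auto
    then show ?thesis using X_nonorth[OF e] by (simp add: g_def edge_products[OF e])
  qed
  have diag: "form42 (g h j) (g h l) \<noteq> 0" if q: "quad S i j k l" and h: "h \<in> {\<alpha>, \<beta>}" for h i j k l
  proof -
    note E = quad_edges[OF q]
    have r: "form42 (g h a) (g h b) = L a b * form42 (X a) (X b)" if e: "edge S a b" for a b
      using sol[OF e] h by (auto simp: g_def edge_products[OF e])
    have "wedge (g h k - g h i) (g h l - g h j) = 0"
      unfolding g_def by (rule par[OF _ q]) (use sol h in auto)
    then show ?thesis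
      by (rule diagonal_nonorthogonal[OF norm(1)[OF edge_mem(2)[OF E(1)]]])
         (use labels[OF q] labels[OF quad_rotate[OF quad_rotate[OF quad_rotate[OF q]]]] r E in auto)
  qed
  have koenigs: "null_koenigs S \<pp> (g h)" if h: "h \<in> {\<alpha>, \<beta>}" for h
    unfolding null_koenigs_def
  proof (intro conjI allI impI ballI)
    show "g h i \<noteq> g h j" if e: "edge S i j" for i j
      using cross[OF e h h] norm(1)[OF edge_mem(2)[OF e]] by auto
    show "wedge (g h k - g h i) (g h l - g h j) = 0" if q: "quad S i j k l" for i j k l
      unfolding g_def by (rule par[OF _ q]) (use sol h in auto)
  qed (use norm diag h in auto)
  define lev where "lev e = (if e = 0 then \<alpha> else \<beta>)" for e :: int
  define G where "G = join (g \<alpha>) (g \<beta>)"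
  have G: "G z = g (lev (z $ None)) (base_pt z)" for z by (simp add: G_def join_def lev_def)
  have lev: "lev e \<in> {\<alpha>, \<beta>}" for e by (simp add: lev_def)
  have lsol: "(lev e i - kap i j) * (lev e j - kap i j) = L i j" if "edge S i j" for e i j
    using sol that by (simp add: lev_def)
  have D: "base_pt z \<in> S" if "z \<in> doubled S" for z using that by (simp add: doubled_def)
  have doubled: "null_koenigs (doubled S) \<pp> G"
    unfolding null_koenigs_def
  proof (intro conjI allI impI ballI)
    show "G z \<noteq> G w" if e: "edge (doubled S) z w" for z w
      using doubled_edge_cases[OF e]
    proof (elim disjE conjE)
      assume *: "z $ None = w $ None" "edge S (base_pt z) (base_pt w)"
      then show ?thesis
        using koenigs[OF lev] by (auto simp: G null_koenigs_def)
    next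
      assume *: "base_pt z = base_pt w" "z $ None \<noteq> w $ None" "base_pt z \<in> S"
      have "z $ None \<in> {0, 1}" "w $ None \<in> {0, 1}"
        using edge_mem[OF e] by (simp_all add: doubled_def)
      then have "lev (z $ None) (base_pt z) \<noteq> lev (w $ None) (base_pt z)"
        using * dist[OF *(3)] by (auto simp: lev_def)
      then show ?thesis using * XX[OF *(3)] by (simp add: G g_def)
    qed
    fix z1 z2 z3 z4 assume q: "quad (doubled S) z1 z2 z3 z4"
    have "wedge (G z3 - G z1) (G z4 - G z2) = 0 \<and> form42 (G z2) (G z4) \<noteq> 0"
    proof (rule doubled_quad_cases[OF q])
      assume "quad S (base_pt z1) (base_pt z2) (base_pt z3) (base_pt z4)"
        "z2 $ None = z1 $ None" "z3 $ None = z1 $ None" "z4 $ None = z1 $ None"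
      then show ?thesis using koenigs[OF lev] by (auto simp: G null_koenigs_def)
    next
      assume *: "base_pt z2 = base_pt z1" "base_pt z3 = base_pt z4" "edge S (base_pt z1) (base_pt z4)"
        "z4 $ None = z1 $ None" "z3 $ None = z2 $ None" "z2 $ None \<noteq> z1 $ None"
      let ?i = "base_pt z1" and ?j = "base_pt z4"
      have "wedge (g (lev (z2 $ None)) ?j - g (lev (z1 $ None)) ?i)
          (g (lev (z2 $ None)) ?i - g (lev (z1 $ None)) ?j) = 0"
        unfolding g_def by (rule edge_diagonals_parallel[OF *(3) lsol[OF *(3)] lsol[OF *(3)]])
      then have "wedge (G z3 - G z1) (- (G z4 - G z2)) = 0" using * by (simp add: G)
      then show ?thesis using cross[OF *(3) lev lev] * by (simp add: G wedge_minus_right del: minus_diff_eq)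
    next
      assume *: "base_pt z4 = base_pt z1" "base_pt z3 = base_pt z2" "edge S (base_pt z1) (base_pt z2)"
        "z2 $ None = z1 $ None" "z3 $ None = z4 $ None" "z4 $ None \<noteq> z1 $ None"
      let ?i = "base_pt z1" and ?j = "base_pt z2"
      have "wedge (g (lev (z4 $ None)) ?j - g (lev (z1 $ None)) ?i)
          (g (lev (z4 $ None)) ?i - g (lev (z1 $ None)) ?j) = 0"
        unfolding g_def by (rule edge_diagonals_parallel[OF *(3) lsol[OF *(3)] lsol[OF *(3)]])
      then show ?thesis using cross[OF edge_sym[OF *(3)] lev lev] * by (simp add: G)
    qed
    then show "wedge (G z3 - G z1) (G z4 - G z2) = 0" "form42 (G z2) (G z4) \<noteq> 0" by blast+
  qed (use norm D in \<open>auto simp: G\<close>)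
  have joined: "join (\<lambda>i. span {g \<alpha> i}) (\<lambda>i. span {g \<beta> i}) = (\<lambda>z. span {G z})"
    by (auto simp: fun_eq_iff join_def G_def)
  have spans: "f i = span (span {g \<alpha> i} \<union> span {g \<beta> i})" "span {g \<alpha> i} \<inter> span {g \<beta> i} = {0}"
    if i: "i \<in> S" for i
  proof -
    let ?V = "span (span {g \<alpha> i} \<union> span {g \<beta> i})"
    have gV: "g \<alpha> i \<in> ?V" "g \<beta> i \<in> ?V" by (simp_all add: span_base)
    have "X i = (1 / (\<alpha> i - \<beta> i)) *\<^sub>R (g \<alpha> i - g \<beta> i)"
      using dist[OF i] by (simp add: g_def flip: scaleR_diff_left)
    then have XV: "X i \<in> ?V" using gV span_diff span_scale by metis
    moreover have "N i = g \<alpha> i - \<alpha> i *\<^sub>R X i" by (simp add: g_def)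
    then have "N i \<in> ?V" using gV XV span_diff span_scale by metis
    ultimately have 1: "f i \<subseteq> ?V" by (simp add: plane[OF i] span_minimal)
    have "g h i \<in> f i" for h
      by (simp add: plane[OF i] g_def span_add span_scale span_base)
    then have "span {g \<alpha> i} \<subseteq> f i" "span {g \<beta> i} \<subseteq> f i"
      by (simp_all add: plane[OF i] span_minimal)
    then have "?V \<subseteq> f i" by (simp add: plane[OF i] span_minimal)
    then show "f i = ?V" using 1 by blast
    have "v = 0" if v: "v \<in> span {g \<alpha> i}" "v \<in> span {g \<beta> i}" for v
    proof -
      obtain r where r: "v = r *\<^sub>R g \<alpha> i" using v(1) by (auto simp: span_singleton)
      obtain s where s: "v = s *\<^sub>R g \<beta> i" using v(2) by (auto simp: span_singleton)
      note rs = r s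
      have "form42 \<pp> (r *\<^sub>R g \<alpha> i) = form42 \<pp> (s *\<^sub>R g \<beta> i)" using rs by simp
      then have "r = s" using norm(2)[OF i] by (simp add: form42_simps)
      then have "r *\<^sub>R (g \<alpha> i - g \<beta> i) = 0" using rs by auto
      then have "(r * (\<alpha> i - \<beta> i)) *\<^sub>R X i = 0" by (simp add: g_def algebra_simps)
      then show ?thesis using rs dist[OF i] XX[OF i] by simp
    qed
    then show "span {g \<alpha> i} \<inter> span {g \<beta> i} = {0}" by (auto simp: span_zero)
  qed
  have "doubled S \<noteq> {}" using ne level_pt_doubled[of 0 _ S] by fastforce
  then have "conserved_quantity (doubled S) (\<lambda>z. span {G z}) (\<lambda>j i. wedge (G j) (G i)) 1
      (\<lambda>n z. if n = 0 then \<pp> else G z)"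
    by (rule null_koenigs_conserved[OF doubled])
  moreover have "isothermic S (\<lambda>i. span {g \<alpha> i})" "isothermic S (\<lambda>i. span {g \<beta> i})"
    unfolding isothermic_def
    using null_koenigs_isothermic[OF koenigs[of \<alpha>]] null_koenigs_isothermic[OF koenigs[of \<beta>]]
    by blast+
  ultimately have "special_omega_with S f 1 (\<lambda>n z. if n = 0 then \<pp> else G z)"
    unfolding special_omega_with_def
    using null_koenigs_isothermic[OF doubled] spans
    by (intro exI[of _ "\<lambda>i. span {g \<alpha> i}"] exI[of _ "\<lambda>i. span {g \<beta> i}"]
        exI[of _ "\<lambda>j i. wedge (G j) (G i)"] conjI ballI) (simp_all only: joined)
  then show ?thesis using doubled by (intro exI[of _ G]) (simp add: null_koenigs_def)
qed

end

text \<open>The inverse labels of the Koenigs nets are, up to the factor \<open>-1/2\<close>, the numbers \<open>(dy, dx) + (dn, dn)\<close>, so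
  the two non-degeneracy conditions say that the Moebius relation is invertible and that
  adjacent labels differ. All but countably many initial values yield a solution of the relation, which
  leaves room for two of them.\<close>

theorem guichard_imp_special_omega:
  fixes S :: "(int ^ 'n) set"
  assumes sc: "simply_connected_domain S" and omega: "omega_net S f" and G: "lifts_guichard S f"
  shows "\<exists>p c. c \<noteq> 0 \<and> special_omega_with S f 1 p \<and>
       (\<forall>z\<in>doubled S. \<forall>t. form42 (poly_section 1 p t z) (poly_section 1 p t z) = - 1 - 2 * c * t) \<and>
       (\<forall>z\<in>doubled S. edges_generic S f (p 0 z))"
proof -
  obtain \<pp> \<oo> \<qq> x n y where frame: "lie_frame \<pp> \<oo> \<qq>" and gen: "generic S f \<pp> \<qq>"
    and pn: "principal_net S \<pp> \<oo> \<qq> x n" and lift: "lifts S \<pp> \<oo> \<qq> f x n"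
    and ga: "guichard_associate S \<pp> \<oo> \<qq> x n y"
    and nd: "edge_nondegenerate S x n y" "quad_nondegenerate S x n y"
    using G by (auto simp: lifts_guichard_def)
  define X where "X = (\<lambda>i. \<oo> + x i + (form42 (x i) (x i) / 2) *\<^sub>R \<qq>)"
  define N where "N = (\<lambda>i. n i + \<pp> + form42 (x i) (n i) *\<^sub>R \<qq>)"
  note lf = lift_framed[OF omega frame pn lift X_def N_def]
  interpret framed_net S f \<pp> \<oo> \<qq> X N by (rule lf(1))
  have proj: "\<pi> (X i) = x i" "\<pi> (N i) = n i" if "i \<in> S" for i using lf(2)[OF that] by auto
  obtain b where b: "b \<in> S" using sc by (auto simp: simply_connected_domain_def)
  have dx: "x i \<noteq> x j" if e: "edge S i j" for i j
    using X_distinct[OF e] by (auto simp: X_def)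
  have kapx: "kap i j \<noteq> 0" "kap i j *\<^sub>R x i + n i = kap i j *\<^sub>R x j + n j" if e: "edge S i j" for i j
  proof -
    obtain \<kappa> where k: "\<kappa> \<noteq> 0" "\<kappa> *\<^sub>R x i + n i = \<kappa> *\<^sub>R x j + n j"
      using pn e unfolding principal_net_def by blast
    then have "\<kappa> = kap i j" using kap_unique[OF e lf(3)[OF e k]] by simp
    then show "kap i j \<noteq> 0" "kap i j *\<^sub>R x i + n i = kap i j *\<^sub>R x j + n j" using k by auto
  qed
  define \<rho> where "\<rho> i j = (SOME r. df y i j = r *\<^sub>R df x i j)" for i j
  have \<rho>: "df y i j = \<rho> i j *\<^sub>R df x i j" if e: "edge S i j" for i j
    unfolding \<rho>_def by (rule someI_ex) (use ga e in \<open>auto simp: guichard_associate_def\<close>)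
  have \<rho>_sym: "\<rho> i j = \<rho> j i" if e: "edge S i j" for i j
  proof -
    have "\<rho> i j *\<^sub>R df x i j = - df y j i" using \<rho>[OF e] by (simp add: df_def)
    also have "\<dots> = \<rho> j i *\<^sub>R df x i j"
      unfolding \<rho>[OF edge_sym[OF e]] by (simp add: df_def algebra_simps)
    finally have "\<rho> i j *\<^sub>R df x i j = \<rho> j i *\<^sub>R df x i j" .
    then show ?thesis using dx[OF e] by (simp add: df_def)
  qed
  have dy: "y j - y i = \<rho> i j *\<^sub>R (x j - x i)" if e: "edge S i j" for i j
    using \<rho>[OF edge_sym[OF e]] \<rho>_sym[OF e] by (simp add: df_def)
  have dn: "n j - n i = - kap i j *\<^sub>R (x j - x i)" if e: "edge S i j" for i j
  proof -
    have "n j - n i = (kap i j *\<^sub>R x j + n j) - (kap i j *\<^sub>R x i + n i) - kap i j *\<^sub>R (x j - x i)"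
      by (simp add: algebra_simps)
    then show ?thesis using kapx(2)[OF e] by simp
  qed
  define L where "L i j = \<rho> i j + (kap i j)\<^sup>2" for i j
  have L0: "L i j \<noteq> 0" if e: "edge S i j" for i j
  proof
    assume "L i j = 0"
    then have "\<rho> i j = - (kap i j * kap i j)" by (simp add: L_def power2_eq_square)
    then have "df y j i = kap i j *\<^sub>R df n j i" using dy[OF e] dn[OF e] by (simp add: df_def)
    then show False using nd(1) e kapx[OF e] unfolding edge_nondegenerate_def by blast
  qed
  have omega_form0: "omega_form \<rho> i l + omega_form \<rho> l k + omega_form \<rho> k j + omega_form \<rho> j i = 0" if q: "quad S i j k l" for i j k l
  proof -
    note E = quad_edges[OF q]
    have S: "i \<in> S" "j \<in> S" "k \<in> S" "l \<in> S" using edge_mem E by blast+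
    show ?thesis
    proof (rule omega_form_closes[OF q, where y = y])
      show "\<not> collinear {\<pi> (X i), \<pi> (X j), \<pi> (X k), \<pi> (X l)}"
        using nd(2) q S unfolding quad_nondegenerate_def by (simp add: proj)
      show "form_wedge (df y) (df (\<lambda>a. \<pi> (X a))) l k j i
        + form_wedge (df (\<lambda>a. \<pi> (N a))) (df (\<lambda>a. \<pi> (N a))) l k j i = 0"
        using ga q S unfolding guichard_associate_def by (simp add: proj form_wedge_def df_def)
    qed (use dy E S in \<open>simp_all add: proj\<close>)
  qed
  have flat: "(x' - kap i j) * (y' - kap i j) = L i j"
    "wedge ((N k + z' *\<^sub>R X k) - (N i + x' *\<^sub>R X i)) ((N l + w' *\<^sub>R X l) - (N j + y' *\<^sub>R X j)) = 0"
    if "quad S i j k l" "(y' - kap j k) * (z' - kap j k) = L j k" "(z' - kap k l) * (w' - kap k l) = L k l"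
      "(w' - kap l i) * (x' - kap l i) = L l i" for i j k l x' y' z' w'
    using moebius_flat[OF that(1) omega_form0[OF that(1)] _ _ \<rho>_sym that(2-4)[unfolded L_def]]
      L0[OF quad_edges(2)[OF that(1)]] L0[OF quad_edges(4)[OF that(1)]]
    by (simp_all add: L_def)
  have L_sym: "L i j = L j i" if "edge S i j" for i j
    using kap_sym[OF that] \<rho>_sym[OF that] by (simp add: L_def)
  have "\<exists>C. countable C \<and> (\<forall>x0. x0 \<notin> C \<longrightarrow>
    (\<exists>h. h b = x0 \<and> (\<forall>i j. edge S i j \<longrightarrow> (h i - kap i j) * (h j - kap i j) = L i j)))"
    by (rule moebius_transport[OF sc b]; (rule kap_sym L_sym L0 flat(1))?) assumption+
  then obtain C where C: "countable C"
    "\<And>x0. x0 \<notin> C \<Longrightarrow> \<exists>h. h b = x0 \<and> (\<forall>i j. edge S i j \<longrightarrow> (h i - kap i j) * (h j - kap i j) = L i j)"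
    by (elim exE conjE) (rule that, assumption, simp)
  obtain a0 where a0: "a0 \<notin> C" using C(1) uncountable_UNIV_real by (metis UNIV_eq_I)
  have "countable (insert a0 C)" using C(1) by simp
  then obtain b0 where b0: "b0 \<notin> insert a0 C" using uncountable_UNIV_real by (metis UNIV_eq_I)
  obtain \<alpha> where \<alpha>: "\<alpha> b = a0" "\<And>i j. edge S i j \<Longrightarrow> (\<alpha> i - kap i j) * (\<alpha> j - kap i j) = L i j"
    using C(2)[OF a0] by blast
  obtain \<beta> where \<beta>: "\<beta> b = b0" "\<And>i j. edge S i j \<Longrightarrow> (\<beta> i - kap i j) * (\<beta> j - kap i j) = L i j"
    using C(2)[of b0] b0 by blast
  have dist: "\<alpha> i \<noteq> \<beta> i" if "i \<in> S" for i
  proof (rule simply_connected_induct[OF sc b that])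
    show "\<alpha> b \<noteq> \<beta> b" using \<alpha> \<beta> b0 by simp
    show "\<alpha> j \<noteq> \<beta> j" if e: "edge S i j" and ne: "\<alpha> i \<noteq> \<beta> i" for i j
    proof
      assume eq: "\<alpha> j = \<beta> j"
      have "\<alpha> j - kap i j \<noteq> 0" using \<alpha>(2)[OF e] L0[OF e] by auto
      moreover have "(\<alpha> i - kap i j) * (\<alpha> j - kap i j) = (\<beta> i - kap i j) * (\<alpha> j - kap i j)"
        using \<alpha>(2)[OF e] \<beta>(2)[OF e] eq by simp
      ultimately show False using ne by simp
    qed
  qed
  have label: "form42 (df y j i) (df x j i) + form42 (df n j i) (df n j i) = - 2 * (L i j * form42 (X i) (X j))"
    if e: "edge S i j" for i j
  proof -
    have XX: "form42 (X i) (X j) = - (form42 (x j - x i) (x j - x i)) / 2"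
    proof -
      have "form42 (x a) \<oo> = 0 \<and> form42 (x a) \<qq> = 0 \<and> form42 \<oo> (x a) = 0 \<and> form42 \<qq> (x a) = 0"
        if "a \<in> S" for a
        using frame_proj_perp[OF frame, of "X a"] proj(1)[OF that]
        by (simp add: perp_def form42_commute[of "x a" \<oo>] form42_commute[of "x a" \<qq>])
      then show ?thesis
        using edge_mem[OF e] lie_frameD[OF frame] form42_commute[of "x j" "x i"]
        by (simp add: X_def form42_simps field_simps)
    qed
    have "form42 (\<rho> i j *\<^sub>R d) d + form42 (- kap i j *\<^sub>R d) (- kap i j *\<^sub>R d)
        = - 2 * (L i j * (- form42 d d / 2))" for d
      by (simp add: form42_simps L_def power2_eq_square algebra_simps)
    then show ?thesis unfolding XX df_def dy[OF e] dn[OF e] by simp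
  qed
  have labels: "L i j * form42 (X i) (X j) \<noteq> L j k * form42 (X j) (X k)" if q: "quad S i j k l" for i j k l
  proof -
    have "form42 (df y j i) (df x j i) + form42 (df n j i) (df n j i) \<noteq>
      form42 (df y k j) (df x k j) + form42 (df n k j) (df n k j)"
      using nd(2) q unfolding quad_nondegenerate_def by blast
    then show ?thesis
      using label[OF quad_edges(1)[OF q]] label[OF quad_edges(2)[OF q]] by auto
  qed
  have "\<exists>g. special_omega_with S f 1 (\<lambda>n z. if n = 0 then \<pp> else g z) \<and>
    (\<forall>z\<in>doubled S. form42 (g z) (g z) = 0 \<and> form42 \<pp> (g z) = -1)"
  proof (rule special_omega_from_solutions[of \<alpha> L \<beta>])
    show "S \<noteq> {}" using b by blast
    show "wedge ((N k + h k *\<^sub>R X k) - (N i + h i *\<^sub>R X i)) ((N l + h l *\<^sub>R X l) - (N j + h j *\<^sub>R X j)) = 0"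
      if h: "\<And>i j. edge S i j \<Longrightarrow> (h i - kap i j) * (h j - kap i j) = L i j" and q: "quad S i j k l"
      for h i j k l
      by (rule flat(2)[OF q]) (use h quad_edges[OF q] in blast)+
  qed (use \<alpha> \<beta> L0 dist labels in auto)
  then obtain g where g: "special_omega_with S f 1 (\<lambda>n z. if n = 0 then \<pp> else g z)"
    "\<And>z. z \<in> doubled S \<Longrightarrow> form42 (g z) (g z) = 0 \<and> form42 \<pp> (g z) = -1" by blast
  let ?p = "\<lambda>n z. if n = 0 then \<pp> else g z"
  have "form42 (poly_section 1 ?p t z) (poly_section 1 ?p t z) = - 1 - 2 * 1 * t" if "z \<in> doubled S" for t z
    using g(2)[OF that] lie_frameD(1)[OF frame] form42_commute[of "g z" \<pp>]
    by (simp add: poly_section_def form42_simps)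
  moreover have "edges_generic S f \<pp>" using gen by (simp add: generic_def)
  ultimately show ?thesis using g(1) by (intro exI[of _ ?p] exI[of _ 1]) simp
qed

section \<open>From conserved quantities to Guichard nets\<close>

context framed_net
begin

text \<open>The coefficients of the two spheres along \<open>\<qq>\<close> are forced by nullity and mutual orthogonality.\<close>

lemma X_reconstruct:
  assumes i: "i \<in> S"
  shows "X i = \<oo> + \<pi> (X i) + (form42 (\<pi> (X i)) (\<pi> (X i)) / 2) *\<^sub>R \<qq>"
    and "N i = \<pi> (N i) + \<pp> + form42 (\<pi> (X i)) (\<pi> (N i)) *\<^sub>R \<qq>"
    and "form42 (\<pi> (N i)) (\<pi> (N i)) = 1"
proof -
  note fr = lie_frameD[OF frame]
  note n = X_pp[OF i] X_qq[OF i] N_pp[OF i] N_qq[OF i] null[OF i]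
  have c: "form42 \<pp> (X i) = 0" "form42 \<qq> (X i) = -1" "form42 \<pp> (N i) = -1" "form42 \<qq> (N i) = 0"
    "form42 \<oo> (X i) = form42 (X i) \<oo>" "form42 \<oo> (N i) = form42 (N i) \<oo>"
    using n form42_commute by metis+
  have "form42 (\<pi> (X i)) (\<pi> (X i)) = - 2 * form42 (X i) \<oo>"
    by (simp add: frame_proj_def form42_simps n c fr)
  then show "X i = \<oo> + \<pi> (X i) + (form42 (\<pi> (X i)) (\<pi> (X i)) / 2) *\<^sub>R \<qq>"
    using frame_decomposition[of "X i" \<pp> \<oo> \<qq>] n by (simp add: algebra_simps)
  have "form42 (\<pi> (X i)) (\<pi> (N i)) = - form42 (N i) \<oo>"
    by (simp add: frame_proj_def form42_simps n c fr)
  then show "N i = \<pi> (N i) + \<pp> + form42 (\<pi> (X i)) (\<pi> (N i)) *\<^sub>R \<qq>"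
    using frame_decomposition[of "N i" \<pp> \<oo> \<qq>] n by (simp add: algebra_simps)
  show "form42 (\<pi> (N i)) (\<pi> (N i)) = 1"
    by (simp add: frame_proj_def form42_simps n c fr)
qed

lemma proj_X_distinct:
  assumes e: "edge S i j" shows "\<pi> (X i) \<noteq> \<pi> (X j)"
  using X_distinct[OF e] X_reconstruct(1)[OF edge_mem(1)[OF e]] X_reconstruct(1)[OF edge_mem(2)[OF e]]
  by auto

lemma X_product:
  assumes "i \<in> S" "j \<in> S"
  shows "form42 (X i) (X j) = - form42 (\<pi> (X j) - \<pi> (X i)) (\<pi> (X j) - \<pi> (X i)) / 2"
proof -
  let ?d = "X j - X i"
  have d: "form42 ?d \<pp> = 0" "form42 ?d \<qq> = 0"
    using X_pp X_qq assms by (simp_all add: form42_simps)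
  then have "\<pi> ?d = ?d + form42 ?d \<oo> *\<^sub>R \<qq>" by (simp add: frame_proj_def)
  then have "form42 (\<pi> ?d) (\<pi> ?d) = form42 ?d ?d"
    using d(2) lie_frameD[OF frame] form42_commute[of \<qq> ?d] by (simp only: form42_add_left
        form42_add_right form42_scale_left form42_scale_right) simp
  also have "\<dots> = - 2 * form42 (X i) (X j)"
    using null assms form42_commute[of "X j" "X i"] by (simp add: form42_simps)
  finally show ?thesis by (simp add: frame_proj_linear)
qed

lemma framed_lifts:
  assumes k: "\<And>i j. edge S i j \<Longrightarrow> kap i j \<noteq> 0"
  shows "principal_net S \<pp> \<oo> \<qq> (\<lambda>i. \<pi> (X i)) (\<lambda>i. \<pi> (N i))"
    and "lifts S \<pp> \<oo> \<qq> f (\<lambda>i. \<pi> (X i)) (\<lambda>i. \<pi> (N i))"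
    and "generic S f \<pp> \<qq>"
proof -
  have "kap i j *\<^sub>R \<pi> (X i) + \<pi> (N i) = kap i j *\<^sub>R \<pi> (X j) + \<pi> (N j)" if "edge S i j" for i j
    using arg_cong[OF kap[OF that], of \<pi>] by (simp only: frame_proj_linear)
  then show "principal_net S \<pp> \<oo> \<qq> (\<lambda>i. \<pi> (X i)) (\<lambda>i. \<pi> (N i))"
    using k frame_proj_perp[OF frame] X_reconstruct(3) unfolding principal_net_def by blast
  show "lifts S \<pp> \<oo> \<qq> f (\<lambda>i. \<pi> (X i)) (\<lambda>i. \<pi> (N i))"
    unfolding lifts_def using plane X_reconstruct(1,2) by simp
  have "v = 0" if i: "i \<in> S" and v: "v \<in> perp (f i)" "v \<in> span {\<pp>, \<qq>}" for i v
  proof -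
    obtain a b where ab: "v = a *\<^sub>R \<pp> + b *\<^sub>R \<qq>"
      using v(2) by (auto simp: span_insert span_singleton algebra_simps)
    have "form42 (X i) v = 0" "form42 (N i) v = 0" using v(1) X_in[OF i] N_in[OF i] by (auto simp: perp_def)
    then show ?thesis using X_pp[OF i] X_qq[OF i] N_pp[OF i] N_qq[OF i] by (simp add: ab form42_simps)
  qed
  moreover have "0 \<in> perp U" for U by (simp add: perp_def form42_simps)
  moreover have "\<not> f i \<inter> f j \<subseteq> perp {\<pp>}" "\<not> f i \<inter> f j \<subseteq> perp {\<qq>}" if e: "edge S i j" for i j
  proof -
    have "sig i j \<in> f i"
      using edge_mem[OF e] by (simp add: plane sig_def span_add span_scale span_base)
    moreover have "sig i j \<in> f j"
      using edge_mem[OF e] by (simp add: plane sig_eq(1)[OF e] span_add span_scale span_base)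
    moreover have "form42 \<pp> (sig i j) = -1" "form42 \<qq> (sig i j) = - kap i j"
      using X_pp X_qq N_pp N_qq edge_mem[OF e] form42_commute[of _ "sig i j"]
      by (simp_all add: sig_def form42_simps)
    ultimately show "\<not> f i \<inter> f j \<subseteq> perp {\<pp>}" "\<not> f i \<inter> f j \<subseteq> perp {\<qq>}"
      using k[OF e] by (auto simp: perp_def)
  qed
  ultimately show "generic S f \<pp> \<qq>"
    unfolding generic_def edges_generic_def by (auto simp: span_zero)
qed

text \<open>A closed bivector-valued 1-form of the shape \<open>\<rho> X \<and> X + N \<and> N\<close> yields an associate net: its
  contraction with \<open>\<qq>\<close> integrates, and its Euclidean part is the mixed area condition.\<close>

lemma associate_from_closed:
  assumes sc: "simply_connected_domain S" and closed: "closed_form S \<eta>"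
    and omega_form: "\<And>i j. edge S i j \<Longrightarrow> \<eta> j i = omega_form \<rho> j i"
  shows "\<exists>y. guichard_associate S \<pp> \<oo> \<qq> (\<lambda>i. \<pi> (X i)) (\<lambda>i. \<pi> (N i)) y \<and>
    (\<forall>i j. edge S i j \<longrightarrow> df y j i = \<rho> i j *\<^sub>R df (\<lambda>i. \<pi> (X i)) j i)"
proof -
  let ?x = "\<lambda>i. \<pi> (X i)" and ?n = "\<lambda>i. \<pi> (N i)"
  define \<omega> where "\<omega> j i = \<pi> (blinfun_apply (\<eta> j i) \<qq>)" for j i
  have \<omega>: "\<omega> j i = \<rho> i j *\<^sub>R df ?x j i" if e: "edge S i j" for i j
    using X_qq N_qq edge_mem[OF e]
    by (simp add: \<omega>_def omega_form[OF e] omega_form_def blinfun_left_simps wedge_apply df_def frame_proj_linear)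
  have "closed_form S \<omega>"
    unfolding closed_form_def
  proof (intro conjI allI impI)
    show "\<omega> j i = - \<omega> i j" if "edge S i j" for i j
    proof -
      have "\<eta> j i = - 1 *\<^sub>R \<eta> i j" using closed that by (simp add: closed_form_def)
      then have "\<omega> j i = \<pi> (- 1 *\<^sub>R blinfun_apply (\<eta> i j) \<qq>)"
        unfolding \<omega>_def by (simp only: blinfun.scaleR_left)
      then show ?thesis by (simp only: frame_proj_linear) (simp add: \<omega>_def)
    qed
    show "\<omega> i l + \<omega> l k + \<omega> k j + \<omega> j i = 0" if "quad S i j k l" for i j k l
    proof -
      have "\<eta> i l + \<eta> l k + \<eta> k j + \<eta> j i = 0" using closed that unfolding closed_form_def by blast
      then have "\<pi> (blinfun_apply (\<eta> i l + \<eta> l k + \<eta> k j + \<eta> j i) \<qq>) = 0"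
        by (simp add: frame_proj_linear)
      then show ?thesis by (simp add: \<omega>_def blinfun_left_simps frame_proj_linear)
    qed
  qed
  then obtain y0 where y0: "\<And>i j. edge S i j \<Longrightarrow> df y0 j i = \<omega> j i"
    using closed_form_exact[OF sc] by metis
  \<comment> \<open>The potential is determined up to a constant only; projecting it puts its values into
    Euclidean space.\<close>
  define y where "y i = \<pi> (y0 i)" for i
  have dy: "df y j i = \<rho> i j *\<^sub>R df ?x j i" if e: "edge S i j" for i j
  proof -
    have "df y j i = \<pi> (df y0 j i)" by (simp add: df_def y_def frame_proj_linear)
    also have "\<dots> = \<pi> (\<rho> i j *\<^sub>R df ?x j i)" unfolding y0[OF e] \<omega>[OF e] ..
    also have "\<dots> = \<rho> i j *\<^sub>R (\<pi> (\<pi> (X j)) - \<pi> (\<pi> (X i)))"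
      by (simp only: df_def frame_proj_linear)
    finally show ?thesis using frame_proj_fixes[OF frame_proj_perp[OF frame]] by (simp add: df_def)
  qed
  have "guichard_associate S \<pp> \<oo> \<qq> ?x ?n y"
    unfolding guichard_associate_def
  proof (intro conjI allI impI ballI)
    show "y i \<in> perp {\<pp>, \<oo>, \<qq>}" for i unfolding y_def by (rule frame_proj_perp[OF frame])
    show "\<exists>r. df y i j = r *\<^sub>R df ?x i j" if "edge S i j" for i j
      using dy[OF edge_sym[OF that]] by blast
    fix i j k l assume q: "quad S i j k l"
    note E = quad_edges[OF q]
    have "omega_form \<rho> i l + omega_form \<rho> l k + omega_form \<rho> k j + omega_form \<rho> j i = 0"
      using closed q omega_form[OF E(1)] omega_form[OF E(2)] omega_form[OF E(3)] omega_form[OF E(4)]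
      unfolding closed_form_def by metis
    then have zero: "form42 (blinfun_apply (omega_form \<rho> i l + omega_form \<rho> l k + omega_form \<rho> k j + omega_form \<rho> j i) (\<pi> u)) (\<pi> v) = 0"
      for u v by (simp add: form42_simps)
    have "(\<rho> l i *\<^sub>R wedge (?x i) (?x l) + wedge (?n i) (?n l))
        + (\<rho> k l *\<^sub>R wedge (?x l) (?x k) + wedge (?n l) (?n k))
        + (\<rho> j k *\<^sub>R wedge (?x k) (?x j) + wedge (?n k) (?n j))
        + (\<rho> i j *\<^sub>R wedge (?x j) (?x i) + wedge (?n j) (?n i)) = 0"
      by (rule bivector_eqI)
         (use zero in \<open>simp add: omega_form_def blinfun_left_simps form42_simps wedge_frame_proj\<close>)
    moreover note closure_mixed_area[where x = ?x and n = ?n,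
        OF dy[OF E(1), unfolded df_def] dy[OF E(2), unfolded df_def]
        dy[OF E(3), unfolded df_def] dy[OF E(4), unfolded df_def]]
    ultimately have "- (form_wedge (df y) (df ?x) l k j i + form_wedge (df ?n) (df ?n) l k j i) = 0"
      by (simp only:)
    then show "form_wedge (df y) (df ?x) l k j i + form_wedge (df ?n) (df ?n) l k j i = 0"
      by (simp only: neg_equal_0_iff_equal)
  qed
  then show ?thesis using dy by blast
qed

text \<open>Three points on a line would put \<open>\<qq>\<close> into the span of their point spheres, which \<open>w\<close> excludes.\<close>

lemma not_collinear:
  assumes q: "quad S i j k l"
    and w: "form42 w (X i) = 0" "form42 w (X j) = 0" "form42 w (X k) = 0" "form42 w \<qq> \<noteq> 0"
  shows "\<not> collinear {\<pi> (X i), \<pi> (X j), \<pi> (X k), \<pi> (X l)}"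
proof
  note E = quad_edges[OF q]
  have S: "i \<in> S" "j \<in> S" "k \<in> S" using edge_mem E by blast+
  assume "collinear {\<pi> (X i), \<pi> (X j), \<pi> (X k), \<pi> (X l)}"
  then obtain u where u: "\<And>a b. a \<in> {\<pi> (X i), \<pi> (X j), \<pi> (X k), \<pi> (X l)} \<Longrightarrow>
    b \<in> {\<pi> (X i), \<pi> (X j), \<pi> (X k), \<pi> (X l)} \<Longrightarrow> \<exists>c. a - b = c *\<^sub>R u"
    unfolding collinear_def by blast
  obtain r s where rs: "\<pi> (X j) - \<pi> (X i) = r *\<^sub>R u" "\<pi> (X k) - \<pi> (X i) = s *\<^sub>R u"
    using u by (meson insertCI)
  have r: "r \<noteq> 0" using rs(1) proj_X_distinct[OF E(1)] by auto
  define v where "v = r *\<^sub>R (X k - X i) - s *\<^sub>R (X j - X i)"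
  have "\<pi> v = r *\<^sub>R (\<pi> (X k) - \<pi> (X i)) - s *\<^sub>R (\<pi> (X j) - \<pi> (X i))"
    by (simp only: v_def frame_proj_linear)
  then have "\<pi> v = 0" unfolding rs by simp
  moreover have "form42 v \<pp> = 0" "form42 v \<qq> = 0" using X_pp X_qq S by (simp_all add: v_def form42_simps)
  ultimately have v: "v = - form42 v \<oo> *\<^sub>R \<qq>" using frame_decomposition[of v \<pp> \<oo> \<qq>] by simp
  have "form42 w v = 0" using w by (simp add: v_def form42_simps)
  then have "form42 v \<oo> = 0" using w(4) by (subst (asm) v) (simp add: form42_simps)
  then have "v = 0" using v by simp
  then have Xk: "X k = (s / r) *\<^sub>R X j + ((r - s) / r) *\<^sub>R X i"
  proof -
    have "r *\<^sub>R X k = s *\<^sub>R X j + (r - s) *\<^sub>R X i"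
      using \<open>v = 0\<close> by (simp add: v_def algebra_simps)
    then have "X k = (1 / r) *\<^sub>R (s *\<^sub>R X j + (r - s) *\<^sub>R X i)" using r
      by (metis divideR_right inverse_eq_divide)
    then show ?thesis using r by (simp add: scaleR_add_right)
  qed
  have "s / r = 0 \<or> (r - s) / r = 0"
    by (rule null_in_hyperbolic_plane[OF Xk null(1)[OF S(2)] null(1)[OF S(1)] null(1)[OF S(3)]])
       (rule X_nonorth[OF edge_sym[OF E(1)]])
  then have "X k = X i \<or> X k = X j" using Xk r by auto
  then show False using X_opposite_distinct[OF q] X_distinct[OF E(2)] by auto
qed

text \<open>In terms of \<open>X i\<close>, \<open>X j\<close> and the curvature sphere, the bivector \<open>v \<and> u\<close> has three coefficients.
  Contraction with \<open>\<pp>\<close> determines two of them; the third defines \<open>\<rho>\<close>. It does not vanish because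
  neither factor lies on the curvature sphere.\<close>

lemma isothermic_edge_form:
  assumes e: "edge S i j" and u: "u \<in> f i" and v: "v \<in> f j" and c: "c \<noteq> 0"
    and cq: "blinfun_apply (wedge v u) \<pp> = c *\<^sub>R ((N j + b *\<^sub>R X j) - (N i + a *\<^sub>R X i))"
    and off: "u \<notin> f j" "v \<notin> f i"
  shows "\<exists>\<rho>. (1 / c) *\<^sub>R wedge v u = (\<rho> *\<^sub>R wedge (X j) (X i) + wedge (N j) (N i))
      + b *\<^sub>R wedge (X j) (N j) - a *\<^sub>R wedge (X i) (N i) \<and>
    \<rho> + (kap i j)\<^sup>2 \<noteq> 0 \<and> form42 u v = c * (\<rho> + (kap i j)\<^sup>2) * form42 (X i) (X j)"
proof -
  note S = edge_mem[OF e]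
  let ?s = "sig i j" and ?k = "kap i j"
  have Ni: "N i = ?s - ?k *\<^sub>R X i" and Nj: "N j = ?s - ?k *\<^sub>R X j"
    using sig_eq(1)[OF e] sig_def[of i j] by (metis add_diff_cancel_left')+
  have coord: "\<exists>r t. w = r *\<^sub>R X m + t *\<^sub>R ?s"
    if w: "w \<in> f m" "m \<in> S" and Nm: "N m = ?s - ?k *\<^sub>R X m" for w m
  proof -
    obtain r t where "w = r *\<^sub>R X m + t *\<^sub>R N m" using plane_element[OF w(2,1)] by blast
    then have "w = (r - t * ?k) *\<^sub>R X m + t *\<^sub>R ?s" by (simp add: Nm algebra_simps)
    then show ?thesis by blast
  qed
  obtain a1 b1 where u': "u = a1 *\<^sub>R X i + b1 *\<^sub>R ?s" using coord[OF u S(1) Ni] by blast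
  obtain a2 b2 where v': "v = a2 *\<^sub>R X j + b2 *\<^sub>R ?s" using coord[OF v S(2) Nj] by blast
  have s: "?s \<in> f i" "?s \<in> f j"
    using S by (simp_all add: plane sig_def span_add span_scale span_base)
      (simp_all add: plane sig_eq(1)[OF e, unfolded sig_def] span_add span_scale span_base)
  have sub: "subspace (f i)" "subspace (f j)" using S by (simp_all add: plane)
  have a12: "a1 \<noteq> 0" "a2 \<noteq> 0"
    using off s sub by (auto simp: u' v' subspace_scale)
  have sp: "form42 ?s \<pp> = -1" using X_pp N_pp S by (simp add: sig_def form42_simps)
  have "(a2 * b1 - c * (b - ?k)) *\<^sub>R X j - (b2 * a1 - c * (a - ?k)) *\<^sub>R X i
      = blinfun_apply (wedge v u) \<pp> - c *\<^sub>R ((N j + b *\<^sub>R X j) - (N i + a *\<^sub>R X i))"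
    using X_pp S sp by (simp add: u' v' Ni Nj wedge_apply form42_simps algebra_simps)
  then have z: "(a2 * b1 - c * (b - ?k)) *\<^sub>R X j - (b2 * a1 - c * (a - ?k)) *\<^sub>R X i = 0"
    using cq by simp
  have "form42 (X i) ((a2 * b1 - c * (b - ?k)) *\<^sub>R X j - (b2 * a1 - c * (a - ?k)) *\<^sub>R X i) = 0"
    "form42 ((a2 * b1 - c * (b - ?k)) *\<^sub>R X j - (b2 * a1 - c * (a - ?k)) *\<^sub>R X i) (X j) = 0"
    unfolding z by (simp_all add: form42_simps)
  then have b12: "a2 * b1 = c * (b - ?k)" "b2 * a1 = c * (a - ?k)"
    using null S X_nonorth[OF e] by (simp_all add: form42_simps)
  define \<rho> where "\<rho> = a1 * a2 / c - ?k\<^sup>2"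
  have "wedge v u = (a1 * a2) *\<^sub>R wedge (X j) (X i) + (a2 * b1) *\<^sub>R wedge (X j) ?s
      - (b2 * a1) *\<^sub>R wedge (X i) ?s"
    using wedge_anticommute[of ?s "X i"] by (simp add: u' v' wedge_simps algebra_simps)
  also have "\<dots> = (c * (\<rho> + ?k\<^sup>2)) *\<^sub>R wedge (X j) (X i) + (c * (b - ?k)) *\<^sub>R wedge (X j) ?s
      - (c * (a - ?k)) *\<^sub>R wedge (X i) ?s"
    using c by (simp add: b12 \<rho>_def)
  finally have "(1 / c) *\<^sub>R wedge v u = (\<rho> + ?k\<^sup>2) *\<^sub>R wedge (X j) (X i) + (b - ?k) *\<^sub>R wedge (X j) ?s
      - (a - ?k) *\<^sub>R wedge (X i) ?s"
    using c by (simp add: scaleR_add_right scaleR_diff_right)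
  also have "\<dots> = (\<rho> *\<^sub>R wedge (X j) (X i) + wedge (N j) (N i))
      + b *\<^sub>R wedge (X j) (N j) - a *\<^sub>R wedge (X i) (N i)"
    using wedge_anticommute[of ?s "X i"]
    by (simp add: Ni Nj wedge_simps algebra_simps power2_eq_square)
  finally have "(1 / c) *\<^sub>R wedge v u = (\<rho> *\<^sub>R wedge (X j) (X i) + wedge (N j) (N i))
      + b *\<^sub>R wedge (X j) (N j) - a *\<^sub>R wedge (X i) (N i)" .
  moreover have "\<rho> + ?k\<^sup>2 \<noteq> 0" using a12 c by (simp add: \<rho>_def)
  moreover have "form42 u v = c * (\<rho> + ?k\<^sup>2) * form42 (X i) (X j)"
  proof -
    have "form42 ?s ?s = 0" "form42 (X i) ?s = 0" using null S by (simp_all add: sig_def form42_simps)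
    moreover have "form42 ?s (X j) = 0" using null S by (simp add: sig_eq(1)[OF e] form42_simps)
    ultimately show ?thesis using c by (simp add: u' v' form42_simps \<rho>_def)
  qed
  ultimately show ?thesis by blast
qed

end

text \<open>Evaluated at a null vector on \<open>s j\<close>, the closing condition has the difference of the inverse labels
  of the two edges at \<open>j\<close> as the coefficient of this vector. If it vanished, the null line \<open>s l\<close> would lie
  in the hyperbolic plane of \<open>s i\<close> and \<open>s k\<close>.\<close>

lemma isothermic_adjacent_labels:
  assumes iso: "isothermic_with D s \<eta>" and q: "quad D i j k l"
    and ij: "\<eta> j i = wedge v u" "u \<in> s i" "v \<in> s j"
    and jk: "\<eta> k j = wedge v' u'" "u' \<in> s j" "v' \<in> s k"
  shows "form42 u v \<noteq> form42 u' v'"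
proof
  assume eq: "form42 u v = form42 u' v'"
  note E = quad_edges[OF q]
  have D: "i \<in> D" "j \<in> D" "k \<in> D" "l \<in> D" using edge_mem E by blast+
  have lines: "s a \<in> null_lines" if "a \<in> D" for a using iso that by (simp add: isothermic_with_def)
  have nz: "\<eta> j i \<noteq> 0" "\<eta> k j \<noteq> 0" "\<eta> l k \<noteq> 0" "\<eta> i l \<noteq> 0"
    using iso E by (auto simp: isothermic_with_def)
  obtain l1 k1 where lk: "\<eta> l k = wedge l1 k1" "l1 \<in> s l" "k1 \<in> s k"
    using iso E(3) unfolding isothermic_with_def by blast
  obtain i1 l2 where il: "\<eta> i l = wedge i1 l2" "i1 \<in> s i" "l2 \<in> s l"
    using iso E(4) unfolding isothermic_with_def by blast
  have n: "v \<noteq> 0" "l1 \<noteq> 0" "i1 \<noteq> 0" "k1 \<noteq> 0" "l2 \<noteq> 0"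
    using nz ij jk lk il by (auto simp: wedge_simps)
  have sj: "s j = span {v}" by (rule null_line_span[OF lines[OF D(2)] ij(3) n(1)])
  have sl: "s l = span {l1}" by (rule null_line_span[OF lines[OF D(4)] lk(2) n(2)])
  have si: "s i = span {i1}" by (rule null_line_span[OF lines[OF D(1)] il(2) n(3)])
  have sk: "s k = span {k1}" by (rule null_line_span[OF lines[OF D(3)] lk(3) n(4)])
  have null: "form42 v v = 0" "form42 l1 l1 = 0" "form42 i1 i1 = 0" "form42 k1 k1 = 0"
    using lines D ij lk il by (auto simp: null_lines_def)
  obtain t where t: "u' = t *\<^sub>R v" using jk(2) by (auto simp: sj span_singleton)
  obtain r where r: "l2 = r *\<^sub>R l1" using il(3) by (auto simp: sl span_singleton)
  have "r \<noteq> 0" using r n by auto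
  have "\<not> s i \<subseteq> perp (s k)" "\<not> s j \<subseteq> perp (s l)"
    using iso q unfolding isothermic_with_def isothermic_regular_def by blast+
  then have diag: "form42 l1 v \<noteq> 0" "form42 k1 i1 \<noteq> 0"
    by (auto simp: si sj sk sl perp_def span_singleton form42_simps)
  have "\<eta> i l + \<eta> l k + \<eta> k j + \<eta> j i = 0"
    using iso q unfolding isothermic_with_def closed_form_def by blast
  then have "blinfun_apply (wedge i1 (r *\<^sub>R l1) + wedge l1 k1 + wedge v' (t *\<^sub>R v) + wedge v u) v = 0"
    by (simp add: ij jk lk il t r)
  then have "form42 l1 v *\<^sub>R (k1 - r *\<^sub>R i1) - form42 (k1 - r *\<^sub>R i1) v *\<^sub>R l1
      = (form42 u v - t * form42 v' v) *\<^sub>R v"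
    using null(1) by (simp add: blinfun_left_simps wedge_apply form42_simps algebra_simps)
  moreover have "form42 u v = t * form42 v' v"
    using eq form42_commute[of v v'] by (simp add: t form42_simps)
  ultimately have "form42 l1 v *\<^sub>R (k1 - r *\<^sub>R i1) = form42 (k1 - r *\<^sub>R i1) v *\<^sub>R l1" by simp
  then have "k1 - r *\<^sub>R i1 = (1 / form42 l1 v) *\<^sub>R (form42 (k1 - r *\<^sub>R i1) v *\<^sub>R l1)"
    using diag(1) by (metis divideR_right inverse_eq_divide)
  then obtain m where m: "k1 - r *\<^sub>R i1 = m *\<^sub>R l1" by (metis scaleR_scaleR)
  have "m \<noteq> 0"
  proof
    assume "m = 0"
    then have "k1 = r *\<^sub>R i1" using m by simp
    then show False using diag(2) null(3) by (simp add: form42_simps)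
  qed
  then have l1: "l1 = (1 / m) *\<^sub>R k1 + (- r / m) *\<^sub>R i1"
  proof -
    have "l1 = (1 / m) *\<^sub>R (k1 - r *\<^sub>R i1)" using m \<open>m \<noteq> 0\<close> by simp
    then show ?thesis by (simp add: scaleR_diff_right)
  qed
  have "1 / m = 0 \<or> - r / m = 0"
    by (rule null_in_hyperbolic_plane[OF l1 null(4,3,2) diag(2)])
  then show False using \<open>m \<noteq> 0\<close> \<open>r \<noteq> 0\<close> by simp
qed

text \<open>The constant part of the conserved quantity is the point sphere complex. Its linear part \<open>P\<close> is
  null, and the vertical edges force it into the null planes, so \<open>P\<close> provides in each plane a vector
  that is not orthogonal to \<open>\<pp>\<close>. The vector \<open>\<qq>\<close> is chosen last, in general position.\<close>

theorem special_omega_imp_guichard: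
  fixes S :: "(int ^ 'n) set"
  assumes sc: "simply_connected_domain S" and omega: "omega_net S f" and c: "c \<noteq> 0"
    and special: "special_omega_with S f 1 p"
    and norm: "\<And>z t. z \<in> doubled S \<Longrightarrow>
      form42 (poly_section 1 p t z) (poly_section 1 p t z) = - 1 - 2 * c * t"
    and gen: "\<And>z. z \<in> doubled S \<Longrightarrow> edges_generic S f (p 0 z)"
  shows "lifts_guichard S f"
proof -
  obtain sp sm \<eta> where sf: "\<And>i. i \<in> S \<Longrightarrow> f i = span (sp i \<union> sm i)"
    and iso: "isothermic_with (doubled S) (join sp sm) \<eta>"
    and cons: "conserved_quantity (doubled S) (join sp sm) \<eta> 1 p"
    using special unfolding special_omega_with_def by blast
  obtain b where b: "b \<in> S" using sc by (auto simp: simply_connected_domain_def)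
  let ?l = "level_pt 0" and ?m = "level_pt 1" and ?s = "join sp sm"
  have D: "?l i \<in> doubled S" "?m i \<in> doubled S" if "i \<in> S" for i using that by (simp_all add: level_pt_doubled)
  have planes: "f i \<in> null_planes" if "i \<in> S" for i using omega that by (simp add: omega_net_def)
  have iso_null: "form42 v w = 0" if "i \<in> S" "v \<in> f i" "w \<in> f i" for i v w
    using planes[OF that(1)] that by (auto simp: null_planes_def)
  have sub: "sp i \<subseteq> f i" "sm i \<subseteq> f i" if "i \<in> S" for i
    using span_superset[of "sp i \<union> sm i"] by (simp_all add: sf[OF that])
  have dec: "\<exists>v\<in>?s w. \<exists>u\<in>?s z. \<eta> w z = wedge v u" if "edge (doubled S) z w" for z w
    using iso that unfolding isothermic_with_def by blast
  have eta0: "\<eta> w z \<noteq> 0" if "edge (doubled S) z w" for z w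
    using iso that unfolding isothermic_with_def by blast
  define \<pp> where "\<pp> = p 0 (?l b)"
  have p0: "p 0 (?l i) = \<pp>" if "i \<in> S" for i
  proof (rule simply_connected_induct[OF sc b that])
    show "p 0 (?l b) = \<pp>" by (simp add: \<pp>_def)
    show "p 0 (?l j) = \<pp>" if e: "edge S i j" and i: "p 0 (?l i) = \<pp>" for i j
    proof -
      have E: "edge (doubled S) (?l i) (?l j)" by (rule level_edge[OF e]) simp
      then obtain v u where "u \<in> ?s (?l i)" "v \<in> ?s (?l j)" "\<eta> (?l j) (?l i) = wedge v u"
        using dec by blast
      then show ?thesis using linear_conserved_quantityD(1)[OF iso cons E] i by simp
    qed
  qed
  define P where "P i = p 1 (?l i)" for i
  have products: "form42 \<pp> \<pp> = -1" "form42 (P i) \<pp> = - c" "form42 (P i) (P i) = 0" if i: "i \<in> S" for i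
  proof -
    have e: "form42 \<pp> \<pp> + 2 * t * form42 (P i) \<pp> + t * t * form42 (P i) (P i) = - 1 - 2 * c * t" for t
    proof -
      have "poly_section 1 p t (?l i) = \<pp> + t *\<^sub>R P i"
        using p0[OF i] by (simp add: poly_section_def P_def)
      then have "form42 (\<pp> + t *\<^sub>R P i) (\<pp> + t *\<^sub>R P i) = - 1 - 2 * c * t"
        using norm[OF D(1)[OF i], of t] by simp
      moreover have "form42 (\<pp> + t *\<^sub>R P i) (\<pp> + t *\<^sub>R P i)
          = form42 \<pp> \<pp> + 2 * t * form42 (P i) \<pp> + t * t * form42 (P i) (P i)"
        by (simp add: form42_simps form42_commute[of \<pp> "P i"] algebra_simps)
      ultimately show ?thesis by simp
    qed
    show "form42 \<pp> \<pp> = -1" "form42 (P i) \<pp> = - c" "form42 (P i) (P i) = 0"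
      using e[of 0] e[of 1] e[of "-1"] by simp_all
  qed
  have PF: "P i \<in> f i" if i: "i \<in> S" for i
  proof -
    have E: "edge (doubled S) (?l i) (?m i)" by (rule vertical_edge[OF i])
    obtain v u where uv: "u \<in> ?s (?l i)" "v \<in> ?s (?m i)" "\<eta> (?m i) (?l i) = wedge v u"
      using dec[OF E] by blast
    then have F: "u \<in> f i" "v \<in> f i" using sub[OF i] by (auto simp: join_level_pt)
    then have "form42 u (P i) = 0 \<and> form42 v (P i) = 0"
      unfolding P_def by (intro linear_conserved_quantityD(3)[OF iso cons E uv] iso_null[OF i])
    then show ?thesis
      using null_plane_maximal[OF planes[OF i] F] products(3)[OF i] eta0[OF E] uv(3) by simp
  qed
  define G where "G i = (1 / c) *\<^sub>R P i" for i
  have G: "G i \<in> f i" "form42 (G i) \<pp> = -1" if i: "i \<in> S" for i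
    using PF[OF i] products[OF i] planes[OF i] c
    by (simp_all add: G_def form42_simps null_planes_def subspace_scale)
  have pp: "form42 \<pp> \<pp> = -1" using products(1)[OF b] .
  define X0 where "X0 i = (SOME x. x \<noteq> 0 \<and> form42 x \<pp> = 0 \<and> f i = span {x, G i})" for i
  have X0: "X0 i \<noteq> 0" "form42 (X0 i) \<pp> = 0" "f i = span {X0 i, G i}" if i: "i \<in> S" for i
  proof -
    have "X0 i \<noteq> 0 \<and> form42 (X0 i) \<pp> = 0 \<and> f i = span {X0 i, G i}"
      unfolding X0_def
      by (rule someI_ex) (rule null_plane_basis[OF planes[OF i] G[OF i] pp])
    then show "X0 i \<noteq> 0" "form42 (X0 i) \<pp> = 0" "f i = span {X0 i, G i}" by auto
  qed
  have "\<forall>i j. edge S i j \<longrightarrow> (\<exists>v. v \<in> f i \<inter> f j \<and> form42 v \<pp> \<noteq> 0)"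
  proof (intro allI impI)
    fix i j assume e: "edge S i j"
    have "edges_generic S f \<pp>" using gen[OF D(1)[OF b]] by (simp add: \<pp>_def)
    then have "\<not> f i \<inter> f j \<subseteq> perp {\<pp>}" using e by (simp add: edges_generic_def)
    then show "\<exists>v. v \<in> f i \<inter> f j \<and> form42 v \<pp> \<noteq> 0"
      by (auto simp: perp_def form42_commute[of _ \<pp>])
  qed
  then obtain s where s: "\<And>i j. edge S i j \<Longrightarrow> s i j \<in> f i \<inter> f j \<and> form42 (s i j) \<pp> \<noteq> 0" by metis
  have "\<exists>w. w \<noteq> 0 \<and> (\<forall>a\<in>{\<pp>, X0 i, X0 j, X0 k}. form42 a w = 0)" for i j k
    by (rule exists_orthogonal) (auto simp: card_insert_if)
  then obtain w where w: "\<And>i j k. w i j k \<noteq> 0" "\<And>i j k a. a \<in> {\<pp>, X0 i, X0 j, X0 k} \<Longrightarrow> form42 a (w i j k) = 0"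
    by metis
  \<comment> \<open>The three families of vectors keep \<open>\<qq>\<close> off the complements of the point spheres and of the
    curvature spheres (projected to the complement of \<open>\<pp>\<close>), and out of the spans of the point
    spheres of a quadrilateral, where the points would be collinear.\<close>
  define W where "W = X0 ` S \<union> (\<lambda>(i, j). s i j + form42 (s i j) \<pp> *\<^sub>R \<pp>) ` {(i, j). edge S i j}
    \<union> (\<lambda>(i, j, k). w i j k) ` UNIV"
  have "countable W" unfolding W_def by (intro countable_Un countable_image countableI_type)
  moreover have "v \<noteq> 0 \<and> form42 \<pp> v = 0" if v: "v \<in> W" for v
  proof -
    consider i where "i \<in> S" "v = X0 i"
      | i j where "edge S i j" "v = s i j + form42 (s i j) \<pp> *\<^sub>R \<pp>" | i j k where "v = w i j k"
      using v unfolding W_def by auto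
    then show ?thesis
    proof cases
      case 1
      then show ?thesis using X0 form42_commute[of \<pp>] by simp
    next
      case 2
      have sij: "form42 (s i j) (s i j) = 0" "form42 (s i j) \<pp> \<noteq> 0"
        using s[OF 2(1)] iso_null edge_mem[OF 2(1)] by auto
      have "form42 (s i j) v = (form42 (s i j) \<pp>)\<^sup>2"
        by (simp add: 2(2) form42_simps sij power2_eq_square)
      then have "v \<noteq> 0" using sij by (auto simp: form42_simps)
      moreover have "form42 \<pp> v = 0"
        using pp form42_commute[of \<pp> "s i j"] by (simp add: 2(2) form42_simps)
      ultimately show ?thesis by blast
    next
      case 3
      then show ?thesis using w(1) w(2)[of \<pp>] by simp
    qed
  qed
  ultimately obtain \<qq> where q: "form42 \<qq> \<qq> = 0" "form42 \<pp> \<qq> = 0" and qW: "\<And>v. v \<in> W \<Longrightarrow> form42 \<qq> v \<noteq> 0"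
    using null_vector_in_general_position[OF pp, of W] by blast
  have X0q: "form42 (X0 i) \<qq> \<noteq> 0" if "i \<in> S" for i
    using qW[of "X0 i"] that form42_commute[of \<qq> "X0 i"] by (auto simp: W_def)
  have sq: "form42 (s i j) \<qq> \<noteq> 0" if e: "edge S i j" for i j
  proof -
    have "s i j + form42 (s i j) \<pp> *\<^sub>R \<pp> \<in> W" using e unfolding W_def by (auto intro: image_eqI[of _ _ "(i, j)"])
    from qW[OF this] show ?thesis
      using q form42_commute[of \<qq> "s i j"] form42_commute[of \<qq> \<pp>] by (simp add: form42_simps)
  qed
  have wq: "form42 (w i j k) \<qq> \<noteq> 0" for i j k
  proof -
    have "w i j k \<in> W" unfolding W_def by (auto intro: image_eqI[of _ _ "(i, j, k)"])
    from qW[OF this] show ?thesis using form42_commute[of \<qq> "w i j k"] by simp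
  qed
  define X where "X i = (- 1 / form42 (X0 i) \<qq>) *\<^sub>R X0 i" for i
  define N where "N i = G i + form42 (G i) \<qq> *\<^sub>R X i" for i
  have frames: "form42 (X i) \<pp> = 0" "form42 (X i) \<qq> = -1" "form42 (N i) \<pp> = -1" "form42 (N i) \<qq> = 0"
    if i: "i \<in> S" for i
    using X0[OF i] X0q[OF i] G[OF i] by (simp_all add: X_def N_def form42_simps)
  have spanXN: "f i = span {X i, N i}" if i: "i \<in> S" for i
  proof -
    have "X0 i \<in> f i" by (simp add: X0(3)[OF i] span_base)
    moreover have "subspace (f i)" using planes[OF i] by (simp add: null_planes_def)
    ultimately have XF: "X i \<in> f i" "N i \<in> f i"
      using G(1)[OF i] unfolding X_def N_def by (metis subspace_add subspace_scale)+
    have "X0 i = (- form42 (X0 i) \<qq>) *\<^sub>R X i" using X0q[OF i] by (simp add: X_def)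
    then have "X0 i \<in> span {X i, N i}" by (metis insertI1 span_base span_scale)
    moreover have "G i = N i - form42 (G i) \<qq> *\<^sub>R X i" by (simp add: N_def)
    then have "G i \<in> span {X i, N i}" by (metis insertI1 insertI2 span_base span_diff span_scale)
    ultimately have "f i \<subseteq> span {X i, N i}" by (simp add: X0(3)[OF i] span_minimal)
    moreover have "span {X i, N i} \<subseteq> f i" using XF by (simp add: X0(3)[OF i] span_minimal)
    ultimately show ?thesis by blast
  qed
  have Xb: "form42 (X b) (X b) = 0"
    by (rule iso_null[OF b]) (simp_all add: spanXN[OF b] span_base)
  have sphere: "\<exists>\<kappa>. \<kappa> \<noteq> 0 \<and> \<kappa> *\<^sub>R X i + N i = \<kappa> *\<^sub>R X j + N j" if e: "edge S i j" for i j
  proof -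
    have el: "v = (- form42 v \<qq>) *\<^sub>R X m + (- form42 v \<pp>) *\<^sub>R N m" if m: "m \<in> S" and v: "v \<in> f m" for v m
    proof -
      obtain r t where "v = r *\<^sub>R X m + t *\<^sub>R N m"
        using v by (auto simp: spanXN[OF m] span_insert span_singleton algebra_simps)
      then show ?thesis using frames[OF m] by (simp add: form42_simps)
    qed
    define u v where "u = - form42 (s i j) \<qq>" and "v = - form42 (s i j) \<pp>"
    have nz: "u \<noteq> 0" "v \<noteq> 0" using s[OF e] sq[OF e] by (auto simp: u_def v_def)
    have eq: "u *\<^sub>R X i + v *\<^sub>R N i = u *\<^sub>R X j + v *\<^sub>R N j"
      using el s[OF e] edge_mem[OF e] unfolding u_def v_def by (metis IntD1 IntD2)
    have "(u / v) *\<^sub>R X m + N m = (1 / v) *\<^sub>R (u *\<^sub>R X m + v *\<^sub>R N m)" for m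
      using nz by (simp add: scaleR_add_right)
    then have "(u / v) *\<^sub>R X i + N i = (u / v) *\<^sub>R X j + N j" using eq by simp
    then show ?thesis using nz by (intro exI[of _ "u / v"]) simp
  qed
  interpret framed_net S f \<pp> "X b" \<qq> X N
  proof
    show "lie_frame \<pp> (X b) \<qq>"
      using pp q Xb frames[OF b] form42_commute[of \<pp> \<qq>] by (simp add: lie_frame_def)
    show "\<exists>\<kappa>. \<kappa> *\<^sub>R X i + N i = \<kappa> *\<^sub>R X j + N j" if "edge S i j" for i j
      using sphere[OF that] by blast
  qed (use omega spanXN frames in auto)
  have kap0: "kap i j \<noteq> 0" if e: "edge S i j" for i j
    using sphere[OF e] kap_unique[OF e] by blast
  define a where "a i = - form42 (G i) \<qq>" for i
  have Ga: "G i = N i + a i *\<^sub>R X i" for i by (simp add: N_def a_def)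
  define Q where "Q i j r \<longleftrightarrow> (\<exists>u v. u \<in> sp i \<and> v \<in> sp j \<and> \<eta> (?l j) (?l i) = wedge v u \<and>
    (1 / c) *\<^sub>R wedge v u = (r *\<^sub>R wedge (X j) (X i) + wedge (N j) (N i))
      + a j *\<^sub>R wedge (X j) (N j) - a i *\<^sub>R wedge (X i) (N i) \<and>
    r + (kap i j)\<^sup>2 \<noteq> 0 \<and> form42 u v = c * (r + (kap i j)\<^sup>2) * form42 (X i) (X j))" for i j r
  define \<rho> where "\<rho> i j = (SOME r. Q i j r)" for i j
  have Q: "Q i j (\<rho> i j)" if e: "edge S i j" for i j
    unfolding \<rho>_def
  proof (rule someI_ex)
    note S = edge_mem[OF e]
    have E: "edge (doubled S) (?l i) (?l j)" by (rule level_edge[OF e]) simp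
    obtain v u where uv': "u \<in> ?s (?l i)" "v \<in> ?s (?l j)" "\<eta> (?l j) (?l i) = wedge v u"
      using dec[OF E] by blast
    then have uv: "u \<in> sp i" "v \<in> sp j" by (simp_all add: join_level_pt)
    have nz: "u \<noteq> 0" "v \<noteq> 0" using uv' eta0[OF E] by (auto simp: wedge_simps)
    have F: "u \<in> f i" "v \<in> f j" using uv sub S by auto
    have "isothermic_regular (doubled S) ?s" using iso by (simp add: isothermic_with_def)
    then have reg: "\<not> sp i \<subseteq> perp (sm j)" "\<not> sp j \<subseteq> perp (sm i)"
      using vertical_quad[OF e] unfolding isothermic_regular_def by (metis join_level_pt)+
    have "sp m \<in> null_lines" if "m \<in> S" for m
      using iso D(1)[OF that] by (auto simp: isothermic_with_def join_level_pt dest!: bspec)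
    then have lines: "sp i = span {u}" "sp j = span {v}"
      using null_line_span uv nz S by blast+
    \<comment> \<open>A line in both null planes would be orthogonal to the diagonally opposite line of the vertical
      quadrilateral, against regularity on the doubled domain.\<close>
    have off: "u \<notin> f j" "v \<notin> f i"
    proof -
      have perp: "span {x} \<subseteq> perp (sm m)" if m: "m \<in> S" and x: "x \<in> f m" for x m
      proof
        fix z assume "z \<in> span {x}"
        then obtain k where z: "z = k *\<^sub>R x" by (auto simp: span_singleton)
        have "form42 y z = 0" if "y \<in> sm m" for y
          using iso_null[OF m _ x, of y] that sub(2)[OF m] by (auto simp: z form42_simps)
        then show "z \<in> perp (sm m)" by (simp add: perp_def)
      qed
      have "sp i \<subseteq> perp (sm j)" if "u \<in> f j" using perp[OF S(2) that] lines by simp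
      moreover have "sp j \<subseteq> perp (sm i)" if "v \<in> f i" using perp[OF S(1) that] lines by simp
      ultimately show "u \<notin> f j" "v \<notin> f i" using reg by blast+
    qed
    have "P j = P i + blinfun_apply (wedge v u) \<pp>"
      using linear_conserved_quantityD(2)[OF iso cons E uv'] p0[OF S(1)] uv'(3) by (simp add: P_def)
    moreover have "P m = c *\<^sub>R G m" for m using c by (simp add: G_def)
    ultimately have "blinfun_apply (wedge v u) \<pp> = c *\<^sub>R ((N j + a j *\<^sub>R X j) - (N i + a i *\<^sub>R X i))"
      by (simp flip: Ga add: scaleR_diff_right)
    from isothermic_edge_form[OF e F c this off] show "\<exists>r. Q i j r"
      unfolding Q_def using uv uv'(3) by blast
  qed
  define E0 where "E0 j i = (1 / c) *\<^sub>R \<eta> (?l j) (?l i)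
    - (a j *\<^sub>R wedge (X j) (N j) - a i *\<^sub>R wedge (X i) (N i))" for i j
  have E0: "E0 j i = omega_form \<rho> j i" if "edge S i j" for i j
    using Q[OF that] unfolding Q_def by (auto simp: E0_def omega_form_def)
  have "closed_form S E0"
    unfolding closed_form_def
  proof (intro conjI allI impI)
    have cl: "closed_form (doubled S) \<eta>" using iso by (simp add: isothermic_with_def)
    show "E0 j i = - E0 i j" if "edge S i j" for i j
    proof -
      have "\<eta> (?l j) (?l i) = - \<eta> (?l i) (?l j)"
        using cl level_edge[OF that, of 0] unfolding closed_form_def by simp
      then show ?thesis by (simp add: E0_def)
    qed
    show "E0 i l + E0 l k + E0 k j + E0 j i = 0" if "quad S i j k l" for i j k l
    proof -
      have "\<eta> (?l i) (?l l) + \<eta> (?l l) (?l k) + \<eta> (?l k) (?l j) + \<eta> (?l j) (?l i) = 0"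
        using cl level_quad[OF that, of 0] unfolding closed_form_def by simp
      moreover have "E0 i l + E0 l k + E0 k j + E0 j i = (1 / c) *\<^sub>R
        (\<eta> (?l i) (?l l) + \<eta> (?l l) (?l k) + \<eta> (?l k) (?l j) + \<eta> (?l j) (?l i))"
        by (simp add: E0_def scaleR_add_right)
      ultimately show ?thesis by simp
    qed
  qed
  then obtain y where y: "guichard_associate S \<pp> (X b) \<qq> (\<lambda>i. \<pi> (X i)) (\<lambda>i. \<pi> (N i)) y"
    "\<And>i j. edge S i j \<Longrightarrow> df y j i = \<rho> i j *\<^sub>R df (\<lambda>i. \<pi> (X i)) j i"
    using associate_from_closed[OF sc _ E0] by blast
  let ?x = "\<lambda>i. \<pi> (X i)" and ?n = "\<lambda>i. \<pi> (N i)"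
  have dn: "df ?n j i = - kap i j *\<^sub>R df ?x j i" if e: "edge S i j" for i j
  proof -
    have "N j - N i = - kap i j *\<^sub>R (X j - X i)"
    proof -
      have "N j - N i = (kap i j *\<^sub>R X j + N j) - (kap i j *\<^sub>R X i + N i) - kap i j *\<^sub>R (X j - X i)"
        by (simp add: algebra_simps)
      then show ?thesis using kap[OF e] by simp
    qed
    from arg_cong[OF this, of \<pi>] show ?thesis by (simp only: df_def frame_proj_linear)
  qed
  have nd1: "edge_nondegenerate S ?x ?n y"
    unfolding edge_nondegenerate_def
  proof (intro allI impI)
    fix i j \<kappa> assume *: "edge S i j \<and> \<kappa> \<noteq> 0 \<and> \<kappa> *\<^sub>R ?x i + ?n i = \<kappa> *\<^sub>R ?x j + ?n j"
    then have e: "edge S i j" by blast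
    have dx: "df ?x j i \<noteq> 0" using proj_X_distinct[OF e] by (simp add: df_def)
    have "df ?n j i = - \<kappa> *\<^sub>R df ?x j i"
    proof -
      have "df ?n j i = (\<kappa> *\<^sub>R ?x j + ?n j) - (\<kappa> *\<^sub>R ?x i + ?n i) - \<kappa> *\<^sub>R df ?x j i"
        by (simp add: df_def algebra_simps)
      then show ?thesis using * by simp
    qed
    then have \<kappa>: "\<kappa> = kap i j" using dn[OF e] dx by simp
    show "df y j i \<noteq> \<kappa> *\<^sub>R df ?n j i"
    proof
      assume "df y j i = \<kappa> *\<^sub>R df ?n j i"
      then have "(\<rho> i j + (kap i j)\<^sup>2) *\<^sub>R df ?x j i = 0"
        unfolding \<kappa> dn[OF e] y(2)[OF e] by (simp add: scaleR_add_left power2_eq_square)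
      then show False using Q[OF e] dx unfolding Q_def by auto
    qed
  qed
  have label: "form42 (df y j i) (df ?x j i) + form42 (df ?n j i) (df ?n j i) = - 2 / c * form42 u v"
    if e: "edge S i j" and uv: "form42 u v = c * (\<rho> i j + (kap i j)\<^sup>2) * form42 (X i) (X j)" for i j u v
  proof -
    have "form42 (r *\<^sub>R d) d + form42 (- k *\<^sub>R d) (- k *\<^sub>R d) = (r + k\<^sup>2) * form42 d d" for r k d
      by (simp add: form42_simps power2_eq_square algebra_simps)
    then have "form42 (df y j i) (df ?x j i) + form42 (df ?n j i) (df ?n j i)
        = (\<rho> i j + (kap i j)\<^sup>2) * form42 (df ?x j i) (df ?x j i)"
      unfolding y(2)[OF e] dn[OF e] by blast
    then show ?thesis
      unfolding uv X_product[OF edge_mem[OF e]] df_def using c by simp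
  qed
  have nd2: "quad_nondegenerate S ?x ?n y"
    unfolding quad_nondegenerate_def
  proof (intro allI impI conjI)
    fix i j k l assume qd: "quad S i j k l"
    note E = quad_edges[OF qd]
    have X0w: "form42 (w i j k) (X m) = 0" if "m \<in> {i, j, k}" for m
      using w(2)[of "X0 m" i j k] that form42_commute[of "w i j k" "X0 m"] by (auto simp: X_def form42_simps)
    show "\<not> collinear {?x i, ?x j, ?x k, ?x l}"
      by (rule not_collinear[OF qd, of "w i j k"]) (use X0w wq in auto)
    obtain u v where uv: "u \<in> sp i" "v \<in> sp j" "\<eta> (?l j) (?l i) = wedge v u"
      "form42 u v = c * (\<rho> i j + (kap i j)\<^sup>2) * form42 (X i) (X j)"
      using Q[OF E(1)] unfolding Q_def by blast
    obtain u' v' where uv': "u' \<in> sp j" "v' \<in> sp k" "\<eta> (?l k) (?l j) = wedge v' u'"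
      "form42 u' v' = c * (\<rho> j k + (kap j k)\<^sup>2) * form42 (X j) (X k)"
      using Q[OF E(2)] unfolding Q_def by blast
    have "form42 u v \<noteq> form42 u' v'"
      by (rule isothermic_adjacent_labels[OF iso level_quad[OF qd, of 0]])
         (use uv uv' in \<open>auto simp: join_level_pt\<close>)
    then show "form42 (df y j i) (df ?x j i) + form42 (df ?n j i) (df ?n j i) \<noteq>
      form42 (df y k j) (df ?x k j) + form42 (df ?n k j) (df ?n k j)"
      using c by (simp add: label[OF E(1) uv(4)] label[OF E(2) uv'(4)])
  qed
  show ?thesis
    unfolding lifts_guichard_def
    using frame framed_lifts[OF kap0] y(1) nd1 nd2 by blast
qed

theorem theorem7p11:
  fixes S :: "(int ^ 'n) set" and f :: "int ^ 'n \<Rightarrow> r42 set"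
  assumes "simply_connected_domain S" and "omega_net S f"
  shows "lifts_guichard S f \<longleftrightarrow>
    (\<exists>p c. c \<noteq> 0 \<and> special_omega_with S f 1 p \<and>
       (\<forall>z\<in>doubled S. \<forall>t. form42 (poly_section 1 p t z) (poly_section 1 p t z) = - 1 - 2 * c * t) \<and>
       (\<forall>z\<in>doubled S. edges_generic S f (p 0 z)))"
  using guichard_imp_special_omega[OF assms] special_omega_imp_guichard[OF assms] by blast

end
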